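(* Let $1\le r<n$. The action on prime cyclic words, $T\mapsto (T)\Pi$, gives a representation (group homomorphism) of $\mathrm{Out}(G_{n,r})\cong\mathcal O_{n,r}$ in the symmetric group on the set $\mathsf W_n$ of all prime cyclic words over an alphabet of size $n$. The restriction of this map (for $r=n-1$, i.e. on $\mathcal O_{n,n-1}=\mathcal O_n$) to the subgroup $\mathcal L_n$ is the periodic orbit representation of the group $\mathrm{Aut}(X_n^{\mathbb Z},\sigma_n)/\langle\sigma_n\rangle$, where $\mathcal L_n$ is identified with this quotient by sending $T\in\mathcal L_n$ to the coset of $(T,\alpha)$ for any annotation $\alpha$ of $T$.
   Context: Functions are written on the right of arguments. $G_{n,r}$ is the Higman–Thompson group; it is known that $\mathrm{Out}(G_{n,r})\cong\mathcal O_{n,r}$ (defined below). **Transducers.** $X_n=\{0,\dots,n-1\}$, $n\ge2$; $X_n^*$ is the set of finite words ($\varepsilon$ the empty word), $X_n^+=X_n^*\setminus\{\varepsilon\}$, $X_n^{\mathbb N}$ the set of right-infinite words, $|w|$ the length of $w$. A transducer is $T=(X_n,Q_T,\pi_T,\lambda_T)$ with $Q_T$ a finite nonempty set of states, $\pi_T:X_n\times Q_T\to Q_T$, $\lambda_T:X_n\times Q_T\to X_n^*$, extended to words by $\pi_T(\varepsilon,q)=q$, $\lambda_T(\varepsilon,q)=\varepsilon$, $\pi_T(wx,q)=\pi_T(x,\pi_T(w,q))$, $\lambda_T(wx,q)=\lambda_T(w,q)\lambda_T(x,\pi_T(w,q))$, and $\lambda_T$ extended to infinite words. Always assumed: if $w\in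 X_n^+$ and $\pi_T(w,q)=q$ then $\lambda_T(w,q)\ne\varepsilon$. Each state $q$ induces a continuous map $h_q:X_n^{\mathbb N}\to X_n^{\mathbb N}$, $w\mapsto\lambda_T(w,q)$, with image $\mathrm{Image}(q)$. States $p,q$ (possibly of different transducers) are $\omega$-equivalent if $h_p=h_q$; $T$ is weakly minimal if distinct states are never $\omega$-equivalent. $\Lambda(w,q)$ is the greatest common prefix of $\{\lambda_T(wx,q):x\in X_n^{\mathbb N}\}$; $|\Lambda(\varepsilon,q)|\in\mathbb N\cup\{\infty\}$ is the extent of incomplete response of $q$, and $q$ is a state of incomplete response if $\Lambda(\varepsilon,q)\neq\varepsilon$. $T$ is strongly synchronizing if for some $k\ge 0$ (a synchronizing level), for each $w\in X_n^k$ the state $\pi_T(w,q)$ is independent of $q$ (the state forced by $w$). The states forced by words of length $k$ form a subtransducer $\mathrm{core}(T)$; $T$ is core if $T=\mathrm{core}(T)$. For $x\in X_n^+$, $Z_x$ is the one-state transducer with output $x$ on every letter. A word is prime if it is nonempty and not a proper power of a shorter word. A transducer is called minimal if either it is weakly minimal, strongly connected and has no states of incomplete response, or it is $Z_x$ with $x$ prime and lexicographically least among its rotations. Transducers are considered equal if there is a bijection of state sets matching $\omega$-equivalent states. **Reduction.** For a strongly synchronizing core transducer $C$ define a minimal transducer $[C]$: if some (equivalently every) state has infinite extent of incomplete response, each state of $C$ is $\omega$-equivalent to the state of some $Z_x$ with $x$ prime (unique up to rotation) and $[C]:=Z_{\bar x}$ with $\bar x$ the lexicographically least rotation of $x$;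 otherwise keep states and transitions, replace the output $\lambda_C(x,q)$ ($x\in X_n$) by the word obtained by deleting the prefix $\Lambda(\varepsilon,q)$ from $\Lambda(x,q)$, and then identify $\omega$-equivalent states. **Groups.** $T*U$ has states $Q_T\times Q_U$, $\pi_{T*U}(x,(p,q))=(\pi_T(x,p),\pi_U(\lambda_T(x,p),q))$, $\lambda_{T*U}(x,(p,q))=\lambda_U(\lambda_T(x,p),q)$. $\mathcal M_n$ is the monoid of minimal, strongly synchronizing, core transducers over $X_n$ with product $TU:=[\mathrm{core}(T*U)]$. $\widetilde{\mathcal O}_n\subseteq\mathcal M_n$ is the submonoid of those $T$ all of whose states $q$ have $h_q$ injective with clopen image; $\mathcal O_n$ is its largest inverse-closed subset (group of units). For $T\in\mathcal O_n$ and $q\in Q_T$, let $m_q$ be the least number of cones $U_\nu=\{x\in X_n^{\mathbb N}:\nu\text{ is a prefix of }x\}$ needed to write $\mathrm{Image}(q)$ as a union of cones; its residue mod $n-1$ does not depend on $q$ and is denoted $(T)\overline{\mathrm{sig}}$. For $1\le r\le n-1$, $\mathcal O_{n,r}=\{T\in\mathcal O_n: r\cdot (T)\overline{\mathrm{sig}}\equiv r \pmod{n-1}\}$, a subgroup; $\mathcal O_{n,n-1}=\mathcal O_n$. $\widetilde{\mathcal L}_n\subseteq\mathcal M_n$ is the submonoid of those $T$ with $|\lambda_T(a,q)|=|a|$ whenever $\pi_T(a,q)=q$; $\mathcal L_n:=\mathcal O_n\cap\widetilde{\mathcal L}_n$, a group. **Action on prime cyclic words.** $\mathsf W_n$ is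 the set of rotation classes $[\gamma]$ of prime words $\gamma$ over $X_n$. For $T\in\mathcal M_n$ and $\gamma$ prime there is a unique state $q_\gamma$ with $\pi_T(\gamma,q_\gamma)=q_\gamma$; write $\lambda_T(\gamma,q_\gamma)=\delta^s$ with $\delta$ prime, $s\ge1$, and put $([\gamma])(T)\Pi:=[\delta]$. **Shift and annotations.** $\sigma_n:X_n^{\mathbb Z}\to X_n^{\mathbb Z}$, $(x)\sigma_n=y$ with $y_i=x_{i-1}$; $\mathrm{Aut}(X_n^{\mathbb Z},\sigma_n)$ is the group of homeomorphisms of $X_n^{\mathbb Z}$ commuting with $\sigma_n$. An annotation of $T\in\widetilde{\mathcal L}_n$ is a map $\alpha:Q_T\to\mathbb Z$ with $(\pi_T(w,q))\alpha=(q)\alpha+|\lambda_T(w,q)|-|w|$ for all $q\in Q_T$, $w\in X_n^*$ (these exist and are unique up to an additive constant). The map $(T,\alpha):X_n^{\mathbb Z}\to X_n^{\mathbb Z}$ sends $x$ to the $y$ such that for each $i\in\mathbb Z$, if $q$ is the state forced by $x_{i-k}\cdots x_{i-1}$ ($k$ a synchronizing level), $\rho=(q)\alpha$ and $w=\lambda_T(x_i,q)$, then $y_{i+\rho}y_{i+\rho+1}\cdots y_{i+\rho+|w|-1}=w$. **Periodic orbit representation.** The $\sigma_n$-orbits of $\sigma_n$-periodic points are in bijection with $\mathsf W_n$: the orbit of a point $x$ of least period $k$ corresponds to $[x_0x_1\cdots x_{k-1}]$. Each $\varphi\in\mathrm{Aut}(X_n^{\mathbb Z},\sigma_n)$ permutes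 these orbits, and this permutation depends only on the coset $\varphi\langle\sigma_n\rangle$; the resulting homomorphism $\mathrm{Aut}(X_n^{\mathbb Z},\sigma_n)/\langle\sigma_n\rangle\to\mathrm{Sym}(\mathsf W_n)$ is the periodic orbit representation. *)

theory Defs
  imports
    "HOL-Analysis.Function_Topology"
    "HOL-Algebra.Bij"
    "HOL-Algebra.Generated_Groups"
    "HOL-Library.Omega_Words_Fun"
    "HOL-Library.Extended_Nat"
    "HOL-Library.Cardinality"
begin

text \<open>
  The alphabet is a type of sort \<open>{finite, linorder}\<close>; its cardinality \<open>CARD('a)\<close> plays the
  role of \<open>n\<close>, and its order is that of \<open>0 < 1 < \<dots> < n - 1\<close>. Infinite words are functions
  \<open>nat \<Rightarrow> 'a\<close>, bi-infinite words are functions \<open>int \<Rightarrow> 'a\<close>. Maps act on the right in the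
  mathematical text, so all products of maps below apply the left factor first.
\<close>

section \<open>Prime words and cyclic words\<close>

definition word_power :: "'a list \<Rightarrow> nat \<Rightarrow> 'a list" where
  "word_power u k = concat (replicate k u)"

definition prime_word :: "'a list \<Rightarrow> bool" where
  "prime_word w \<longleftrightarrow> w \<noteq> [] \<and> \<not> (\<exists>u k. length u < length w \<and> w = word_power u k)"

definition cyclic_word :: "'a list \<Rightarrow> 'a list set" where
  "cyclic_word w = range (\<lambda>k. rotate k w)"

definition prime_cyclic_words :: "'a list set set" where
  "prime_cyclic_words = cyclic_word ` {w. prime_word w}"

definition least_rotation :: "'a::linorder list \<Rightarrow> bool" where
  "least_rotation w \<longleftrightarrow> (\<forall>v\<in>cyclic_word w. ord_class.lexordp_eq w v)"

section \<open>Transducers\<close>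

record ('a, 'q) transducer =
  states :: "'q set"
  step :: "'a \<Rightarrow> 'q \<Rightarrow> 'q"
  out :: "'a \<Rightarrow> 'q \<Rightarrow> 'a list"

definition step_word :: "('a, 'q) transducer \<Rightarrow> 'a list \<Rightarrow> 'q \<Rightarrow> 'q" where
  "step_word T w q = fold (step T) w q"

primrec out_word :: "('a, 'q) transducer \<Rightarrow> 'a list \<Rightarrow> 'q \<Rightarrow> 'a list" where
  "out_word T [] q = []"
| "out_word T (a # w) q = out T a q @ out_word T w (step T a q)"

definition is_transducer :: "('a, 'q) transducer \<Rightarrow> bool" where
  "is_transducer T \<longleftrightarrow> finite (states T) \<and> states T \<noteq> {} \<and>
     (\<forall>q\<in>states T. \<forall>a. step T a q \<in> states T) \<and>
     (\<forall>q\<in>states T. \<forall>w. w \<noteq> [] \<longrightarrow> step_word T w q = q \<longrightarrow> out_word T w q \<noteq> [])"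

text \<open>
  The map \<open>h\<^sub>q\<close>: letter \<open>i\<close> of the output on \<open>x\<close> is read off from the output on the shortest
  prefix of \<open>x\<close> whose output has more than \<open>i\<close> letters. Such a prefix exists whenever
  \<open>is_transducer T\<close> and \<open>q \<in> states T\<close>.
\<close>
definition state_map :: "('a, 'q) transducer \<Rightarrow> 'q \<Rightarrow> (nat \<Rightarrow> 'a) \<Rightarrow> (nat \<Rightarrow> 'a)" where
  "state_map T q x =
     (\<lambda>i. out_word T (prefix (LEAST k. i < length (out_word T (prefix k x) q)) x) q ! i)"

definition tr_equal :: "('a, 'p) transducer \<Rightarrow> ('a, 'q) transducer \<Rightarrow> bool" where
  "tr_equal T U \<longleftrightarrow> (\<exists>f. bij_betw f (states T) (states U) \<and>
     (\<forall>q\<in>states T. state_map T q = state_map U (f q)))"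

definition weakly_minimal :: "('a, 'q) transducer \<Rightarrow> bool" where
  "weakly_minimal T \<longleftrightarrow>
     (\<forall>p\<in>states T. \<forall>q\<in>states T. state_map T p = state_map T q \<longrightarrow> p = q)"

definition strongly_connected :: "('a, 'q) transducer \<Rightarrow> bool" where
  "strongly_connected T \<longleftrightarrow> (\<forall>p\<in>states T. \<forall>q\<in>states T. \<exists>w. step_word T w p = q)"

text \<open>
  The greatest common prefix \<open>\<Lambda>(w, q)\<close> may be an infinite word. It is handled through the set
  of its finite prefixes: the extent \<open>|\<Lambda>(\<epsilon>, q)|\<close> is the supremum of their lengths, and
  \<open>Lam T w q\<close> is \<open>\<Lambda>(w, q)\<close> whenever the latter is finite (unspecified otherwise).
\<close>
definition common_prefixes :: "('a, 'q) transducer \<Rightarrow> 'a list \<Rightarrow> 'q \<Rightarrow> 'a list set" where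
  "common_prefixes T w q = {u. \<forall>x. prefix (length u) (state_map T q (w \<frown> x)) = u}"

definition extent :: "('a, 'q) transducer \<Rightarrow> 'q \<Rightarrow> enat" where
  "extent T q = (SUP u\<in>common_prefixes T [] q. enat (length u))"

definition Lam :: "('a, 'q) transducer \<Rightarrow> 'a list \<Rightarrow> 'q \<Rightarrow> 'a list" where
  "Lam T w q = (ARG_MAX length u. u \<in> common_prefixes T w q)"

definition incomplete_response :: "('a, 'q) transducer \<Rightarrow> 'q \<Rightarrow> bool" where
  "incomplete_response T q \<longleftrightarrow> extent T q \<noteq> 0"

definition sync_level :: "('a, 'q) transducer \<Rightarrow> nat \<Rightarrow> bool" where
  "sync_level T k \<longleftrightarrow> (\<forall>w. length w = k \<longrightarrow>
     (\<forall>p\<in>states T. \<forall>q\<in>states T. step_word T w p = step_word T w q))"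

definition strongly_synchronizing :: "('a, 'q) transducer \<Rightarrow> bool" where
  "strongly_synchronizing T \<longleftrightarrow> (\<exists>k. sync_level T k)"

definition forced_state :: "('a, 'q) transducer \<Rightarrow> 'a list \<Rightarrow> 'q" where
  "forced_state T w = (THE p. \<forall>q\<in>states T. step_word T w q = p)"

text \<open>The set of states forced by words of length \<open>k\<close> is the same for all synchronizing
  levels \<open>k\<close>, so the union over all of them is taken.\<close>
definition core :: "('a, 'q) transducer \<Rightarrow> ('a, 'q) transducer" where
  "core T = T\<lparr>states := {forced_state T w |w. sync_level T (length w)}\<rparr>"

definition is_core :: "('a, 'q) transducer \<Rightarrow> bool" where
  "is_core T \<longleftrightarrow> strongly_synchronizing T \<and> states (core T) = states T"

text \<open>\<open>Z_transducer s x\<close> is \<open>Z\<^sub>x\<close>, with \<open>s\<close> as the name of its only state.\<close>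
definition Z_transducer :: "'q \<Rightarrow> 'a list \<Rightarrow> ('a, 'q) transducer" where
  "Z_transducer s x = \<lparr>states = {s}, step = (\<lambda>_ _. s), out = (\<lambda>_ _. x)\<rparr>"

definition id_transducer :: "('a, unit) transducer" where
  "id_transducer = \<lparr>states = {()}, step = (\<lambda>_ _. ()), out = (\<lambda>a _. [a])\<rparr>"

definition minimal :: "('a::linorder, 'q) transducer \<Rightarrow> bool" where
  "minimal T \<longleftrightarrow>
     weakly_minimal T \<and> strongly_connected T \<and> (\<forall>q\<in>states T. \<not> incomplete_response T q) \<or>
     (\<exists>s x. states T = {s} \<and> (\<forall>a. out T a s = x) \<and> prime_word x \<and> least_rotation x)"

section \<open>Reduction\<close>

definition strip_response :: "('a, 'q) transducer \<Rightarrow> ('a, 'q) transducer" where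
  "strip_response C = C\<lparr>out := (\<lambda>a q. drop (length (Lam C [] q)) (Lam C [a] q))\<rparr>"

definition state_class :: "('a, 'q) transducer \<Rightarrow> 'q \<Rightarrow> 'q set" where
  "state_class C q = {p \<in> states C. state_map C p = state_map C q}"

text \<open>Transitions and outputs of a class are those of an arbitrary representative. For the
  transducers to which this is applied, which have no states of incomplete response, the choice
  is irrelevant.\<close>
definition identify_states :: "('a, 'q) transducer \<Rightarrow> ('a, 'q set) transducer" where
  "identify_states C =
     \<lparr>states = state_class C ` states C,
      step = (\<lambda>a K. state_class C (step C a (SOME q. q \<in> K))),
      out = (\<lambda>a K. out C a (SOME q. q \<in> K))\<rparr>"

definition response_root :: "('a::linorder, 'q) transducer \<Rightarrow> 'a list" where
  "response_root C = (THE y. least_rotation y \<and>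
     (\<exists>q\<in>states C. \<exists>x. prime_word x \<and> state_map C q = state_map (Z_transducer () x) () \<and>
        y \<in> cyclic_word x))"

definition reduction :: "('a::linorder, 'q) transducer \<Rightarrow> ('a, 'q set) transducer" where
  "reduction C =
     (if \<exists>q\<in>states C. extent C q = \<infinity> then Z_transducer (states C) (response_root C)
      else identify_states (strip_response C))"

section \<open>The monoids and groups of transducers\<close>

definition tr_product ::
    "('a, 'p) transducer \<Rightarrow> ('a, 'q) transducer \<Rightarrow> ('a, 'p \<times> 'q) transducer" where
  "tr_product T U =
     \<lparr>states = states T \<times> states U,
      step = (\<lambda>a (p, q). (step T a p, step_word U (out T a p) q)),
      out = (\<lambda>a (p, q). out_word U (out T a p) q)\<rparr>"

text \<open>
  Elements of the monoid \<open>\<M>\<^sub>n\<close> are transducers up to equality, i.e. equivalence classes for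
  \<open>tr_equal\<close>. As state sets are finite, every class has members with states in \<open>nat\<close>.
\<close>
type_synonym 'a tclass = "('a, nat) transducer set"

definition M_transducers :: "('a::linorder, nat) transducer set" where
  "M_transducers =
     {T. is_transducer T \<and> minimal T \<and> strongly_synchronizing T \<and> is_core T}"

definition tclass :: "('a::linorder, 'q) transducer \<Rightarrow> 'a tclass" where
  "tclass S = {T \<in> M_transducers. tr_equal T S}"

definition M_monoid :: "('a::linorder) tclass monoid" where
  "M_monoid =
     \<lparr>carrier = tclass ` (M_transducers :: ('a, nat) transducer set),
      mult = (\<lambda>A B. \<Union>T\<in>A. \<Union>U\<in>B. tclass (reduction (core (tr_product T U)))),
      one = tclass id_transducer\<rparr>"

abbreviation cantor_space :: "(nat \<Rightarrow> 'a) topology" where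
  "cantor_space \<equiv> product_topology (\<lambda>_. discrete_topology UNIV) UNIV"

definition image_of_state :: "('a, 'q) transducer \<Rightarrow> 'q \<Rightarrow> (nat \<Rightarrow> 'a) set" where
  "image_of_state T q = range (state_map T q)"

definition O_tilde :: "('a::linorder) tclass monoid" where
  "O_tilde = M_monoid\<lparr>carrier := {A \<in> carrier M_monoid. \<forall>T\<in>A. \<forall>q\<in>states T.
     inj (state_map T q) \<and> openin cantor_space (image_of_state T q) \<and>
     closedin cantor_space (image_of_state T q)}\<rparr>"

definition O_group :: "('a::linorder) tclass monoid" where
  "O_group = units_of O_tilde"

definition cone :: "'a list \<Rightarrow> (nat \<Rightarrow> 'a) set" where
  "cone v = {x. prefix (length v) x = v}"

definition min_cones :: "('a, 'q) transducer \<Rightarrow> 'q \<Rightarrow> nat" where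
  "min_cones T q =
     (LEAST m. \<exists>S. finite S \<and> card S = m \<and> image_of_state T q = (\<Union>v\<in>S. cone v))"

definition sig :: "('a::{finite,linorder}) tclass \<Rightarrow> nat" where
  "sig A = (THE s. \<forall>T\<in>A. \<forall>q\<in>states T. min_cones T q mod (CARD('a) - 1) = s)"

definition Or_group :: "nat \<Rightarrow> ('a::{finite,linorder}) tclass monoid" where
  "Or_group r = O_group\<lparr>carrier := {A \<in> carrier O_group.
     (r * sig A) mod (CARD('a) - 1) = r mod (CARD('a) - 1)}\<rparr>"

definition L_tilde :: "('a::linorder) tclass monoid" where
  "L_tilde = M_monoid\<lparr>carrier := {A \<in> carrier M_monoid. \<forall>T\<in>A. \<forall>q\<in>states T. \<forall>w.
     step_word T w q = q \<longrightarrow> length (out_word T w q) = length w}\<rparr>"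

definition L_group :: "('a::linorder) tclass monoid" where
  "L_group = O_group\<lparr>carrier := carrier O_group \<inter> carrier L_tilde\<rparr>"

section \<open>The action on prime cyclic words\<close>

text \<open>The symmetric group on \<open>S\<close> acting on the right; \<open>BijGroup S\<close> of HOL-Algebra has the
  opposite product.\<close>
definition right_sym_group :: "'x set \<Rightarrow> ('x \<Rightarrow> 'x) monoid" where
  "right_sym_group S = \<lparr>carrier = Bij S, mult = (\<lambda>f g. compose S g f), one = (\<lambda>x\<in>S. x)\<rparr>"

definition loop_state :: "('a, 'q) transducer \<Rightarrow> 'a list \<Rightarrow> 'q" where
  "loop_state T w = (THE q. q \<in> states T \<and> step_word T w q = q)"

definition cyclic_action :: "('a::linorder) tclass \<Rightarrow> 'a list set \<Rightarrow> 'a list set" where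
  "cyclic_action A = (\<lambda>c\<in>prime_cyclic_words. THE d. \<forall>T\<in>A. \<forall>w\<in>c. \<exists>v s.
     prime_word v \<and> 1 \<le> s \<and> out_word T w (loop_state T w) = word_power v s \<and>
     d = cyclic_word v)"

section \<open>Automorphisms of the full shift\<close>

abbreviation shift_space :: "(int \<Rightarrow> 'a) topology" where
  "shift_space \<equiv> product_topology (\<lambda>_. discrete_topology UNIV) UNIV"

definition shift_map :: "(int \<Rightarrow> 'a) \<Rightarrow> (int \<Rightarrow> 'a)" where
  "shift_map x = (\<lambda>i. x (i - 1))"

definition shift_aut :: "((int \<Rightarrow> 'a) \<Rightarrow> (int \<Rightarrow> 'a)) monoid" where
  "shift_aut =
     \<lparr>carrier = {f. homeomorphic_map shift_space shift_space f \<and>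
                    f \<circ> shift_map = shift_map \<circ> f},
      mult = (\<lambda>f g. g \<circ> f), one = id\<rparr>"

definition shift_subgroup :: "((int \<Rightarrow> 'a) \<Rightarrow> (int \<Rightarrow> 'a)) set" where
  "shift_subgroup = generate shift_aut {shift_map}"

definition annotation :: "('a, 'q) transducer \<Rightarrow> ('q \<Rightarrow> int) \<Rightarrow> bool" where
  "annotation T \<alpha> \<longleftrightarrow> (\<forall>q\<in>states T. \<forall>w.
     \<alpha> (step_word T w q) = \<alpha> q + int (length (out_word T w q)) - int (length w))"

definition annotated_map ::
    "('a, 'q) transducer \<Rightarrow> ('q \<Rightarrow> int) \<Rightarrow> (int \<Rightarrow> 'a) \<Rightarrow> (int \<Rightarrow> 'a)" where
  "annotated_map T \<alpha> x = (THE y. \<forall>i k. sync_level T k \<longrightarrow>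
     (let q = forced_state T (map x [i - int k..i - 1]); w = out T (x i) q
      in \<forall>j<length w. y (i + \<alpha> q + int j) = w ! j))"

section \<open>The periodic orbit representation\<close>

definition periodic_point :: "(int \<Rightarrow> 'a) \<Rightarrow> bool" where
  "periodic_point x \<longleftrightarrow> (\<exists>k>0. (shift_map ^^ k) x = x)"

definition least_period :: "(int \<Rightarrow> 'a) \<Rightarrow> nat" where
  "least_period x = (LEAST k. 0 < k \<and> (shift_map ^^ k) x = x)"

definition shift_orbit :: "(int \<Rightarrow> 'a) \<Rightarrow> (int \<Rightarrow> 'a) set" where
  "shift_orbit x = {f x |f. f \<in> shift_subgroup}"

definition periodic_orbits :: "(int \<Rightarrow> 'a) set set" where
  "periodic_orbits = shift_orbit ` {x. periodic_point x}"

definition orbit_cyclic_word :: "(int \<Rightarrow> 'a) set \<Rightarrow> 'a list set" where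
  "orbit_cyclic_word Q =
     (THE c. \<forall>x\<in>Q. c = cyclic_word (map x [0..int (least_period x) - 1]))"

definition orbit_permutation ::
    "((int \<Rightarrow> 'a) \<Rightarrow> (int \<Rightarrow> 'a)) \<Rightarrow> 'a list set \<Rightarrow> 'a list set" where
  "orbit_permutation f = (\<lambda>c\<in>prime_cyclic_words.
     orbit_cyclic_word (f ` inv_into periodic_orbits orbit_cyclic_word c))"

definition periodic_orbit_rep ::
    "((int \<Rightarrow> 'a) \<Rightarrow> (int \<Rightarrow> 'a)) set \<Rightarrow> 'a list set \<Rightarrow> 'a list set" where
  "periodic_orbit_rep K = (THE p. \<forall>f\<in>K. orbit_permutation f = p)"

end

theory Submission imports Defs
begin

text \<open>
  Two synchronizing transducers with nonconstant state maps represent the same element of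
  \<open>\<M>\<^sub>n\<close> exactly when the state maps forced by long words agree up to bounded finite
  prefixes. This equivalence is defined without reduction, is compatible with products, and preserves
  outputs along loops up to conjugation, because a nonconstant map cannot coincide with a shift of
  itself. Hence
  all invariants may be computed on unreduced representatives: \<open>\<Pi>\<close> is multiplicative since
  the loop of a product on a word \<open>w\<close> outputs the loop output of the second factor on the loop
  output of the first, and the signature is multiplicative since the number of cones in a disjoint
  decomposition of a clopen set is well defined modulo \<open>n - 1\<close>.

  For \<open>\<L>\<^sub>n\<close>, an annotated transducer represents the map of bi-infinite words that sends
  the tail of \<open>x\<close> from \<open>i\<close> on, read from the state forced by the past, to the tail of
  the image from \<open>i + \<alpha>(q)\<close> on. Products represent compositions, equivalent transducers
  represent the same map up to a power of the shift, and conversely a map determines its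
  transducer up to equivalence. By compactness every automorphism of the shift is, up to a power of the
  shift, computed by a finite window over the past; the corresponding sliding window transducer induces
  clopen embeddings because the inverse automorphism has a finite window as well.
\<close>

section \<open>Infinite words\<close>

text \<open>Reduction changes the type of states, deletes prefixes and merges states, so proving the
  monoid laws on minimal transducers would mean tracking these changes through every product.
  Allowing bounded prefixes makes them invisible, and a class can be handled through whatever
  transducer is at hand, in particular a raw product. The price is that the relation is too coarse
  for constant maps: the one-state transducers writing \<open>0\<close> and \<open>00\<close> on
  each letter have the same state map but loop outputs of different lengths. Injectivity excludes
  this case as soon as there are two letters.

  Finiteness enters mostly through one estimate: reading \<open>m * card (states T)\<close> letters
  writes at least \<open>m\<close> letters. It absorbs bounded prefixes, synchronizes products and
  gives uniform continuity.

  For annotated transducers the corresponding principle is causality: the letters of the image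
  before position \<open>i + \<alpha> q\<close> depend only on the letters of \<open>x\<close>
  before \<open>i\<close>. Hence two transducers representing one map differ at each position by an
  explicit prefix, whose length is the difference of the two annotations.\<close>

lemma conc_cancel:
  assumes "a \<frown> x = b \<frown> y" "length a \<le> length b"
  shows "b = a @ drop (length a) b" "x = drop (length a) b \<frown> y"
proof -
  have "prefix (length a) (a \<frown> x) = prefix (length a) (b \<frown> y)"
    using assms(1) by simp
  then have "a = take (length a) b"
    using assms(2) by simp
  then show b: "b = a @ drop (length a) b"
    by (metis append_take_drop_id)
  have "suffix (length a) (a \<frown> x) = suffix (length a) (b \<frown> y)"
    using assms(1) by simp
  then show "x = drop (length a) b \<frown> y"
    using assms(2) by simp
qed

lemma prefix_eq_iff_conc: "prefix (length u) y = u \<longleftrightarrow> (\<exists>z. y = u \<frown> z)"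
  by (metis prefix_conc_length prefix_suffix)

lemma prefix_eq_mono:
  assumes "prefix k x = prefix k y" "j \<le> k"
  shows "prefix j x = prefix j y"
  using arg_cong[OF assms(1), of "take j"] assms(2) by (simp add: min_absorb1)

text \<open>Comparing \<open>h u\<close> with itself shifted by \<open>length e\<close> forces it to be periodic with period \<open>e\<close>.\<close>
lemma constant_if_self_prefixed:
  assumes "\<And>u. h u = e \<frown> h u" "e \<noteq> []"
  shows "h u = (h v :: nat \<Rightarrow> 'a)"
proof
  fix i
  show "h u i = h v i"
  proof (induction i rule: less_induct)
    case (less i)
    have "h w i = (if i < length e then e ! i else h w (i - length e))" for w
      by (subst assms(1)) (simp add: conc_def)
    moreover have "h u (i - length e) = h v (i - length e)" if "\<not> i < length e"
      using less[of "i - length e"] that assms(2) by (cases e) auto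
    ultimately show ?case by simp
  qed
qed

text \<open>If the words had different lengths, the excess of the longer one would be a nonempty
  word that can be put in front of every \<open>h u\<close> without changing it, and
  \<open>constant_if_self_prefixed\<close> would make \<open>h\<close> constant.\<close>

lemma conc_left_unique:
  assumes "\<And>u. e \<frown> h u = e' \<frown> h u" "h x \<noteq> (h y :: nat \<Rightarrow> 'a)"
  shows "e = e'"
proof -
  have *: "e = e'" if le: "length e \<le> length e'" and eq: "\<And>u. e \<frown> h u = e' \<frown> h u" for e e'
  proof -
    have "e' = e @ drop (length e) e'"
      using conc_cancel(1)[OF eq le] .
    moreover have "drop (length e) e' = []"
      using constant_if_self_prefixed[of h "drop (length e) e'" x y] conc_cancel(2)[OF eq le] assms(2)
      by blast
    ultimately show ?thesis by simp
  qed
  show ?thesis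
    using *[of e e'] *[of e' e] assms(1) by (metis nat_le_linear)
qed

section \<open>Transducers and their state maps\<close>

lemma step_word_Nil [simp]: "step_word T [] q = q"
  and step_word_Cons [simp]: "step_word T (a # w) q = step_word T w (step T a q)"
  and step_word_append [simp]: "step_word T (u @ v) q = step_word T v (step_word T u q)"
  by (simp_all add: step_word_def)

lemma out_word_append [simp]:
  "out_word T (u @ v) q = out_word T u q @ out_word T v (step_word T u q)"
  by (induction u arbitrary: q) simp_all

lemma step_word_in_states:
  "is_transducer T \<Longrightarrow> q \<in> states T \<Longrightarrow> step_word T w q \<in> states T"
  by (induction w arbitrary: q) (auto simp: is_transducer_def)

text \<open>Reading \<open>card (states T)\<close> letters visits some state twice by the pigeonhole
  principle. The word read between the two visits is a loop, and loops write something by the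
  definition of a transducer.\<close>

lemma out_word_nonempty:
  assumes T: "is_transducer T" "q \<in> states T" and w: "card (states T) \<le> length w"
  shows "out_word T w q \<noteq> []"
proof -
  let ?f = "\<lambda>i. step_word T (take i w) q"
  have "?f ` {..card (states T)} \<subseteq> states T"
    using step_word_in_states[OF T] by auto
  then have "card (?f ` {..card (states T)}) < card {..card (states T)}"
    using T(1) card_mono[of "states T"] by (simp add: is_transducer_def less_Suc_eq_le)
  then have "\<not> inj_on ?f {..card (states T)}"
    using pigeonhole by blast
  then obtain i j where "i \<le> card (states T)" "j \<le> card (states T)" "?f i = ?f j" "i \<noteq> j"
    by (auto simp: inj_on_def)
  then obtain i j where ij: "j \<le> length w" "?f i = ?f j" "i < j"
    using w by (metis le_trans linorder_neqE_nat)
  define u where "u = drop i (take j w)"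
  have tj: "take j w = take i w @ u"
    using ij by (metis append_take_drop_id less_imp_le min.absorb1 take_take u_def)
  have "step_word T u (?f i) = ?f i"
    using ij(2) unfolding tj by simp
  moreover have "u \<noteq> []"
    using ij by (simp add: u_def)
  ultimately have "out_word T u (?f i) \<noteq> []"
    using T step_word_in_states[OF T] by (auto simp: is_transducer_def)
  moreover have "w = take i w @ u @ drop j w"
    by (metis append.assoc append_take_drop_id tj)
  ultimately show ?thesis
    by (metis append_is_Nil_conv out_word_append)
qed

text \<open>Each block of \<open>card (states T)\<close> letters contributes at least one letter.
  This linear bound is the quantitative form in which finiteness of the state set is used
  later.\<close>

lemma length_out_word_ge:
  assumes "is_transducer T" "q \<in> states T" "m * card (states T) \<le> length w"
  shows "m \<le> length (out_word T w q)"
  using assms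
proof (induction m arbitrary: w q)
  case (Suc m)
  let ?c = "card (states T)"
  have "out_word T (take ?c w) q \<noteq> []"
    using Suc.prems by (intro out_word_nonempty) auto
  moreover have "m \<le> length (out_word T (drop ?c w) (step_word T (take ?c w) q))"
    using Suc by (intro Suc.IH) (auto intro: step_word_in_states)
  moreover have "out_word T w q =
      out_word T (take ?c w) q @ out_word T (drop ?c w) (step_word T (take ?c w) q)"
    by (metis append_take_drop_id out_word_append)
  ultimately show ?case
    by (cases "out_word T (take ?c w) q") auto
qed simp

text \<open>Bounds the output caused by a residual prefix of bounded length, which keeps prefixes
  uniformly bounded when a second transducer is applied.\<close>

lemma length_out_word_le:
  assumes "is_transducer T"
  shows "\<exists>M. \<forall>q\<in>states T. \<forall>w. length (out_word T w q) \<le> M * length (w :: 'a::finite list)"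
proof -
  let ?L = "(\<lambda>(a, q). length (out T a q)) ` (UNIV \<times> states T)"
  have fin: "finite ?L"
    using assms by (simp add: is_transducer_def)
  have "length (out_word T w q) \<le> Max ?L * length w" if "q \<in> states T" for q w
    using that
  proof (induction w arbitrary: q)
    case (Cons a w)
    have "length (out T a q) \<le> Max ?L"
      using Cons.prems by (intro Max_ge[OF fin]) auto
    moreover have "length (out_word T w (step T a q)) \<le> Max ?L * length w"
      using Cons assms by (auto simp: is_transducer_def)
    ultimately show ?case by simp
  qed simp
  then show ?thesis by blast
qed

lemma out_word_prefix_mono:
  assumes "k \<le> m"
  shows "\<exists>v. out_word T (prefix m x) q = out_word T (prefix k x) q @ v"
proof -
  have "prefix m x = prefix k x @ x [k \<rightarrow> m]"
    using subsequence_append[where i = k and j = "m - k" and w = x] assms by simp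
  then show ?thesis by simp
qed

lemma prefix_state_map:
  "prefix (length (out_word T (prefix k x) q)) (state_map T q x) = out_word T (prefix k x) q"
proof (rule nth_equalityI)
  fix i assume i: "i < length (prefix (length (out_word T (prefix k x) q)) (state_map T q x))"
  \<comment> \<open>\<open>L\<close> is the prefix length from which \<open>state_map\<close> reads
    letter \<open>i\<close>; the output on the prefix of length \<open>k\<close> extends the output
    on this one.\<close>
  define L where "L = (LEAST k. i < length (out_word T (prefix k x) q))"
  have "i < length (out_word T (prefix L x) q)" "L \<le> k"
    using i LeastI[of "\<lambda>k. i < length (out_word T (prefix k x) q)" k]
      Least_le[of "\<lambda>k. i < length (out_word T (prefix k x) q)" k] by (auto simp: L_def)
  moreover have "state_map T q x i = out_word T (prefix L x) q ! i"
    by (simp add: state_map_def L_def)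
  ultimately show "prefix (length (out_word T (prefix k x) q)) (state_map T q x) ! i
      = out_word T (prefix k x) q ! i"
    using out_word_prefix_mono[where k = L and m = k and T = T and x = x and q = q] i by (auto simp: nth_append)
qed simp

text \<open>The outputs on prefixes get arbitrarily long, so at most one infinite word extends them
  all. Most identities between state maps come from this characterization instead of the
  \<open>LEAST\<close> in the definition.\<close>

lemma state_map_unique:
  assumes "is_transducer T" "q \<in> states T"
    and "\<And>k. \<exists>z. y = out_word T (prefix k x) q \<frown> z"
  shows "y = state_map T q x"
proof
  fix i
  let ?u = "out_word T (prefix (Suc i * card (states T)) x) q"
  have i: "i < length ?u"
    using length_out_word_ge[OF assms(1,2), of "Suc i" "prefix (Suc i * card (states T)) x"] by simp
  have "y i = ?u ! i"
    using assms(3)[of "Suc i * card (states T)"] i by auto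
  moreover have "state_map T q x i = ?u ! i"
    using arg_cong[OF prefix_state_map, of "\<lambda>u. u ! i" T q x "Suc i * card (states T)"] i by simp
  ultimately show "y i = state_map T q x i" by simp
qed

lemma state_map_conc:
  assumes T: "is_transducer T" "q \<in> states T"
  shows "state_map T q (w \<frown> x) = out_word T w q \<frown> state_map T (step_word T w q) x"
proof (rule state_map_unique[OF T, symmetric])
  fix k
  show "\<exists>z. out_word T w q \<frown> state_map T (step_word T w q) x
      = out_word T (prefix k (w \<frown> x)) q \<frown> z"
  proof (cases "k \<le> length w")
    case True
    have "out_word T w q = out_word T (take k w) q @ out_word T (drop k w) (step_word T (take k w) q)"
      by (metis append_take_drop_id out_word_append)
    then show ?thesis
      using True by (metis conc_conc prefix_conc_fst)
  next
    case False
    let ?u = "out_word T (prefix (k - length w) x) (step_word T w q)"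
    obtain z where "state_map T (step_word T w q) x = ?u \<frown> z"
      using prefix_state_map[of T "step_word T w q" x "k - length w"] prefix_eq_iff_conc[where u = ?u]
      by blast
    then show ?thesis
      using False by simp
  qed
qed

lemma state_map_uniformly_continuous:
  assumes "is_transducer T" "q \<in> states T" "prefix (m * card (states T)) x = prefix (m * card (states T)) y"
  shows "prefix m (state_map T q x) = prefix m (state_map T q y)"
proof -
  have "\<exists>u z z'. state_map T q x = u \<frown> z \<and> state_map T q y = u \<frown> z' \<and> m \<le> length u"
    using assms length_out_word_ge[OF assms(1,2), of m "prefix (m * card (states T)) x"]
      state_map_conc[OF assms(1,2)] by (metis eq_imp_le prefix_suffix subsequence_length minus_nat.diff_0)
  then show ?thesis by auto
qed

lemma step_word_update_states [simp]: "step_word (T\<lparr>states := X\<rparr>) = step_word T"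
  by (simp add: step_word_def fun_eq_iff)

lemma out_word_update_states [simp]: "out_word (T\<lparr>states := X\<rparr>) w q = out_word T w q"
  by (induction w arbitrary: q) simp_all

lemma state_map_update_states [simp]: "state_map (T\<lparr>states := X\<rparr>) = state_map T"
  by (simp add: state_map_def fun_eq_iff)

lemma step_word_core [simp]: "step_word (core T) = step_word T"
  and out_word_core [simp]: "out_word (core T) w q = out_word T w q"
  and state_map_core [simp]: "state_map (core T) = state_map T"
  and step_core [simp]: "step (core T) = step T"
  and out_core [simp]: "out (core T) = out T"
  by (simp_all add: core_def)

subsection \<open>Products\<close>

lemma states_tr_product [simp]: "states (tr_product T U) = states T \<times> states U"
  by (simp add: tr_product_def)

lemma step_word_tr_product [simp]:
  "step_word (tr_product T U) w (p, q) = (step_word T w p, step_word U (out_word T w p) q)"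
  by (induction w arbitrary: p q) (simp_all add: tr_product_def)

lemma out_word_tr_product [simp]:
  "out_word (tr_product T U) w (p, q) = out_word U (out_word T w p) q"
  by (induction w arbitrary: p q) (simp_all add: tr_product_def)

lemma is_transducer_tr_product:
  assumes "is_transducer T" "is_transducer U"
  shows "is_transducer (tr_product T U)"
  unfolding is_transducer_def
proof (intro conjI ballI allI impI)
  show "finite (states (tr_product T U))" "states (tr_product T U) \<noteq> {}"
    using assms by (auto simp: is_transducer_def)
  fix r assume r: "r \<in> states (tr_product T U)"
  then obtain p q where pq: "r = (p, q)" "p \<in> states T" "q \<in> states U" by auto
  show "step (tr_product T U) a r \<in> states (tr_product T U)" for a
    using step_word_in_states[OF assms(1) pq(2), of "[a]"] step_word_in_states[OF assms(2) pq(3)] pq(1)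
    by (simp add: tr_product_def)
  show "out_word (tr_product T U) w r \<noteq> []" if "w \<noteq> []" "step_word (tr_product T U) w r = r" for w
    using that assms pq by (simp add: is_transducer_def)
qed

lemma state_map_tr_product:
  assumes "is_transducer T" "is_transducer U" "p \<in> states T" "q \<in> states U"
  shows "state_map (tr_product T U) (p, q) x = state_map U q (state_map T p x)"
proof (rule state_map_unique[symmetric])
  fix k
  let ?u = "out_word T (prefix k x) p"
  obtain z where "state_map T p x = ?u \<frown> z"
    using prefix_state_map prefix_eq_iff_conc by metis
  then show "\<exists>z. state_map U q (state_map T p x) = out_word (tr_product T U) (prefix k x) (p, q) \<frown> z"
    using state_map_conc[OF assms(2,4)] by auto
qed (use assms is_transducer_tr_product in auto)

subsection \<open>Morphisms\<close>

text \<open>Serves both for merging states with equal maps and for renaming states by natural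
  numbers. Closure of \<open>states T\<close> under steps is included, so that words can be followed
  by induction.\<close>

definition tr_morphism :: "('p \<Rightarrow> 'q) \<Rightarrow> ('a, 'p) transducer \<Rightarrow> ('a, 'q) transducer \<Rightarrow> bool" where
  "tr_morphism f T S \<longleftrightarrow> (\<forall>q\<in>states T. f q \<in> states S \<and>
     (\<forall>a. step T a q \<in> states T \<and> f (step T a q) = step S a (f q) \<and> out T a q = out S a (f q)))"

lemma tr_morphism_words:
  assumes "tr_morphism f T S" "q \<in> states T"
  shows "step_word S w (f q) = f (step_word T w q)" "out_word S w (f q) = out_word T w q"
proof -
  show "step_word S w (f q) = f (step_word T w q)"
    using assms(2)
  proof (induction w arbitrary: q)
    case (Cons a w)
    then show ?case
      using assms(1) Cons.IH[of "step T a q"] by (simp add: tr_morphism_def)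
  qed simp
  show "out_word S w (f q) = out_word T w q"
    using assms(2)
  proof (induction w arbitrary: q)
    case (Cons a w)
    then show ?case
      using assms(1) Cons.IH[of "step T a q"] by (simp add: tr_morphism_def)
  qed simp
qed

lemma tr_morphism_state_map:
  assumes "tr_morphism f T S" "q \<in> states T"
  shows "state_map S (f q) = state_map T q"
  using tr_morphism_words(2)[OF assms] by (simp add: state_map_def fun_eq_iff)

subsection \<open>Synchronization\<close>

lemma sync_level_length:
  "sync_level T (length w) \<Longrightarrow> p \<in> states T \<Longrightarrow> q \<in> states T \<Longrightarrow>
    step_word T w p = step_word T w q"
  unfolding sync_level_def by blast

lemma sync_level_mono:
  assumes "sync_level T k" "k \<le> m" "is_transducer T"
  shows "sync_level T m"
  unfolding sync_level_def
proof (intro allI impI ballI)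
  fix w :: "'a list" and p q assume *: "length w = m" "p \<in> states T" "q \<in> states T"
  have "step_word T (take k w) p = step_word T (take k w) q"
    using * assms(1,2) by (intro sync_level_length) simp_all
  then show "step_word T w p = step_word T w q"
    by (metis append_take_drop_id step_word_append)
qed

lemma sync_levelD:
  assumes "sync_level T k" "is_transducer T" "k \<le> length w" "p \<in> states T" "q \<in> states T"
  shows "step_word T w p = step_word T w q"
  using sync_level_length[OF sync_level_mono[OF assms(1,3,2)] assms(4,5)] .

lemma forced_state_eq:
  assumes "sync_level T (length w)" "q \<in> states T"
  shows "forced_state T w = step_word T w q"
  unfolding forced_state_def
proof (rule the_equality)
  show "\<forall>p\<in>states T. step_word T w p = step_word T w q"
    using sync_level_length[OF assms(1) _ assms(2)] by simp
qed (use assms(2) in auto)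

lemma states_core:
  assumes "q \<in> states T"
  shows "states (core T) = {step_word T w q |w. sync_level T (length w)}"
  using assms forced_state_eq[of T] by (auto simp: core_def) metis+

lemma states_core_subset:
  assumes "is_transducer T"
  shows "states (core T) \<subseteq> states T"
proof -
  obtain q where "q \<in> states T"
    using assms by (auto simp: is_transducer_def)
  then show ?thesis
    using step_word_in_states[OF assms] by (auto simp: states_core)
qed

lemma is_transducer_core:
  assumes T: "is_transducer T" and "strongly_synchronizing T"
  shows "is_transducer (core T)"
proof -
  obtain q where q: "q \<in> states T"
    using T by (auto simp: is_transducer_def)
  obtain k where k: "sync_level T k"
    using assms(2) by (auto simp: strongly_synchronizing_def)
  have ne: "states (core T) \<noteq> {}"
    using states_core[OF q] k Ex_list_of_length[of k] by auto
  have "step T a p \<in> states (core T)" if p: "p \<in> states (core T)" for a p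
  proof -
    obtain w where "p = step_word T w q" "sync_level T (length w)"
      using p states_core[OF q] by auto
    then have "step T a p = step_word T (w @ [a]) q" "sync_level T (length (w @ [a]))"
      using sync_level_mono[OF _ _ T, of "length w" "Suc (length w)"] by auto
    then show ?thesis
      using states_core[OF q] by blast
  qed
  then show ?thesis
    using T ne states_core_subset[OF T] unfolding is_transducer_def
    by (auto intro: finite_subset)
qed

lemma sync_level_core: "is_transducer T \<Longrightarrow> sync_level T k \<Longrightarrow> sync_level (core T) k"
  unfolding sync_level_def step_word_core using states_core_subset by blast

lemma strongly_synchronizing_core:
  "is_transducer T \<Longrightarrow> strongly_synchronizing T \<Longrightarrow> strongly_synchronizing (core T)"
  using sync_level_core by (auto simp: strongly_synchronizing_def)

lemma is_core_core:
  assumes T: "is_transducer T" and "strongly_synchronizing T"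
  shows "is_core (core T)"
proof -
  obtain p where p: "p \<in> states (core T)"
    using is_transducer_core[OF assms] by (auto simp: is_transducer_def)
  then have pT: "p \<in> states T"
    using states_core_subset[OF T] by auto
  have "states (core (core T)) = states (core T)"
  proof
    show "states (core (core T)) \<subseteq> states (core T)"
      by (rule states_core_subset[OF is_transducer_core[OF assms]])
    show "states (core T) \<subseteq> states (core (core T))"
      using states_core[OF p] states_core[OF pT] sync_level_core[OF T] by auto
  qed
  then show ?thesis
    using strongly_synchronizing_core[OF assms] by (simp add: is_core_def)
qed

text \<open>A forced state is reached whatever was read before, so the word forcing \<open>q\<close>
  may be preceded by arbitrarily many letters. This makes \<open>q\<close> accessible to statements
  about sufficiently long words.\<close>

lemma is_core_reached:
  assumes T: "is_transducer T" "is_core T" and "p \<in> states T" "q \<in> states T"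
  obtains w where "K \<le> length w" "step_word T w p = q"
proof -
  have "q \<in> states (core T)"
    using assms by (simp add: is_core_def)
  then obtain w where w: "q = step_word T w p" "sync_level T (length w)"
    using states_core[OF assms(3)] by auto
  obtain v :: "'a list" where v: "length v = K"
    using Ex_list_of_length by blast
  have "step_word T (v @ w) p = q"
    using w sync_level_length[OF w(2) step_word_in_states[OF T(1) assms(3)] assms(3)] by simp
  then show ?thesis
    using that[of "v @ w"] v by simp
qed

lemma strongly_connected_if_core:
  "is_transducer T \<Longrightarrow> is_core T \<Longrightarrow> strongly_connected T"
  unfolding strongly_connected_def by (metis is_core_reached)

lemma sync_level_morphism:
  fixes T :: "('a, 'p) transducer" and S :: "('a, 'q) transducer"
  assumes "tr_morphism f T S" "f ` states T = states S" "sync_level T k"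
  shows "sync_level S k"
  unfolding sync_level_def
proof (intro allI impI ballI)
  fix w :: "'a list" and p q assume *: "length w = k" "p \<in> states S" "q \<in> states S"
  then obtain p' q' where "p' \<in> states T" "q' \<in> states T" "p = f p'" "q = f q'"
    by (auto simp: assms(2)[symmetric])
  then show "step_word S w p = step_word S w q"
    using sync_level_length[of T w p' q'] assms(3) * tr_morphism_words(1)[OF assms(1)] by simp
qed

text \<open>A loop of \<open>S\<close> lifts only to a path of \<open>T\<close> between two states
  with the same image, so each application supplies its own reason why loops of \<open>S\<close>
  write something.\<close>

lemma is_transducer_morphism:
  assumes f: "tr_morphism f T S" "f ` states T = states S" and T: "is_transducer T"
    and S: "\<And>q w. q \<in> states S \<Longrightarrow> w \<noteq> [] \<Longrightarrow> step_word S w q = q \<Longrightarrow> out_word S w q \<noteq> []"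
  shows "is_transducer S"
  unfolding is_transducer_def
proof (intro conjI ballI allI impI)
  show "finite (states S)" "states S \<noteq> {}"
    using T unfolding f(2)[symmetric] by (simp_all add: is_transducer_def)
  show "step S a q \<in> states S" if "q \<in> states S" for a q
  proof -
    obtain p where p: "p \<in> states T" "q = f p"
      using \<open>q \<in> states S\<close> f(2) by blast
    then have "step S a q = f (step T a p)" "step T a p \<in> states T"
      using f(1) by (simp_all add: tr_morphism_def)
    then show ?thesis
      using f(2) by blast
  qed
qed (use S in auto)

lemma is_core_morphism:
  assumes f: "tr_morphism f T S" "f ` states T = states S"
    and T: "is_transducer T" "is_core T" and S: "is_transducer S"
  shows "is_core S"
proof -
  obtain p where p: "p \<in> states T"
    using T by (auto simp: is_transducer_def)
  have fp: "f p \<in> states S"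
    using p f(2) by auto
  have ss: "strongly_synchronizing S"
    using T sync_level_morphism[OF f] by (auto simp: is_core_def strongly_synchronizing_def)
  have "states S \<subseteq> states (core S)"
  proof
    fix s assume "s \<in> states S"
    then obtain q where q: "q \<in> states T" "s = f q"
      using f(2) by auto
    then have "q \<in> states (core T)"
      using T by (simp add: is_core_def)
    then obtain w where "q = step_word T w p" "sync_level T (length w)"
      using states_core[OF p] by auto
    then show "s \<in> states (core S)"
      using states_core[OF fp] tr_morphism_words(1)[OF f(1) p] q sync_level_morphism[OF f] by auto
  qed
  then show ?thesis
    using ss states_core_subset[OF S] by (auto simp: is_core_def)
qed

lemma strongly_synchronizing_tr_product:
  assumes "is_transducer T" "is_transducer U" "strongly_synchronizing T" "strongly_synchronizing U"
  shows "strongly_synchronizing (tr_product T U)"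
proof -
  obtain k m where k: "sync_level T k" and m: "sync_level U m"
    using assms(3,4) by (auto simp: strongly_synchronizing_def)
  \<comment> \<open>The first \<open>k\<close> letters bring \<open>T\<close> into a common state
    \<open>s\<close>. The remaining letters make it write at least \<open>m\<close> letters, the
    same in both runs, and these synchronize \<open>U\<close>.\<close>
  have "sync_level (tr_product T U) (k + m * card (states T))"
    unfolding sync_level_def
  proof (intro allI impI ballI)
    fix w :: "'a list" and r r'
    assume w: "length w = k + m * card (states T)"
      and "r \<in> states (tr_product T U)" "r' \<in> states (tr_product T U)"
    then obtain p q p' q' where r: "r = (p, q)" "r' = (p', q')" and st:
      "p \<in> states T" "p' \<in> states T" "q \<in> states U" "q' \<in> states U" by auto
    define u v s where "u = take k w" and "v = drop k w" and "s = step_word T u p"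
    have uv: "w = u @ v" "length u = k" "length v = m * card (states T)"
      using w by (auto simp: u_def v_def)
    have s: "step_word T u p' = s"
      unfolding s_def using k uv st by (intro sync_level_length) simp_all
    have "s \<in> states T"
      using st step_word_in_states[OF assms(1)] by (simp add: s_def)
    then have "m \<le> length (out_word T v s)"
      using length_out_word_ge[OF assms(1)] uv by simp
    then have "step_word U (out_word T v s) (step_word U (out_word T u p) q)
        = step_word U (out_word T v s) (step_word U (out_word T u p') q')"
      using sync_levelD[OF m assms(2)] st step_word_in_states[OF assms(2)] by blast
    then show "step_word (tr_product T U) w r = step_word (tr_product T U) w r'"
      using s by (simp add: r uv(1) s_def[symmetric])
  qed
  then show ?thesis
    by (auto simp: strongly_synchronizing_def)
qed

section \<open>Equivalence of synchronizing transducers up to prefixes\<close>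

text \<open>The two maps share a remainder \<open>h\<close>, since in general neither is obtained
  from the other by prepending a word. The bound \<open>B\<close> is explicit because equivalence of
  transducers needs it uniformly in the word read.\<close>

definition prefix_equiv ::
    "nat \<Rightarrow> ((nat \<Rightarrow> 'a) \<Rightarrow> (nat \<Rightarrow> 'b)) \<Rightarrow> ((nat \<Rightarrow> 'a) \<Rightarrow> (nat \<Rightarrow> 'b)) \<Rightarrow> bool" where
  "prefix_equiv B f g \<longleftrightarrow> (\<exists>a b h. length a \<le> B \<and> length b \<le> B \<and>
     (\<forall>x. f x = a \<frown> h x) \<and> (\<forall>x. g x = b \<frown> h x))"

lemma prefix_equivE:
  assumes "prefix_equiv B f g"
  obtains a b h where "length a \<le> B" "length b \<le> B" "\<And>x. f x = a \<frown> h x" "\<And>x. g x = b \<frown> h x"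
  using assms by (auto simp: prefix_equiv_def)

lemma prefix_equivI:
  assumes "length a \<le> B" "length b \<le> B" "\<And>x. f x = a \<frown> h x" "\<And>x. g x = b \<frown> h x"
  shows "prefix_equiv B f g"
  using assms unfolding prefix_equiv_def by blast

lemma prefix_equiv_refl: "prefix_equiv B f f"
  by (rule prefix_equivI[of "[]" _ "[]" _ f]) simp_all

lemma prefix_equiv_sym: "prefix_equiv B f g \<Longrightarrow> prefix_equiv B g f"
  unfolding prefix_equiv_def by blast

text \<open>The middle map has two decompositions. One of their prefixes extends the other, and its
  excess is appended to the prefix of the outer map paired with the shorter one.\<close>

lemma prefix_equiv_trans:
  assumes "prefix_equiv B f g" "prefix_equiv C g k"
  shows "prefix_equiv (B + C) f k"
proof -
  obtain a b h where ab: "length a \<le> B" "length b \<le> B" "\<And>x. f x = a \<frown> h x" "\<And>x. g x = b \<frown> h x"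
    by (rule prefix_equivE[OF assms(1)]) (rule that)
  obtain c d h' where cd: "length c \<le> C" "length d \<le> C" "\<And>x. g x = c \<frown> h' x" "\<And>x. k x = d \<frown> h' x"
    by (rule prefix_equivE[OF assms(2)]) (rule that)
  have eq: "b \<frown> h x = c \<frown> h' x" for x
    using ab(4) cd(3) by simp
  show ?thesis
  proof (cases "length b \<le> length c")
    case True
    then have "h x = drop (length b) c \<frown> h' x" for x
      using conc_cancel(2)[OF eq] by simp
    then show ?thesis
      using ab cd by (intro prefix_equivI[of "a @ drop (length b) c" _ d _ h']) auto
  next
    case False
    then have "h' x = drop (length c) b \<frown> h x" for x
      using conc_cancel(2)[OF eq[symmetric]] by simp
    then show ?thesis
      using ab cd by (intro prefix_equivI[of a _ "d @ drop (length c) b" _ h]) auto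
  qed
qed

lemma prefix_equiv_comp: "prefix_equiv B f g \<Longrightarrow> prefix_equiv B (\<lambda>x. f (h x)) (\<lambda>x. g (h x))"
  by (erule prefix_equivE) (rule prefix_equivI[where h = "\<lambda>x. k (h x)" for k], auto)

lemma prefix_equiv_conc:
  assumes "prefix_equiv B f g" "\<And>x. f' x = u \<frown> f x" "\<And>x. g' x = v \<frown> g x"
    "length u \<le> C" "length v \<le> C"
  shows "prefix_equiv (B + C) f' g'"
proof -
  obtain a b h where "length a \<le> B" "length b \<le> B" "\<And>x. f x = a \<frown> h x" "\<And>x. g x = b \<frown> h x"
    by (rule prefix_equivE[OF assms(1)]) (rule that)
  then show ?thesis
    using assms(2-) by (intro prefix_equivI[of "u @ a" _ "v @ b" _ h]) auto
qed

text \<open>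
  Two transducers are related when, after reading any sufficiently long word from any states, the
  two state maps agree up to bounded prefixes. This makes sense for transducers that are
  neither core nor minimal, and each class of nonconstant transducers contains exactly one element
  of the monoid \<open>\<M>\<^sub>n\<close>.
\<close>
definition tr_equiv :: "('a, 'p) transducer \<Rightarrow> ('a, 'q) transducer \<Rightarrow> bool" where
  "tr_equiv T S \<longleftrightarrow> (\<exists>K B. \<forall>w. K \<le> length w \<longrightarrow> (\<forall>p\<in>states T. \<forall>q\<in>states S.
     prefix_equiv B (state_map T (step_word T w p)) (state_map S (step_word S w q))))"

lemma tr_equivE:
  assumes "tr_equiv T S"
  obtains K B where "\<And>w p q. K \<le> length w \<Longrightarrow> p \<in> states T \<Longrightarrow> q \<in> states S \<Longrightarrow>
    prefix_equiv B (state_map T (step_word T w p)) (state_map S (step_word S w q))"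
  using assms unfolding tr_equiv_def by blast

lemma tr_equiv_sub:
  assumes "is_transducer T" "strongly_synchronizing T" "states T' \<subseteq> states T"
    "step T' = step T" "out T' = out T"
  shows "tr_equiv T' T"
proof -
  obtain k where k: "sync_level T k"
    using assms(2) by (auto simp: strongly_synchronizing_def)
  have st: "step_word T' = step_word T"
    by (intro ext) (simp add: step_word_def assms(4))
  have "out_word T' w q = out_word T w q" for w q
    using assms(4,5) by (induction w arbitrary: q) simp_all
  then have sm: "state_map T' = state_map T"
    by (simp add: state_map_def fun_eq_iff)
  have "prefix_equiv 0 (state_map T (step_word T w p)) (state_map T (step_word T w q))"
    if "k \<le> length w" "p \<in> states T'" "q \<in> states T" for w p q
  proof -
    have "step_word T w p = step_word T w q"
      by (rule sync_levelD[OF k assms(1)]) (use that assms(3) in auto)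
    then show ?thesis
      by (simp only: prefix_equiv_refl)
  qed
  then show ?thesis
    unfolding tr_equiv_def st sm by blast
qed

lemma tr_equiv_sym: "tr_equiv T S \<Longrightarrow> tr_equiv S T"
  unfolding tr_equiv_def using prefix_equiv_sym by blast

text \<open>The transducer hypothesis on \<open>S\<close> provides a state to compare through; an
  empty state set would be related to everything.\<close>

lemma tr_equiv_trans:
  assumes "tr_equiv T S" "tr_equiv S R" "is_transducer S"
  shows "tr_equiv T R"
proof -
  obtain K B where KB: "\<And>w p q. K \<le> length w \<Longrightarrow> p \<in> states T \<Longrightarrow> q \<in> states S \<Longrightarrow>
    prefix_equiv B (state_map T (step_word T w p)) (state_map S (step_word S w q))"
    using tr_equivE[OF assms(1)] by blast
  obtain L C where LC: "\<And>w p q. L \<le> length w \<Longrightarrow> p \<in> states S \<Longrightarrow> q \<in> states R \<Longrightarrow>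
    prefix_equiv C (state_map S (step_word S w p)) (state_map R (step_word R w q))"
    using tr_equivE[OF assms(2)] by blast
  obtain s where s: "s \<in> states S"
    using assms(3) by (auto simp: is_transducer_def)
  have "prefix_equiv (B + C) (state_map T (step_word T w p)) (state_map R (step_word R w q))"
    if "K + L \<le> length w" "p \<in> states T" "q \<in> states R" for w p q
    using prefix_equiv_trans[OF KB[of w p s] LC[of w s q]] that s by simp
  then show ?thesis
    unfolding tr_equiv_def by blast
qed

definition nonconstant :: "('a, 'q) transducer \<Rightarrow> bool" where
  "nonconstant T \<longleftrightarrow> (\<forall>q\<in>states T. \<exists>x y. state_map T q x \<noteq> state_map T q y)"

lemma nonconstantE:
  assumes "nonconstant T" "q \<in> states T" "\<And>x. state_map T q x = a \<frown> h x"
  obtains x y where "h x \<noteq> h y"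
  using assms unfolding nonconstant_def by metis

text \<open>The two residual maps of \<open>k\<close> after \<open>w\<close> can only differ by a shift of the maps \<open>h\<close>,
  which is impossible for nonconstant \<open>h\<close>.\<close>
lemma common_residual:
  assumes T: "is_transducer T" "p \<in> states T" and S: "is_transducer S" "q \<in> states S"
    and k: "\<And>x. state_map T p x = c \<frown> k x" "\<And>x. state_map S q x = d \<frown> k x"
    and h: "\<And>x. state_map T (step_word T w p) x = a \<frown> h x"
      "\<And>x. state_map S (step_word S w q) x = b \<frown> h x"
    and len: "length c \<le> length (out_word T w p @ a)" "length d \<le> length (out_word S w q @ b)"
    and "nonconstant T"
  obtains e where "out_word T w p @ a = c @ e" "out_word S w q @ b = d @ e"
proof -
  let ?e = "drop (length c) (out_word T w p @ a)" and ?e' = "drop (length d) (out_word S w q @ b)"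
  have eq: "c \<frown> k (w \<frown> x) = (out_word T w p @ a) \<frown> h x"
    "d \<frown> k (w \<frown> x) = (out_word S w q @ b) \<frown> h x" for x
    using state_map_conc[OF T, of w x] state_map_conc[OF S, of w x] k h by auto
  have "k (w \<frown> x) = ?e \<frown> h x" "k (w \<frown> x) = ?e' \<frown> h x" for x
    using conc_cancel(2)[OF eq(1) len(1)] conc_cancel(2)[OF eq(2) len(2)] .
  then have "?e \<frown> h x = ?e' \<frown> h x" for x
    by metis
  moreover obtain x y where "h x \<noteq> h y"
    using nonconstantE[OF \<open>nonconstant T\<close> step_word_in_states[OF T] h(1)] by blast
  ultimately have "?e = ?e'"
    using conc_left_unique[of ?e h ?e' x y] by blast
  then show ?thesis
    using that[of ?e] conc_cancel(1)[OF eq(1) len(1)] conc_cancel(1)[OF eq(2) len(2)] by simp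
qed

text \<open>The second factors read different words, namely the outputs of \<open>T\<close> and
  \<open>T'\<close>. By \<open>common_residual\<close> these outputs, completed by the residual
  prefixes \<open>a\<close> and \<open>b\<close>, end in a common word \<open>e\<close>. When
  \<open>e\<close> is long, \<open>U\<close> and \<open>U'\<close> have read the same long word
  last, so their state maps agree up to bounded prefixes.\<close>

lemma tr_equiv_tr_product:
  fixes T :: "('a::finite, 'p) transducer" and T' :: "('a, 'p2) transducer"
    and U :: "('a, 'q) transducer" and U' :: "('a, 'q2) transducer"
  assumes T: "is_transducer T" "is_transducer T'" "nonconstant T"
    and U: "is_transducer U" "is_transducer U'"
    and eqT: "tr_equiv T T'" and eqU: "tr_equiv U U'"
  shows "tr_equiv (tr_product T U) (tr_product T' U')"
proof -
  obtain K B where KB: "\<And>w p q. K \<le> length w \<Longrightarrow> p \<in> states T \<Longrightarrow> q \<in> states T' \<Longrightarrow>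
    prefix_equiv B (state_map T (step_word T w p)) (state_map T' (step_word T' w q))"
    using tr_equivE[OF eqT] by blast
  obtain L C where LC: "\<And>w p q. L \<le> length w \<Longrightarrow> p \<in> states U \<Longrightarrow> q \<in> states U' \<Longrightarrow>
    prefix_equiv C (state_map U (step_word U w p)) (state_map U' (step_word U' w q))"
    using tr_equivE[OF eqU] by blast
  obtain M where M: "\<And>q w. q \<in> states U \<Longrightarrow> length (out_word U w q) \<le> M * length w"
    using length_out_word_le[OF U(1)] by blast
  obtain M' where M': "\<And>q w. q \<in> states U' \<Longrightarrow> length (out_word U' w q) \<le> M' * length w"
    using length_out_word_le[OF U(2)] by blast
  \<comment> \<open>While reading \<open>w2\<close>, both first factors write at least
    \<open>B + L\<close> letters: up to \<open>B\<close> of them may belong to the prefixes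
    \<open>c\<close> and \<open>d\<close>, and \<open>L\<close> are left for
    \<open>e\<close>.\<close>
  define N where "N = (B + L) * card (states T) + (B + L) * card (states T')"
  have "prefix_equiv (C + (M + M') * B)
      (state_map (tr_product T U) (step_word (tr_product T U) w r))
      (state_map (tr_product T' U') (step_word (tr_product T' U') w r'))"
    if w: "K + N \<le> length w" and "r \<in> states (tr_product T U)" "r' \<in> states (tr_product T' U')"
    for w r r'
  proof -
    obtain p0 q0 p0' q0' where r: "r = (p0, q0)" "r' = (p0', q0')" and
      st: "p0 \<in> states T" "q0 \<in> states U" "p0' \<in> states T'" "q0' \<in> states U'"
      using \<open>r \<in> _\<close> \<open>r' \<in> _\<close> by auto
    define w1 w2 p1 p1' p p' q q' where "w1 = take K w" and "w2 = drop K w" and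
      "p1 = step_word T w1 p0" and "p1' = step_word T' w1 p0'" and
      "p = step_word T w2 p1" and "p' = step_word T' w2 p1'" and
      "q = step_word U (out_word T w p0) q0" and "q' = step_word U' (out_word T' w p0') q0'"
    have w12: "w = w1 @ w2" "length w1 = K" "N \<le> length w2"
      using w by (simp_all add: w1_def w2_def)
    have p: "p = step_word T w p0" "p' = step_word T' w p0'"
      by (simp_all add: w12(1) p_def p'_def p1_def p1'_def)
    have st1: "p1 \<in> states T" "p1' \<in> states T'" "p \<in> states T" "p' \<in> states T'"
      "q \<in> states U" "q' \<in> states U'"
      unfolding p1_def p1'_def p q_def q'_def using st T U by (simp_all add: step_word_in_states)
    obtain c d k where cd: "length c \<le> B" "length d \<le> B"
      "\<And>x. state_map T p1 x = c \<frown> k x" "\<And>x. state_map T' p1' x = d \<frown> k x"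
      unfolding p1_def p1'_def using KB[of w1 p0 p0'] w12(2) st by (auto elim: prefix_equivE)
    obtain a b h where ab: "length a \<le> B" "length b \<le> B"
      "\<And>x. state_map T p x = a \<frown> h x" "\<And>x. state_map T' p' x = b \<frown> h x"
      unfolding p using KB[of w p0 p0'] w st by (auto elim: prefix_equivE)
    have long: "B + L \<le> length (out_word T w2 p1)" "B + L \<le> length (out_word T' w2 p1')"
      using length_out_word_ge[OF T(1) st1(1), of "B + L" w2]
        length_out_word_ge[OF T(2) st1(2), of "B + L" w2] w12(3) by (simp_all add: N_def)
    have "length c \<le> length (out_word T w2 p1 @ a)" "length d \<le> length (out_word T' w2 p1' @ b)"
      using long cd(1,2) by simp_all
    then obtain e where e: "out_word T w2 p1 @ a = c @ e" "out_word T' w2 p1' @ b = d @ e"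
      using common_residual[OF T(1) st1(1) T(2) st1(2) cd(3,4)
          ab(3)[unfolded p_def] ab(4)[unfolded p'_def] _ _ T(3)] by blast
    have "length (out_word T w2 p1 @ a) = length (c @ e)"
      using e(1) by simp
    then have Le: "L \<le> length e"
      using long(1) cd(1) by simp
    \<comment> \<open>Everything read before \<open>e\<close> is absorbed into the starting state,
      which is arbitrary in \<open>LC\<close>.\<close>
    have s: "step_word U a q = step_word U e (step_word U (out_word T w1 p0 @ c) q0)"
    proof -
      have "step_word U a q = step_word U (out_word T w1 p0 @ (out_word T w2 p1 @ a)) q0"
        by (simp add: q_def w12(1) p1_def)
      then show ?thesis
        unfolding e by simp
    qed
    have s': "step_word U' b q' = step_word U' e (step_word U' (out_word T' w1 p0' @ d) q0')"
    proof -
      have "step_word U' b q' = step_word U' (out_word T' w1 p0' @ (out_word T' w2 p1' @ b)) q0'"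
        by (simp add: q'_def w12(1) p1'_def)
      then show ?thesis
        unfolding e by simp
    qed
    have "prefix_equiv C (state_map U (step_word U a q)) (state_map U' (step_word U' b q'))"
      unfolding s s' by (intro LC[OF Le] step_word_in_states U st)
    then have "prefix_equiv C (\<lambda>x. state_map U (step_word U a q) (h x))
        (\<lambda>x. state_map U' (step_word U' b q') (h x))"
      by (rule prefix_equiv_comp)
    moreover have "state_map (tr_product T U) (p, q) x
        = out_word U a q \<frown> state_map U (step_word U a q) (h x)" for x
      using state_map_tr_product[OF T(1) U(1) st1(3,5)] state_map_conc[OF U(1) st1(5)] ab(3) by simp
    moreover have "state_map (tr_product T' U') (p', q') x
        = out_word U' b q' \<frown> state_map U' (step_word U' b q') (h x)" for x
      using state_map_tr_product[OF T(2) U(2) st1(4,6)] state_map_conc[OF U(2) st1(6)] ab(4) by simp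
    moreover have "length (out_word U a q) \<le> (M + M') * B"
      using M[OF st1(5), of a] mult_le_mono[OF _ ab(1), of M "M + M'"] by simp
    moreover have "length (out_word U' b q') \<le> (M + M') * B"
      using M'[OF st1(6), of b] mult_le_mono[OF _ ab(2), of M' "M + M'"] by simp
    ultimately have "prefix_equiv (C + (M + M') * B)
        (state_map (tr_product T U) (p, q)) (state_map (tr_product T' U') (p', q'))"
      by (rule prefix_equiv_conc)
    then show ?thesis
      by (simp add: r p[symmetric] q_def[symmetric] q'_def[symmetric])
  qed
  then show ?thesis
    unfolding tr_equiv_def by blast
qed

text \<open>Reassociating a triple of states does not change the state map; synchronization takes
  care of runs starting from unrelated triples.\<close>

lemma tr_equiv_tr_product_assoc:
  assumes "is_transducer T" "is_transducer U" "is_transducer V"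
    "strongly_synchronizing T" "strongly_synchronizing U" "strongly_synchronizing V"
  shows "tr_equiv (tr_product (tr_product T U) V) (tr_product T (tr_product U V))"
proof -
  let ?L = "tr_product (tr_product T U) V" and ?R = "tr_product T (tr_product U V)"
  have R: "is_transducer ?R" "strongly_synchronizing ?R"
    using assms by (simp_all add: is_transducer_tr_product strongly_synchronizing_tr_product)
  obtain k where k: "sync_level ?R k"
    using R(2) by (auto simp: strongly_synchronizing_def)
  have "prefix_equiv 0 (state_map ?L (step_word ?L w r)) (state_map ?R (step_word ?R w r'))"
    if w: "k \<le> length w" and r: "r \<in> states ?L" and r': "r' \<in> states ?R" for w r r'
  proof -
    obtain p q s where pqs: "r = ((p, q), s)" "p \<in> states T" "q \<in> states U" "s \<in> states V"
      using r by auto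
    have "step_word ?R w r' = step_word ?R w (p, (q, s))"
      by (rule sync_levelD[OF k R(1) w r']) (use pqs in simp)
    moreover have sm: "state_map ?L ((p, q), s) x = state_map ?R (p, (q, s)) x"
      if "p \<in> states T" "q \<in> states U" "s \<in> states V" for p q s x
      using that assms by (simp add: state_map_tr_product is_transducer_tr_product)
    have "state_map ?L (step_word ?L w r) = state_map ?R (step_word ?R w (p, (q, s)))"
      unfolding pqs(1) step_word_tr_product out_word_tr_product
      by (intro ext sm step_word_in_states assms pqs)
    ultimately show ?thesis
      by (simp add: prefix_equiv_refl)
  qed
  then show ?thesis
    unfolding tr_equiv_def by blast
qed

section \<open>Loops\<close>

lemma word_power_0 [simp]: "word_power w 0 = []"
  and word_power_Suc [simp]: "word_power w (Suc k) = w @ word_power w k"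
  by (simp_all add: word_power_def)

lemma length_word_power [simp]: "length (word_power w k) = k * length w"
  by (induction k) simp_all

lemma word_power_snoc: "word_power w k @ w = w @ word_power w k"
  by (induction k) simp_all

lemma word_power_mult: "word_power (word_power w k) m = word_power w (m * k)"
proof (induction m)
  case (Suc m)
  have "word_power w (i + j) = word_power w i @ word_power w j" for i j
    by (induction i) simp_all
  then show ?case
    using Suc by simp
qed simp

lemma word_power_loop:
  assumes "step_word T w q = q"
  shows "step_word T (word_power w k) q = q" "out_word T (word_power w k) q = word_power (out_word T w q) k"
  using assms by (induction k) simp_all

definition sync_transducer :: "('a, 'q) transducer \<Rightarrow> bool" where
  "sync_transducer T \<longleftrightarrow> is_transducer T \<and> strongly_synchronizing T"

text \<open>\<open>word_power w k\<close> is long enough to synchronize and commutes with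
  \<open>w\<close>. Hence the state it forces is fixed by \<open>w\<close>, and any state fixed by
  \<open>w\<close> is forced by it.\<close>

lemma loop_state_ex1:
  assumes T: "sync_transducer T" and w: "w \<noteq> []"
  shows "\<exists>!q. q \<in> states T \<and> step_word T w q = q"
proof -
  obtain k where k: "sync_level T k"
    using T by (auto simp: sync_transducer_def strongly_synchronizing_def)
  have tr: "is_transducer T"
    using T by (simp add: sync_transducer_def)
  obtain p where p: "p \<in> states T"
    using tr by (auto simp: is_transducer_def)
  have kw: "k \<le> length (word_power w k)"
    using w by (cases w) simp_all
  define q where "q = step_word T (word_power w k) p"
  have "step_word T w q = step_word T (word_power w k @ w) p"
    by (simp add: q_def)
  also have "\<dots> = step_word T (word_power w k) (step_word T w p)"
    unfolding word_power_snoc by simp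
  also have "\<dots> = q"
    unfolding q_def by (rule sync_levelD[OF k tr kw step_word_in_states[OF tr p] p])
  finally have "step_word T w q = q" .
  moreover have "q \<in> states T"
    unfolding q_def by (rule step_word_in_states[OF tr p])
  moreover have "q' = q" if "q' \<in> states T" "step_word T w q' = q'" for q'
    using word_power_loop(1)[OF that(2), of k] sync_levelD[OF k tr kw that(1) p] by (simp add: q_def)
  ultimately show ?thesis by blast
qed

lemma loop_state:
  assumes "sync_transducer T" "w \<noteq> []"
  shows "loop_state T w \<in> states T" "step_word T w (loop_state T w) = loop_state T w"
  using theI'[OF loop_state_ex1[OF assms]] by (simp_all add: loop_state_def)

lemma loop_state_eqI:
  "sync_transducer T \<Longrightarrow> w \<noteq> [] \<Longrightarrow> q \<in> states T \<Longrightarrow> step_word T w q = q \<Longrightarrow> loop_state T w = q"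
  using loop_state_ex1[of T w] loop_state[of T w] by blast

definition loop_out :: "('a, 'q) transducer \<Rightarrow> 'a list \<Rightarrow> 'a list" where
  "loop_out T w = out_word T w (loop_state T w)"

lemma loop_out_nonempty: "sync_transducer T \<Longrightarrow> w \<noteq> [] \<Longrightarrow> loop_out T w \<noteq> []"
  using loop_state[of T w] unfolding loop_out_def sync_transducer_def is_transducer_def by blast

lemma loop_out_word_power:
  assumes "sync_transducer T" "w \<noteq> []" "k > 0"
  shows "loop_out T (word_power w k) = word_power (loop_out T w) k"
proof -
  have "word_power w k \<noteq> []"
    using assms by (cases k) simp_all
  then have "loop_state T (word_power w k) = loop_state T w"
    using loop_state[OF assms(1,2)] assms(1) by (intro loop_state_eqI) (simp_all add: word_power_loop)
  then show ?thesis
    using word_power_loop(2)[OF loop_state(2)[OF assms(1,2)]] by (simp add: loop_out_def)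
qed

text \<open>Starting the loop at another of its states rotates the input and conjugates the output
  by the word written on the way to that state.\<close>

lemma loop_out_append_commute:
  assumes "sync_transducer T" "u @ v \<noteq> []"
  shows "\<exists>a. loop_out T (u @ v) @ a = a @ loop_out T (v @ u)"
proof -
  let ?q = "loop_state T (u @ v)"
  have q: "?q \<in> states T" "step_word T (u @ v) ?q = ?q"
    using loop_state[OF assms] by simp_all
  have "loop_state T (v @ u) = step_word T u ?q"
    using assms q step_word_in_states by (intro loop_state_eqI) (auto simp: sync_transducer_def)
  then have "loop_out T (u @ v) @ out_word T u ?q = out_word T u ?q @ loop_out T (v @ u)"
    using q(2) by (simp add: loop_out_def)
  then show ?thesis by blast
qed

lemma sync_transducer_tr_product:
  "sync_transducer T \<Longrightarrow> sync_transducer U \<Longrightarrow> sync_transducer (tr_product T U)"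
  by (simp add: sync_transducer_def is_transducer_tr_product strongly_synchronizing_tr_product)

lemma loop_out_tr_product:
  assumes "sync_transducer T" "sync_transducer U" "w \<noteq> []"
  shows "loop_out (tr_product T U) w = loop_out U (loop_out T w)"
proof -
  let ?q = "(loop_state T w, loop_state U (loop_out T w))"
  have "loop_state (tr_product T U) w = ?q"
    using assms loop_state[of T w] loop_state[of U "loop_out T w"] loop_out_nonempty[of T w]
    by (intro loop_state_eqI sync_transducer_tr_product) (simp_all add: loop_out_def)
  then show ?thesis
    by (simp add: loop_out_def)
qed

text \<open>Loop states are reached along arbitrarily long powers of \<open>w\<close>, so their maps
  agree up to prefixes \<open>a\<close> and \<open>b\<close>. These prefixes are the same before and
  after the loop, which makes the common residual \<open>e\<close> conjugate to both loop
  outputs.\<close>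

lemma tr_equiv_loop_out:
  assumes T: "sync_transducer T" "nonconstant T" and S: "sync_transducer S"
    and eq: "tr_equiv T S" and w: "w \<noteq> []"
  obtains a b e where "loop_out T w @ a = a @ e" "loop_out S w @ b = b @ e"
proof -
  obtain K B where KB: "\<And>w p q. K \<le> length w \<Longrightarrow> p \<in> states T \<Longrightarrow> q \<in> states S \<Longrightarrow>
    prefix_equiv B (state_map T (step_word T w p)) (state_map S (step_word S w q))"
    using tr_equivE[OF eq] by blast
  let ?p = "loop_state T w" and ?q = "loop_state S w"
  have p: "?p \<in> states T" "step_word T w ?p = ?p" and q: "?q \<in> states S" "step_word S w ?q = ?q"
    using loop_state T S w by blast+
  have "K \<le> length (word_power w K)"
    using w by (cases w) simp_all
  then have "prefix_equiv B (state_map T ?p) (state_map S ?q)"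
    using KB[OF _ p(1) q(1), of "word_power w K"] word_power_loop(1) p(2) q(2) by metis
  then obtain a b h where ab: "length a \<le> B" "length b \<le> B" "\<And>x. state_map T ?p x = a \<frown> h x" "\<And>x. state_map S ?q x = b \<frown> h x"
    by (rule prefix_equivE) (rule that)
  note ab = ab(3,4)
  have tr: "is_transducer T" "is_transducer S"
    using T S by (simp_all add: sync_transducer_def)
  have ab': "\<And>x. state_map T (step_word T w ?p) x = a \<frown> h x"
    "\<And>x. state_map S (step_word S w ?q) x = b \<frown> h x"
    using ab p(2) q(2) by simp_all
  obtain e where "out_word T w ?p @ a = a @ e" "out_word S w ?q @ b = b @ e"
    by (rule common_residual[OF tr(1) p(1) tr(2) q(1) ab ab' _ _ T(2)]) auto
  then show ?thesis
    using that[of a e b] by (simp add: loop_out_def)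
qed

section \<open>Clopen sets of infinite words\<close>

lemma openin_box:
  assumes "finite F"
  shows "openin (product_topology (\<lambda>_. discrete_topology UNIV) UNIV) {y. \<forall>i\<in>F. y i = (x :: 'i \<Rightarrow> 'a) i}"
proof -
  let ?S = "\<lambda>i. if i \<in> F then {x i} else UNIV"
  have "{y. \<forall>i\<in>F. y i = x i} = PiE UNIV ?S"
    by (auto simp: PiE_def Pi_def extensional_def)
  moreover have "finite {i \<in> UNIV. ?S i \<noteq> topspace (discrete_topology UNIV)}"
    using assms by (rule rev_finite_subset) auto
  ultimately show ?thesis
    by (simp add: openin_PiE_gen)
qed

text \<open>Finitely many boxes on which \<open>P\<close> is constant cover the compact product, and
  the coordinates fixed by these boxes suffice. The index type is left open to serve one-sided and
  two-sided words alike.\<close>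

lemma finite_dependence_if_locally_constant:
  fixes P :: "('i \<Rightarrow> 'a::finite) \<Rightarrow> 'b"
  assumes "\<And>x. openin (product_topology (\<lambda>_. discrete_topology UNIV) UNIV) {y. P y = P x}"
  shows "\<exists>F. finite F \<and> (\<forall>x y. (\<forall>i\<in>F. x i = y i) \<longrightarrow> P x = P y)"
proof -
  let ?X = "product_topology (\<lambda>_. discrete_topology UNIV) UNIV :: ('i \<Rightarrow> 'a) topology"
  have "\<exists>F. finite F \<and> (\<forall>y. (\<forall>i\<in>F. y i = x i) \<longrightarrow> P y = P x)" for x
  proof -
    have "x \<in> {y. P y = P x}" by simp
    from bspec[OF assms[of x, unfolded openin_product_topology_alt] this]
    obtain U where "finite {i \<in> UNIV. U i \<noteq> topspace (discrete_topology UNIV)}"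
      "\<forall>i\<in>UNIV. openin (discrete_topology UNIV) (U i)"
      "x \<in> PiE UNIV U" "PiE UNIV U \<subseteq> {y. P y = P x}"
      by (elim exE conjE) (rule that)
    note U = this(1,3,4)
    let ?F = "{i. U i \<noteq> UNIV}"
    have "P y = P x" if y: "\<forall>i\<in>?F. y i = x i" for y
    proof -
      have "y i \<in> U i" for i
      proof (cases "U i = UNIV")
        case False
        then show ?thesis
          using y U(2) by (auto simp: PiE_def Pi_def)
      qed simp
      then show ?thesis
        using U(3) by (auto simp: PiE_def Pi_def)
    qed
    moreover have "finite ?F"
      using U(1) by simp
    ultimately show ?thesis by blast
  qed
  then obtain F where F: "\<And>x. finite (F x)" "\<And>x y. \<forall>i\<in>F x. y i = x i \<Longrightarrow> P y = P x"
    by metis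
  let ?B = "\<lambda>x. {y. \<forall>i\<in>F x. y i = x i}"
  have "compact_space ?X"
    by (simp add: compact_space_product_topology compact_space_discrete_topology)
  moreover have "\<forall>U\<in>range ?B. openin ?X U"
    using openin_box[OF F(1)] by auto
  moreover have "topspace ?X \<subseteq> \<Union> (range ?B)"
    by auto
  ultimately obtain \<F> where \<F>: "finite \<F>" "\<F> \<subseteq> range ?B" "topspace ?X \<subseteq> \<Union> \<F>"
    unfolding compact_space_alt by meson
  obtain Y where "finite Y" "\<F> = ?B ` Y"
    using finite_subset_image[OF \<F>(1,2)] by blast
  with \<F>(3) have Y: "finite Y" "topspace ?X \<subseteq> (\<Union>x\<in>Y. ?B x)"
    by simp_all
  show ?thesis
  proof (intro exI conjI allI impI)
    show "finite (\<Union>x\<in>Y. F x)"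
      using Y F by auto
    fix x y :: "'i \<Rightarrow> 'a" assume xy: "\<forall>i\<in>(\<Union>x\<in>Y. F x). x i = y i"
    have "x \<in> topspace ?X" by simp
    then obtain z where z: "z \<in> Y" "x \<in> ?B z"
      using Y(2) by blast
    have "P x = P z"
      using z(2) by (intro F(2)) simp
    moreover have "P y = P z"
    proof (rule F(2), rule ballI)
      fix i assume i: "i \<in> F z"
      then have "y i = x i"
        using xy z(1) by (metis UN_I)
      then show "y i = z i"
        using z(2) i by simp
    qed
    ultimately show "P x = P y" by simp
  qed
qed

text \<open>These are the unions of cones of depth \<open>k\<close>. A set of this form for some
  \<open>k\<close> is clopen, and conversely by compactness.\<close>

definition determined :: "nat \<Rightarrow> (nat \<Rightarrow> 'a) set \<Rightarrow> bool" where
  "determined k S \<longleftrightarrow> (\<forall>x y. prefix k x = prefix k y \<longrightarrow> x \<in> S \<longrightarrow> y \<in> S)"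

definition finitary :: "(nat \<Rightarrow> 'a) set \<Rightarrow> bool" where
  "finitary S \<longleftrightarrow> (\<exists>k. determined k S)"

lemma determinedD: "determined k S \<Longrightarrow> prefix k x = prefix k y \<Longrightarrow> x \<in> S \<Longrightarrow> y \<in> S"
  unfolding determined_def by blast

lemma determined_mono: "determined k S \<Longrightarrow> k \<le> m \<Longrightarrow> determined m S"
  unfolding determined_def using prefix_eq_mono by blast

lemma clopen_iff_finitary:
  "openin cantor_space S \<and> closedin cantor_space S \<longleftrightarrow> finitary (S :: (nat \<Rightarrow> 'a::finite) set)"
proof
  assume S: "openin cantor_space S \<and> closedin cantor_space S"
  then have "openin cantor_space (- S)"
    by (simp add: closedin_def Compl_eq_Diff_UNIV)
  then have op: "openin cantor_space {y. (y \<in> S) = (x \<in> S)}" for x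
    using S by (cases "x \<in> S") (simp_all add: Collect_neg_eq)
  obtain F where F: "finite F" "\<And>x y. \<forall>i\<in>F. x i = y i \<Longrightarrow> (x \<in> S) = (y \<in> S)"
    using finite_dependence_if_locally_constant[of "\<lambda>x. x \<in> S", OF op] by metis
  obtain k where k: "\<And>i. i \<in> F \<Longrightarrow> i < k"
    using F(1) unfolding finite_nat_set_iff_bounded by blast
  have "determined k S"
    unfolding determined_def
  proof (intro allI impI)
    fix x y :: "nat \<Rightarrow> 'a" assume *: "prefix k x = prefix k y" "x \<in> S"
    have "x i = y i" if "i \<in> F" for i
      using arg_cong[OF *(1), of "\<lambda>u. u ! i"] k[OF that] by simp
    then show "y \<in> S"
      using F(2)[of x y] *(2) by simp
  qed
  then show "finitary S"
    by (auto simp: finitary_def)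
next
  have open_finitary: "openin cantor_space S" if "determined k S" for k and S :: "(nat \<Rightarrow> 'a) set"
  proof -
    have "\<exists>U. openin cantor_space U \<and> x \<in> U \<and> U \<subseteq> S" if "x \<in> S" for x
    proof (intro exI conjI)
      show "openin cantor_space {y. \<forall>i\<in>{..<k}. y i = x i}"
        by (rule openin_box) simp
      have "prefix k x = prefix k y" if "\<forall>i\<in>{..<k}. y i = x i" for y
        using that by (intro nth_equalityI) simp_all
      then show "{y. \<forall>i\<in>{..<k}. y i = x i} \<subseteq> S"
        using determinedD[OF \<open>determined k S\<close>] \<open>x \<in> S\<close> by blast
    qed simp
    then show ?thesis
      by (subst openin_subopen) blast
  qed
  assume "finitary S"
  then obtain k where k: "determined k S"
    by (auto simp: finitary_def)
  then have "determined k (- S)"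
    unfolding determined_def by (metis ComplD ComplI)
  then show "openin cantor_space S \<and> closedin cantor_space S"
    using open_finitary k by (simp add: closedin_def Compl_eq_Diff_UNIV)
qed

lemma cone_eq_range: "cone v = range (conc v)"
  unfolding cone_def prefix_eq_iff_conc by auto

lemma determined_cones:
  assumes "determined k S"
  shows "S = (\<Union>w\<in>prefix k ` S. cone w)"
proof
  show "S \<subseteq> (\<Union>w\<in>prefix k ` S. cone w)"
    by (auto simp: cone_def)
  show "(\<Union>w\<in>prefix k ` S. cone w) \<subseteq> S"
  proof
    fix y assume "y \<in> (\<Union>w\<in>prefix k ` S. cone w)"
    then obtain x where "x \<in> S" "prefix k x = prefix k y"
      by (auto simp: cone_def)
    then show "y \<in> S"
      using determinedD[OF assms] by blast
  qed
qed

lemma determined_conc: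
  assumes "determined k S"
  shows "determined (length a + k) (conc a ` S)"
  unfolding determined_def
proof (intro allI impI)
  fix x y assume eq: "prefix (length a + k) x = prefix (length a + k) y" and "x \<in> conc a ` S"
  then obtain z where z: "x = a \<frown> z" "z \<in> S" by auto
  have "prefix (length a) y = a"
    using prefix_eq_mono[OF eq, of "length a"] z(1) by simp
  then obtain z' where z': "y = a \<frown> z'"
    unfolding prefix_eq_iff_conc by blast
  then have "prefix k z = prefix k z'"
    using eq z(1) by simp
  then show "y \<in> conc a ` S"
    using z z' determinedD[OF assms] by blast
qed

lemma determined_conc_cancel:
  assumes "determined k (conc a ` S)"
  shows "determined k S"
  unfolding determined_def
proof (intro allI impI)
  fix x y assume *: "prefix k x = prefix k y" "x \<in> S"
  have "prefix k (a \<frown> x) = prefix k (a \<frown> y)"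
  proof (cases "k \<le> length a")
    case False
    then show ?thesis
      using prefix_eq_mono[OF *(1), of "k - length a"] by simp
  qed simp
  then have "a \<frown> y \<in> conc a ` S"
    using determinedD[OF assms] *(2) by blast
  then show "y \<in> S" by auto
qed

lemma finitary_conc_iff: "finitary (conc a ` S) \<longleftrightarrow> finitary S"
  unfolding finitary_def using determined_conc determined_conc_cancel by blast

lemma determined_UN:
  assumes "finite I" "\<And>i. i \<in> I \<Longrightarrow> finitary (S i)"
  shows "\<exists>k. (\<forall>i\<in>I. determined k (S i)) \<and> determined k (\<Union>i\<in>I. S i)"
proof -
  obtain f where f: "\<And>i. i \<in> I \<Longrightarrow> determined (f i) (S i)"
    using assms(2) unfolding finitary_def by metis
  have *: "determined (Max (f ` I)) (S i)" if "i \<in> I" for i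
    using determined_mono[OF f[OF that]] assms(1) that by simp
  then have "determined (Max (f ` I)) (\<Union>i\<in>I. S i)"
    unfolding determined_def by blast
  then show ?thesis
    using * by blast
qed

lemma finitary_UN: "finite I \<Longrightarrow> (\<And>i. i \<in> I \<Longrightarrow> finitary (S i)) \<Longrightarrow> finitary (\<Union>i\<in>I. S i)"
  using determined_UN[of I S] by (auto simp: finitary_def)

lemma finite_prefixes: "finite (prefix k ` (S :: (nat \<Rightarrow> 'a::finite) set))"
proof (rule finite_subset)
  show "prefix k ` S \<subseteq> {w. set w \<subseteq> UNIV \<and> length w = k}" by auto
  show "finite {w :: 'a list. set w \<subseteq> UNIV \<and> length w = k}"
    by (rule finite_lists_length_eq) simp
qed

lemma state_map_image_determined:
  assumes T: "is_transducer T" "q \<in> states T" and S: "determined k S"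
  shows "state_map T q ` S =
    (\<Union>w\<in>prefix k ` S. conc (out_word T w q) ` image_of_state T (step_word T w q))"
proof -
  have "state_map T q ` cone w = conc (out_word T w q) ` image_of_state T (step_word T w q)" for w
    by (auto simp: cone_eq_range image_of_state_def image_image state_map_conc[OF T])
  then show ?thesis
    by (subst determined_cones[OF S]) (simp add: image_UN)
qed

lemma finitary_state_map_image:
  fixes T :: "('a::finite, 'q) transducer"
  assumes T: "is_transducer T" "q \<in> states T" and fin: "\<And>p. p \<in> states T \<Longrightarrow> finitary (image_of_state T p)"
    and S: "finitary S"
  shows "finitary (state_map T q ` S)"
proof -
  obtain k where k: "determined k S"
    using S by (auto simp: finitary_def)
  show ?thesis
    unfolding state_map_image_determined[OF T k]
    using fin step_word_in_states[OF T] by (intro finitary_UN finite_prefixes) (simp add: finitary_conc_iff)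
qed

subsection \<open>Counting cones modulo \<open>n - 1\<close>\<close>

text \<open>Refining every cone once multiplies the count by the number of letters, which is 1
  modulo \<open>CARD('a) - 1\<close>.\<close>

lemma card_prefixes_Suc:
  fixes S :: "(nat \<Rightarrow> 'a::finite) set"
  assumes "determined k S"
  shows "card (prefix (Suc k) ` S) = CARD('a) * card (prefix k ` S)"
proof -
  let ?f = "\<lambda>(w, a). w @ [a :: 'a]"
  have "prefix (Suc k) ` S = ?f ` (prefix k ` S \<times> UNIV)"
  proof
    show "prefix (Suc k) ` S \<subseteq> ?f ` (prefix k ` S \<times> UNIV)"
      by auto
    show "?f ` (prefix k ` S \<times> UNIV) \<subseteq> prefix (Suc k) ` S"
    proof
      fix u assume "u \<in> ?f ` (prefix k ` S \<times> UNIV)"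
      then obtain x a where x: "x \<in> S" and u: "u = prefix k x @ [a]" by auto
      \<comment> \<open>Membership in \<open>S\<close> ignores letters from position
        \<open>k\<close> on, so \<open>[a]\<close> may be inserted there; the tail \<open>x\<close>
        is an arbitrary filler.\<close>
      let ?y = "(prefix k x @ [a]) \<frown> x"
      have "prefix k ?y = prefix k x" "prefix (Suc k) ?y = prefix k x @ [a]"
        by (simp_all only: prefix_conc_fst length_append subsequence_length) simp_all
      moreover from this have "?y \<in> S"
        using determinedD[OF assms _ x] by simp
      ultimately show "u \<in> prefix (Suc k) ` S"
        unfolding u by (metis imageI)
    qed
  qed
  moreover have "inj_on ?f (prefix k ` S \<times> UNIV)"
    by (auto simp: inj_on_def)
  ultimately show ?thesis
    by (simp add: card_image card_cartesian_product mult.commute)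
qed

text \<open>Counts disjoint cones modulo \<open>n - 1\<close>. The least depth is taken for
  definiteness; by \<open>cone_residue_eq\<close> every admissible depth gives the same
  residue.\<close>

definition cone_residue :: "(nat \<Rightarrow> 'a::finite) set \<Rightarrow> nat" where
  "cone_residue S = card (prefix (LEAST k. determined k S) ` S) mod (CARD('a) - 1)"

lemma cone_residue_eq:
  fixes S :: "(nat \<Rightarrow> 'a::finite) set"
  assumes "determined k S"
  shows "cone_residue S = card (prefix k ` S) mod (CARD('a) - 1)"
proof -
  define m where "m = (LEAST k. determined k S)"
  have m: "determined m S" "m \<le> k"
    using assms LeastI[of "\<lambda>k. determined k S"] Least_le[of "\<lambda>k. determined k S"]
    by (simp_all add: m_def)
  have "card (prefix (m + j) ` S) mod (CARD('a) - 1) = card (prefix m ` S) mod (CARD('a) - 1)" for j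
  proof (induction j)
    case (Suc j)
    let ?c = "card (prefix (m + j) ` S)"
    have "CARD('a) * ?c = ?c + (CARD('a) - 1) * ?c"
      by (cases "CARD('a)") simp_all
    then have "(CARD('a) * ?c) mod (CARD('a) - 1) = ?c mod (CARD('a) - 1)"
      by simp
    then show ?case
      using card_prefixes_Suc[OF determined_mono[OF m(1)], of "m + j"] Suc by simp
  qed simp
  from this[of "k - m"] show ?thesis
    using m(2) by (simp add: cone_residue_def m_def)
qed

lemma cone_residue_conc:
  assumes "finitary S"
  shows "cone_residue (conc a ` S) = cone_residue S"
proof -
  obtain k where k: "determined k S"
    using assms by (auto simp: finitary_def)
  have "prefix (length a + k) ` conc a ` S = append a ` prefix k ` S"
    by (simp add: image_image)
  moreover have "inj_on (append a) (prefix k ` S)"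
    by (simp add: inj_on_def)
  ultimately show ?thesis
    using cone_residue_eq[OF k] cone_residue_eq[OF determined_conc[OF k], of a] by (simp add: card_image)
qed

lemma cone_residue_UN:
  fixes S :: "'i \<Rightarrow> (nat \<Rightarrow> 'a::finite) set"
  assumes I: "finite I" "\<And>i. i \<in> I \<Longrightarrow> finitary (S i)"
    and disj: "\<And>i j. i \<in> I \<Longrightarrow> j \<in> I \<Longrightarrow> i \<noteq> j \<Longrightarrow> S i \<inter> S j = {}"
  shows "cone_residue (\<Union>i\<in>I. S i) = (\<Sum>i\<in>I. cone_residue (S i)) mod (CARD('a) - 1)"
proof -
  obtain k where k: "\<And>i. i \<in> I \<Longrightarrow> determined k (S i)" "determined k (\<Union>i\<in>I. S i)"
    using determined_UN[of I S, OF I] by blast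
  have "prefix k ` S i \<inter> prefix k ` S j = {}" if "i \<in> I" "j \<in> I" "i \<noteq> j" for i j
    using determinedD[OF k(1)[OF that(1)]] disj[OF that] by blast
  then have "card (\<Union>i\<in>I. prefix k ` S i) = (\<Sum>i\<in>I. card (prefix k ` S i))"
    using I(1) finite_prefixes by (intro card_UN_disjoint) auto
  then show ?thesis
    using cone_residue_eq[OF k(1)] cone_residue_eq[OF k(2)]
    by (simp add: image_UN mod_sum_eq)
qed

lemma cone_residue_UNIV: "cone_residue (UNIV :: (nat \<Rightarrow> 'a::finite) set) = 1 mod (CARD('a) - 1)"
proof -
  have "prefix 0 ` (UNIV :: (nat \<Rightarrow> 'a) set) = {[]}" by auto
  then show ?thesis
    using cone_residue_eq[of 0 "UNIV :: (nat \<Rightarrow> 'a) set"] by (simp add: determined_def)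
qed

lemma cone_residue_cone:
  fixes v :: "'a::finite list"
  shows "cone_residue (cone v) = 1 mod (CARD('a) - 1)"
proof -
  have "finitary (UNIV :: (nat \<Rightarrow> 'a) set)"
    by (auto simp: finitary_def determined_def)
  then show ?thesis
    by (simp add: cone_eq_range cone_residue_conc cone_residue_UNIV)
qed

lemma finitary_cone: "finitary (cone v)"
  unfolding finitary_def determined_def cone_def by (intro exI[of _ "length v"]) simp

lemma cones_nested:
  assumes "cone u \<inter> cone v \<noteq> {}" "length u \<le> length v"
  shows "cone v \<subseteq> cone u"
proof -
  obtain x where x: "prefix (length u) x = u" "prefix (length v) x = v"
    using assms(1) by (auto simp: cone_def)
  have "u = take (length u) v"
    using x assms(2) by (metis min.absorb1 subsequence_take add_0)
  then have "prefix (length u) y = u" if "prefix (length v) y = v" for y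
    using that assms(2) by (metis min.absorb1 subsequence_take add_0)
  then show ?thesis
    by (auto simp: cone_def)
qed

text \<open>In a cover with the least number of cones, two overlapping cones would be nested and the
  smaller one could be dropped. So such a cover is disjoint, and \<open>min_cones\<close> counts a
  disjoint decomposition.\<close>

lemma least_cones_residue:
  fixes S :: "(nat \<Rightarrow> 'a::finite) set"
  assumes "finitary S"
  shows "(LEAST m. \<exists>V. finite V \<and> card V = m \<and> S = (\<Union>v\<in>V. cone v)) mod (CARD('a) - 1) = cone_residue S"
    (is "(LEAST m. ?P m) mod _ = _")
proof -
  obtain k where k: "determined k S"
    using assms by (auto simp: finitary_def)
  have "?P (card (prefix k ` S))"
    by (intro exI[of _ "prefix k ` S"] conjI finite_prefixes refl determined_cones[OF k])
  then have "?P (LEAST m. ?P m)"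
    by (rule LeastI)
  then obtain V where V: "finite V" "card V = (LEAST m. ?P m)" "S = (\<Union>v\<in>V. cone v)"
    by blast
  have False if uv: "u \<in> V" "v \<in> V" "u \<noteq> v" "cone u \<inter> cone v \<noteq> {}" and le: "length u \<le> length v" for u v
  proof -
    have "V = insert v (V - {v})" and u: "u \<in> V - {v}"
      using uv by auto
    then have "S = cone v \<union> (\<Union>v\<in>V - {v}. cone v)"
      using V(3) by (metis UN_insert)
    moreover have "cone u \<subseteq> (\<Union>v\<in>V - {v}. cone v)"
      using u by (rule UN_upper)
    ultimately have "S = (\<Union>v\<in>V - {v}. cone v)"
      using cones_nested[OF uv(4) le] by (metis Un_absorb1 subset_trans)
    then have "?P (card (V - {v}))"
      using V(1) by (intro exI[of _ "V - {v}"]) simp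
    then have "(LEAST m. ?P m) \<le> card (V - {v})"
      by (rule Least_le)
    then show False
      using V(1,2) uv(2) card_Diff1_less[of V v] by simp
  qed
  then have "cone u \<inter> cone v = {}" if "u \<in> V" "v \<in> V" "u \<noteq> v" for u v
    using that by (metis Int_commute nat_le_linear)
  then have "cone_residue S = (\<Sum>v\<in>V. 1 mod (CARD('a) - 1)) mod (CARD('a) - 1)"
    using V(1) unfolding V(3) by (subst cone_residue_UN) (simp_all add: finitary_cone cone_residue_cone)
  also have "\<dots> = card V mod (CARD('a) - 1)"
    by (simp only: mod_sum_eq) simp
  finally show ?thesis
    using V(2) by simp
qed

text \<open>Injectivity keeps the images of disjoint cones disjoint, so their residues add up, and
  the word written while reading a cone does not affect its residue.\<close>

lemma cone_residue_state_map_image: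
  fixes T :: "('a::finite, 'q) transducer"
  assumes T: "is_transducer T" "q \<in> states T"
    and fin: "\<And>p. p \<in> states T \<Longrightarrow> finitary (image_of_state T p)"
    and inj: "inj (state_map T q)" and k: "determined k S"
  shows "cone_residue (state_map T q ` S) =
    (\<Sum>w\<in>prefix k ` S. cone_residue (image_of_state T (step_word T w q))) mod (CARD('a) - 1)"
proof -
  let ?D = "\<lambda>w. conc (out_word T w q) ` image_of_state T (step_word T w q)"
  have fin': "finitary (image_of_state T (step_word T w q))" for w
    using fin step_word_in_states[OF T] by blast
  have D: "?D w = state_map T q ` cone w" for w
    by (auto simp: cone_eq_range image_of_state_def image_image state_map_conc[OF T])
  have "cone_residue (\<Union>w\<in>prefix k ` S. ?D w)
      = (\<Sum>w\<in>prefix k ` S. cone_residue (?D w)) mod (CARD('a) - 1)"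
  proof (rule cone_residue_UN)
    fix w w' assume "w \<in> prefix k ` S" "w' \<in> prefix k ` S" "w \<noteq> w'"
    then have "cone w \<inter> cone w' = {}"
      by (auto simp: cone_def)
    then show "?D w \<inter> ?D w' = {}"
      unfolding D using inj by (simp add: image_Int[symmetric])
  qed (simp_all add: finite_prefixes finitary_conc_iff fin')
  then show ?thesis
    using state_map_image_determined[OF T k] by (simp add: cone_residue_conc[OF fin'])
qed

section \<open>Reduction\<close>

lemma common_prefixes_iff:
  "u \<in> common_prefixes T w q \<longleftrightarrow> (\<forall>x. \<exists>z. state_map T q (w \<frown> x) = u \<frown> z)"
  by (simp add: common_prefixes_def prefix_eq_iff_conc)

lemma Nil_common_prefix: "[] \<in> common_prefixes T w q"
  by (simp add: common_prefixes_def)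

lemma common_prefixes_cong:
  "state_map T q = state_map S p \<Longrightarrow> common_prefixes T w q = common_prefixes S w p"
  by (simp add: common_prefixes_def)

lemma common_prefixes_eq:
  assumes "u \<in> common_prefixes T w q" "v \<in> common_prefixes T w q" "length u = length v"
  shows "u = v"
proof -
  have "prefix (length u) (state_map T q (w \<frown> undefined)) = u"
    "prefix (length v) (state_map T q (w \<frown> undefined)) = v"
    using assms(1,2) by (simp_all add: common_prefixes_def)
  then show ?thesis
    using assms(3) by metis
qed

lemma common_prefixes_bounded:
  assumes "is_transducer T" "nonconstant T" "q \<in> states T"
  shows "\<exists>b. \<forall>u. u \<in> common_prefixes T w q \<longrightarrow> length u < b"
proof -
  obtain x y where xy: "state_map T (step_word T w q) x \<noteq> state_map T (step_word T w q) y"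
    using assms step_word_in_states unfolding nonconstant_def by metis
  then have "state_map T q (w \<frown> x) \<noteq> state_map T q (w \<frown> y)"
    using state_map_conc[OF assms(1,3)] by simp
  then obtain i where i: "state_map T q (w \<frown> x) i \<noteq> state_map T q (w \<frown> y) i"
    by auto
  have "length u \<le> i" if "u \<in> common_prefixes T w q" for u
  proof (rule ccontr)
    assume "\<not> length u \<le> i"
    moreover have "prefix (length u) (state_map T q (w \<frown> x)) = prefix (length u) (state_map T q (w \<frown> y))"
      using that by (simp add: common_prefixes_def)
    ultimately show False
      using i arg_cong[of _ _ "\<lambda>v. v ! i"] by (metis add_0 diff_zero not_le_imp_less subsequence_nth)
  qed
  then show ?thesis
    by (intro exI[of _ "Suc i"]) (simp add: less_Suc_eq_le)
qed

lemma Lam: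
  assumes "is_transducer T" "nonconstant T" "q \<in> states T"
  shows "Lam T w q \<in> common_prefixes T w q"
    and "\<And>u. u \<in> common_prefixes T w q \<Longrightarrow> length u \<le> length (Lam T w q)"
proof -
  obtain b where "\<forall>u. u \<in> common_prefixes T w q \<longrightarrow> length u < b"
    using common_prefixes_bounded[OF assms, where w = w] by (elim exE) (rule that)
  from arg_max_nat_lemma[of "\<lambda>u. u \<in> common_prefixes T w q", OF Nil_common_prefix this]
  show "Lam T w q \<in> common_prefixes T w q"
    and "\<And>u. u \<in> common_prefixes T w q \<Longrightarrow> length u \<le> length (Lam T w q)"
    by (simp_all add: Lam_def)
qed

text \<open>By maximality neither side is longer than the other, and two common prefixes of equal
  length coincide.\<close>

lemma Lam_word:
  assumes T: "is_transducer T" "nonconstant T" "q \<in> states T"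
  shows "Lam T w q = out_word T w q @ Lam T [] (step_word T w q)"
proof -
  let ?p = "step_word T w q" and ?o = "out_word T w q" and ?v = "Lam T w q"
  have p: "?p \<in> states T"
    by (rule step_word_in_states[OF T(1,3)])
  have sm: "state_map T q (w \<frown> x) = ?o \<frown> state_map T ?p x" for x
    by (rule state_map_conc[OF T(1,3)])
  have "?o @ Lam T [] ?p \<in> common_prefixes T w q"
    using Lam(1)[OF T(1,2) p, of "[]"] by (simp add: common_prefixes_iff sm flip: conc_conc)
  then have len: "length ?o + length (Lam T [] ?p) \<le> length ?v"
    using Lam(2)[OF T, of "?o @ Lam T [] ?p" w] by simp
  have "?v = ?o @ drop (length ?o) ?v \<and> (\<exists>z. state_map T ?p x = drop (length ?o) ?v \<frown> z)" for x
  proof -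
    obtain z where "?o \<frown> state_map T ?p x = ?v \<frown> z"
      using Lam(1)[OF T, of w] by (auto simp: common_prefixes_iff sm)
    then show ?thesis
      using conc_cancel[of ?o _ ?v z] len by auto
  qed
  then have v: "?v = ?o @ drop (length ?o) ?v" "drop (length ?o) ?v \<in> common_prefixes T [] ?p"
    by (auto simp: common_prefixes_iff)
  have "drop (length ?o) ?v = Lam T [] ?p"
  proof (rule common_prefixes_eq[OF v(2) Lam(1)[OF T(1,2) p]])
    show "length (drop (length ?o) ?v) = length (Lam T [] ?p)"
      using len Lam(2)[OF T(1,2) p v(2)] by simp
  qed
  then show ?thesis
    using v(1) by simp
qed

lemma extent_finite:
  assumes "is_transducer T" "nonconstant T" "q \<in> states T"
  shows "extent T q \<noteq> \<infinity>"
proof -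
  have "extent T q \<le> enat (length (Lam T [] q))"
    unfolding extent_def using Lam(2)[OF assms] by (intro SUP_least) simp
  then show ?thesis
    by (cases "extent T q") simp_all
qed

lemma complete_response_iff: "\<not> incomplete_response T q \<longleftrightarrow> common_prefixes T [] q = {[]}"
proof
  assume "\<not> incomplete_response T q"
  then have "enat (length u) \<le> 0" if "u \<in> common_prefixes T [] q" for u
    unfolding incomplete_response_def extent_def using SUP_upper[OF that, of "\<lambda>u. enat (length u)"]
    by simp
  then show "common_prefixes T [] q = {[]}"
    using Nil_common_prefix by (auto simp: enat_0_iff)
next
  assume "common_prefixes T [] q = {[]}"
  then show "\<not> incomplete_response T q"
    by (simp add: incomplete_response_def extent_def enat_0)
qed

text \<open>Without incomplete response the state map determines outputs and successor maps, because
  the output on \<open>w\<close> is the greatest common prefix of the outputs on the words starting with \<open>w\<close>.\<close>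
lemma complete_response_step:
  assumes T: "is_transducer T" "p \<in> states T" and S: "is_transducer S" "q \<in> states S"
    and eq: "state_map T p = state_map S q"
    and cp: "common_prefixes T [] (step_word T w p) = {[]}" "common_prefixes S [] (step_word S w q) = {[]}"
  shows "out_word T w p = out_word S w q" "state_map T (step_word T w p) = state_map S (step_word S w q)"
proof -
  let ?o = "out_word T w p" and ?o' = "out_word S w q"
  have eq': "?o \<frown> state_map T (step_word T w p) x = ?o' \<frown> state_map S (step_word S w q) x" for x
    using state_map_conc[OF T, of w x] state_map_conc[OF S, of w x] eq by simp
  show o: "?o = ?o'"
  proof (cases "length ?o \<le> length ?o'")
    case True
    then have "drop (length ?o) ?o' \<in> common_prefixes T [] (step_word T w p)"
      using conc_cancel(2)[OF eq'] by (auto simp: common_prefixes_iff)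
    then show ?thesis
      using conc_cancel(1)[OF eq' True] cp(1) by (metis append_Nil2 singletonD)
  next
    case False
    then have le: "length ?o' \<le> length ?o" by simp
    have "drop (length ?o') ?o \<in> common_prefixes S [] (step_word S w q)"
      using conc_cancel(2)[OF eq'[symmetric] le] by (auto simp: common_prefixes_iff)
    then show ?thesis
      using conc_cancel(1)[OF eq'[symmetric] le] cp(2) by (metis append_Nil2 singletonD)
  qed
  show "state_map T (step_word T w p) = state_map S (step_word S w q)"
    using eq' o by auto
qed

text \<open>The nonconstant elements of \<open>M_transducers\<close>, described without an order on
  the letters and for any type of states. Strong connectedness is a consequence of being
  core.\<close>

definition reduced :: "('a, 'q) transducer \<Rightarrow> bool" where
  "reduced T \<longleftrightarrow> is_transducer T \<and> is_core T \<and> weakly_minimal T \<and>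
     (\<forall>q\<in>states T. common_prefixes T [] q = {[]})"

lemma reduced_sync: "reduced T \<Longrightarrow> sync_transducer T"
  by (simp add: reduced_def sync_transducer_def is_core_def)

text \<open>A constant state map has its first letter as a common prefix, contrary to complete
  response.\<close>

lemma reduced_nonconstant:
  assumes "reduced T"
  shows "nonconstant T"
  unfolding nonconstant_def
proof (rule ballI, rule ccontr)
  fix q assume q: "q \<in> states T" and "\<nexists>x y. state_map T q x \<noteq> state_map T q y"
  then have "state_map T q x = state_map T q undefined" for x
    by blast
  then have "prefix 1 (state_map T q undefined) \<in> common_prefixes T [] q"
    unfolding common_prefixes_def by simp metis
  then show False
    using assms q by (auto simp: reduced_def)
qed

section \<open>Removing the incomplete response\<close>

context
  fixes C :: "('a, 'q) transducer"
  assumes C: "is_transducer C" "nonconstant C"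
begin

lemma step_strip_response [simp]: "step (strip_response C) = step C"
  and states_strip_response [simp]: "states (strip_response C) = states C"
  and step_word_strip_response [simp]: "step_word (strip_response C) = step_word C"
  by (simp_all add: strip_response_def step_word_def fun_eq_iff)

text \<open>Each new output drops the common prefix of the current state at the front and
  anticipates that of the next state at the end; over a word the intermediate prefixes
  cancel.\<close>

lemma out_word_strip_response:
  assumes "q \<in> states C"
  shows "Lam C [] q @ out_word (strip_response C) w q = out_word C w q @ Lam C [] (step_word C w q)"
  using assms
proof (induction w arbitrary: q)
  case (Cons a w)
  let ?S = "strip_response C"
  have "Lam C [] q \<in> common_prefixes C [a] q"
    using Lam(1)[OF C Cons.prems, of "[]"] by (simp add: common_prefixes_def)
  then have le: "length (Lam C [] q) \<le> length (Lam C [a] q)"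
    by (rule Lam(2)[OF C Cons.prems])
  obtain z where z: "state_map C q ([a] \<frown> undefined) = Lam C [] q \<frown> z"
    using Lam(1)[OF C Cons.prems, of "[]"] by (auto simp: common_prefixes_iff)
  obtain z' where "state_map C q ([a] \<frown> undefined) = Lam C [a] q \<frown> z'"
    using Lam(1)[OF C Cons.prems, of "[a]"] unfolding common_prefixes_iff by blast
  with z have "Lam C [a] q = Lam C [] q @ drop (length (Lam C [] q)) (Lam C [a] q)"
    using conc_cancel(1)[OF _ le] by metis
  moreover have "Lam C [a] q = out C a q @ Lam C [] (step C a q)"
    using Lam_word[OF C Cons.prems, of "[a]"] by simp
  ultimately have "Lam C [] q @ out ?S a q = out C a q @ Lam C [] (step C a q)"
    by (simp add: strip_response_def)
  moreover have "Lam C [] (step C a q) @ out_word ?S w (step C a q)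
      = out_word C w (step C a q) @ Lam C [] (step_word C w (step C a q))"
    using Cons C step_word_in_states[OF C(1), of q "[a]"] by simp
  ultimately show ?case
    by (metis append.assoc out_word.simps(2) step_strip_response step_word_Cons)
qed simp

lemma is_transducer_strip_response: "is_transducer (strip_response C)"
  unfolding is_transducer_def
proof (intro conjI ballI allI impI)
  fix q w assume *: "q \<in> states (strip_response C)" "w \<noteq> []" "step_word (strip_response C) w q = q"
  \<comment> \<open>Along a loop the prefix dropped at the front and the prefix added at the end
    belong to the same state, so the output keeps its length.\<close>
  have "length (Lam C [] q @ out_word (strip_response C) w q) = length (out_word C w q @ Lam C [] (step_word C w q))"
    using out_word_strip_response[of q w] * by simp
  then have "length (out_word (strip_response C) w q) = length (out_word C w q)"
    using * by simp
  moreover have "out_word C w q \<noteq> []"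
    using C(1) * by (simp add: is_transducer_def)
  ultimately show "out_word (strip_response C) w q \<noteq> []" by auto
qed (use C in \<open>auto simp: is_transducer_def\<close>)

lemma state_map_strip_response:
  assumes q: "q \<in> states C"
  shows "state_map C q x = Lam C [] q \<frown> state_map (strip_response C) q x"
proof -
  obtain y where y: "state_map C q x = Lam C [] q \<frown> y"
    using Lam(1)[OF C q, of "[]"] by (auto simp: common_prefixes_iff)
  have "y = state_map (strip_response C) q x"
  proof (rule state_map_unique[OF is_transducer_strip_response])
    show "q \<in> states (strip_response C)"
      using q by simp
    fix k
    let ?w = "prefix k x"
    obtain z where "state_map C (step_word C ?w q) (suffix k x) = Lam C [] (step_word C ?w q) \<frown> z"
      using Lam(1)[OF C step_word_in_states[OF C(1) q], of "[]"] by (auto simp: common_prefixes_iff)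
    moreover have "state_map C q x = out_word C ?w q \<frown> state_map C (step_word C ?w q) (suffix k x)"
      using state_map_conc[OF C(1) q, of ?w "suffix k x"] by simp
    ultimately have "Lam C [] q \<frown> y = (Lam C [] q @ out_word (strip_response C) ?w q) \<frown> z"
      using y out_word_strip_response[OF q, of ?w] by simp
    then have "y = out_word (strip_response C) ?w q \<frown> z"
      by (metis conc_conc same_concat_eq)
    then show "\<exists>z. y = out_word (strip_response C) ?w q \<frown> z" by blast
  qed
  then show ?thesis
    using y by simp
qed

lemma common_prefixes_strip_response:
  assumes q: "q \<in> states C"
  shows "common_prefixes (strip_response C) [] q = {[]}"
proof -
  have "u = []" if "u \<in> common_prefixes (strip_response C) [] q" for u
  proof -
    have "Lam C [] q @ u \<in> common_prefixes C [] q"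
      using that state_map_strip_response[OF q] by (simp add: common_prefixes_iff flip: conc_conc)
    then show ?thesis
      using Lam(2)[OF C q] by fastforce
  qed
  then show ?thesis
    by (auto simp: Nil_common_prefix)
qed

lemma is_core_strip_response: "is_core C \<Longrightarrow> is_core (strip_response C)"
  unfolding is_core_def strongly_synchronizing_def core_def forced_state_def sync_level_def
  by simp

end

section \<open>Merging states with equal maps\<close>

context
  fixes C :: "('a, 'q) transducer"
  assumes C: "is_transducer C" "\<And>q. q \<in> states C \<Longrightarrow> common_prefixes C [] q = {[]}"
begin

lemma state_class_eq_iff:
  "p \<in> states C \<Longrightarrow> q \<in> states C \<Longrightarrow> state_class C p = state_class C q \<longleftrightarrow> state_map C p = state_map C q"
  unfolding state_class_def by auto

lemma identify_states_morphism:
  "tr_morphism (state_class C) C (identify_states C)"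
  "state_class C ` states C = states (identify_states C)"
proof -
  show "tr_morphism (state_class C) C (identify_states C)"
    unfolding tr_morphism_def
  proof (intro ballI conjI allI)
    fix q a assume q: "q \<in> states C"
    show "state_class C q \<in> states (identify_states C)"
      using q by (simp add: identify_states_def)
    show st: "step C a q \<in> states C"
      using C(1) q by (simp add: is_transducer_def)
    \<comment> \<open>\<open>r\<close> is the representative chosen by
      \<open>identify_states\<close>; complete response makes its outputs and successor maps agree
      with those of \<open>q\<close>.\<close>
    define r where "r = (SOME p. p \<in> state_class C q)"
    have "r \<in> state_class C q"
      unfolding r_def by (rule someI[of _ q]) (simp add: state_class_def q)
    then have r: "r \<in> states C" "state_map C r = state_map C q"
      by (simp_all add: state_class_def)
    have st': "step C a r \<in> states C"
      using C(1) r by (simp add: is_transducer_def)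
    have "out_word C [a] r = out_word C [a] q \<and>
      state_map C (step_word C [a] r) = state_map C (step_word C [a] q)"
      using complete_response_step[OF C(1) r(1) C(1) q r(2), of "[a]"] C(2) st st' by simp
    then show "state_class C (step C a q) = step (identify_states C) a (state_class C q)"
      "out C a q = out (identify_states C) a (state_class C q)"
      using state_class_eq_iff[OF st st'] by (simp_all add: identify_states_def r_def)
  qed
  show "state_class C ` states C = states (identify_states C)"
    by (simp add: identify_states_def)
qed

lemma state_map_identify_states:
  "q \<in> states C \<Longrightarrow> state_map (identify_states C) (state_class C q) = state_map C q"
  by (rule tr_morphism_state_map[OF identify_states_morphism(1)])

text \<open>A loop of classes need not lift to a loop, but its power with exponent
  \<open>card (states C)\<close> lifts to a path long enough to write something. If the loop wrote
  nothing, neither would its powers.\<close>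

lemma is_transducer_identify_states: "is_transducer (identify_states C)"
proof (rule is_transducer_morphism[OF identify_states_morphism C(1)])
  let ?E = "identify_states C"
  fix K w assume "K \<in> states ?E" and w: "w \<noteq> []" "step_word ?E w K = K"
  then obtain q where q: "q \<in> states C" "K = state_class C q"
    by (auto simp: identify_states_def)
  let ?N = "card (states C)"
  have "?N \<le> length (word_power w ?N)"
    using w(1) by (cases w) simp_all
  then have "out_word C (word_power w ?N) q \<noteq> []"
    by (rule out_word_nonempty[OF C(1) q(1)])
  then have "word_power (out_word ?E w K) ?N \<noteq> []"
    using tr_morphism_words(2)[OF identify_states_morphism(1) q(1)] word_power_loop(2)[OF w(2)] q(2)
    by metis
  moreover have "word_power [] m = []" for m
    by (induction m) simp_all
  ultimately show "out_word ?E w K \<noteq> []"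
    by metis
qed

lemma reduced_identify_states:
  assumes "is_core C"
  shows "reduced (identify_states C)"
  unfolding reduced_def
proof (intro conjI ballI)
  let ?E = "identify_states C"
  show E: "is_transducer ?E"
    by (rule is_transducer_identify_states)
  show "is_core ?E"
    by (rule is_core_morphism[OF identify_states_morphism C(1) assms E])
  show "weakly_minimal ?E"
    unfolding weakly_minimal_def identify_states_morphism(2)[symmetric]
    using state_map_identify_states state_class_eq_iff by auto
  show "common_prefixes ?E [] K = {[]}" if K: "K \<in> states ?E" for K
  proof -
    obtain q where q: "q \<in> states C" "K = state_class C q"
      using K by (auto simp: identify_states_def)
    then show ?thesis
      using common_prefixes_cong[OF state_map_identify_states[OF q(1)]] C(2) by simp
  qed
qed

end

section \<open>The reduction of a nonconstant transducer\<close>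

lemma reduction_eq:
  assumes "is_transducer C" "nonconstant C"
  shows "reduction C = identify_states (strip_response C)"
  by (simp add: reduction_def extent_finite[OF assms] del: not_infinity_eq)

lemma reduced_reduction:
  assumes C: "is_transducer C" "nonconstant C" "is_core C"
  shows "reduced (reduction C)"
  unfolding reduction_eq[OF C(1,2)]
  using C by (intro reduced_identify_states)
    (simp_all add: is_transducer_strip_response common_prefixes_strip_response is_core_strip_response)

lemma reduction_state_maps:
  assumes C: "is_transducer C" "nonconstant C" and K: "K \<in> states (reduction C)"
  obtains q where "q \<in> states C" "\<And>x. state_map C q x = Lam C [] q \<frown> state_map (reduction C) K x"
proof -
  let ?S = "strip_response C"
  have S: "is_transducer ?S" "\<And>q. q \<in> states ?S \<Longrightarrow> common_prefixes ?S [] q = {[]}"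
    using C by (simp_all add: is_transducer_strip_response common_prefixes_strip_response)
  obtain q where q: "q \<in> states C" "K = state_class ?S q"
    using K C by (auto simp: reduction_eq[OF C] identify_states_def)
  then have "state_map (reduction C) K = state_map ?S q"
    using state_map_identify_states[OF S] C by (simp add: reduction_eq[OF C])
  then show ?thesis
    using that q(1) state_map_strip_response[OF C q(1)] by simp
qed

lemma tr_equiv_reduction:
  assumes C: "is_transducer C" "nonconstant C" "strongly_synchronizing C"
  shows "tr_equiv (reduction C) C"
proof -
  let ?S = "strip_response C" and ?R = "reduction C"
  have S: "is_transducer ?S" "\<And>q. q \<in> states ?S \<Longrightarrow> common_prefixes ?S [] q = {[]}"
    using C by (simp_all add: is_transducer_strip_response common_prefixes_strip_response)
  obtain k where k: "sync_level C k"
    using C(3) by (auto simp: strongly_synchronizing_def)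
  \<comment> \<open>The longest deleted prefix bounds the discrepancy at every state.\<close>
  let ?B = "Max ((\<lambda>q. length (Lam C [] q)) ` states C)"
  have fin: "finite (states C)"
    using C(1) by (simp add: is_transducer_def)
  have "prefix_equiv ?B (state_map ?R (step_word ?R w K)) (state_map C (step_word C w q))"
    if w: "k \<le> length w" and K: "K \<in> states ?R" and q: "q \<in> states C" for w K q
  proof -
    obtain p where p: "p \<in> states C" "K = state_class ?S p"
      using K C by (auto simp: reduction_eq[OF C(1,2)] identify_states_def)
    define s where "s = step_word C w p"
    have s: "s \<in> states C" "step_word C w q = s"
      unfolding s_def by (rule step_word_in_states[OF C(1) p(1)], rule sync_levelD[OF k C(1) w q p(1)])
    have "step_word ?R w K = state_class ?S s"
      using tr_morphism_words(1)[OF identify_states_morphism(1)[OF S], of p w] p C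
      by (simp add: reduction_eq[OF C(1,2)] s_def)
    then have "state_map ?R (step_word ?R w K) = state_map ?S s"
      using state_map_identify_states[OF S, of s] s(1) C by (simp add: reduction_eq[OF C(1,2)])
    moreover have "length (Lam C [] s) \<le> ?B"
      using s(1) fin by simp
    ultimately show ?thesis
      using s state_map_strip_response[OF C(1,2) s(1)]
      by (intro prefix_equivI[of "[]" _ "Lam C [] s" _ "state_map ?S s"]) simp_all
  qed
  then show ?thesis
    unfolding tr_equiv_def by blast
qed

section \<open>Reduced transducers\<close>

text \<open>Complete response leaves no room for the prefixes: each is common to all values of its
  map, hence empty.\<close>

lemma prefix_equiv_complete_response:
  assumes "prefix_equiv B (state_map T p) (state_map S q)"
    and cp: "common_prefixes T [] p = {[]}" "common_prefixes S [] q = {[]}"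
  shows "state_map T p = state_map S q"
proof -
  obtain a b h where ab: "length a \<le> B" "length b \<le> B" "\<And>x. state_map T p x = a \<frown> h x"
    "\<And>x. state_map S q x = b \<frown> h x"
    by (rule prefix_equivE[OF assms(1)]) (rule that)
  then have "a \<in> common_prefixes T [] p" "b \<in> common_prefixes S [] q"
    by (auto simp: common_prefixes_iff)
  then show ?thesis
    using ab(3,4) cp by auto
qed

text \<open>In a core transducer \<open>q\<close> lies on arbitrarily long loops, so the comparison
  after long words applies to the map of \<open>q\<close> itself, and complete response turns it
  into an equality.\<close>

lemma reduced_state_maps_subset:
  assumes T: "reduced T" and S: "reduced S" and eq: "tr_equiv T S" and q: "q \<in> states T"
  obtains p where "p \<in> states S" "state_map S p = state_map T q"
proof -
  obtain K B where KB: "\<And>w p q. K \<le> length w \<Longrightarrow> p \<in> states T \<Longrightarrow> q \<in> states S \<Longrightarrow>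
    prefix_equiv B (state_map T (step_word T w p)) (state_map S (step_word S w q))"
    using tr_equivE[OF eq] by blast
  obtain s where s: "s \<in> states S"
    using S by (auto simp: reduced_def is_transducer_def)
  have trT: "is_transducer T" "is_core T" and trS: "is_transducer S"
    using T S by (simp_all add: reduced_def)
  obtain w where w: "K \<le> length w" "step_word T w q = q"
    using is_core_reached[OF trT q q] by blast
  have "state_map T q = state_map S (step_word S w s)"
    using KB[OF w(1) q s] w(2) T S q step_word_in_states[OF trS s]
    by (intro prefix_equiv_complete_response) (simp_all add: reduced_def)
  then show ?thesis
    using that[of "step_word S w s"] step_word_in_states[OF trS s] by simp
qed

lemma reduced_tr_equal_if_equiv:
  assumes T: "reduced T" and S: "reduced S" and eq: "tr_equiv T S"
  shows "tr_equal T S"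
proof -
  define f where "f q = (SOME p. p \<in> states S \<and> state_map S p = state_map T q)" for q
  have f: "f q \<in> states S" "state_map S (f q) = state_map T q" if q: "q \<in> states T" for q
  proof -
    obtain p where "p \<in> states S \<and> state_map S p = state_map T q"
      using reduced_state_maps_subset[OF T S eq q] by blast
    then show "f q \<in> states S" "state_map S (f q) = state_map T q"
      unfolding f_def by (metis (mono_tags, lifting) someI)+
  qed
  have "bij_betw f (states T) (states S)"
    unfolding bij_betw_def
  proof
    show "inj_on f (states T)"
      using f T by (metis inj_onI reduced_def weakly_minimal_def)
    have "p \<in> f ` states T" if p: "p \<in> states S" for p
    proof -
      obtain q where q: "q \<in> states T" "state_map T q = state_map S p"
        using reduced_state_maps_subset[OF S T tr_equiv_sym[OF eq] p] by blast
      then have "f q = p"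
        using f p S by (metis reduced_def weakly_minimal_def)
      then show ?thesis
        using q(1) by blast
    qed
    then show "f ` states T = states S"
      using f(1) by blast
  qed
  then show ?thesis
    unfolding tr_equal_def using f(2) by metis
qed

text \<open>The map \<open>f\<close> is not assumed to respect steps; equality of state maps
  propagates along words by \<open>complete_response_step\<close>.\<close>

lemma tr_equiv_if_state_maps:
  assumes T: "reduced T" and S: "reduced S"
    and f: "\<And>q. q \<in> states T \<Longrightarrow> f q \<in> states S \<and> state_map S (f q) = state_map T q"
  shows "tr_equiv T S"
proof -
  have trT: "is_transducer T" and trS: "is_transducer S"
    using T S by (simp_all add: reduced_def)
  obtain k where k: "sync_level S k"
    using S by (auto simp: reduced_def is_core_def strongly_synchronizing_def)
  have "prefix_equiv 0 (state_map T (step_word T w p)) (state_map S (step_word S w q))"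
    if w: "k \<le> length w" and p: "p \<in> states T" and q: "q \<in> states S" for w p q
  proof -
    have "step_word S w q = step_word S w (f p)"
      by (rule sync_levelD[OF k trS w q]) (use f p in simp)
    moreover have "state_map T (step_word T w p) = state_map S (step_word S w (f p))"
      using f[OF p] p T S step_word_in_states[OF trT p] step_word_in_states[OF trS]
      by (intro complete_response_step(2)[OF trT _ trS]) (simp_all add: reduced_def)
    ultimately show ?thesis
      by (simp add: prefix_equiv_refl)
  qed
  then show ?thesis
    unfolding tr_equiv_def by blast
qed

lemma reduced_tr_equiv_iff_equal:
  assumes "reduced T" "reduced S"
  shows "tr_equiv T S \<longleftrightarrow> tr_equal T S"
proof
  show "tr_equiv T S \<Longrightarrow> tr_equal T S"
    by (rule reduced_tr_equal_if_equiv[OF assms])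
  assume "tr_equal T S"
  then obtain f where "bij_betw f (states T) (states S)"
    "\<forall>q\<in>states T. state_map T q = state_map S (f q)"
    by (auto simp: tr_equal_def)
  then show "tr_equiv T S"
    by (intro tr_equiv_if_state_maps[OF assms, of f]) (auto dest: bij_betwE)
qed

text \<open>Products and reductions have states of other types, while a \<open>tclass\<close>
  contains only transducers on natural numbers. This supplies its members.\<close>

lemma ex_nat_reduced:
  fixes T :: "('a, 'q) transducer"
  assumes T: "reduced T"
  shows "\<exists>U :: ('a, nat) transducer. reduced U \<and> tr_equiv U T"
proof -
  have trT: "is_transducer T" "is_core T"
    using T by (simp_all add: reduced_def)
  have "finite (states T)"
    using trT by (simp add: is_transducer_def)
  then obtain g :: "'q \<Rightarrow> nat" where g: "inj_on g (states T)"
    using finite_imp_inj_to_nat_seg by metis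
  define U :: "('a, nat) transducer" where
    "U = \<lparr>states = g ` states T, step = \<lambda>a i. g (step T a (inv_into (states T) g i)),
      out = \<lambda>a i. out T a (inv_into (states T) g i)\<rparr>"
  have mor: "tr_morphism g T U" "g ` states T = states U"
    using trT(1) g by (auto simp: tr_morphism_def U_def is_transducer_def)
  have trU: "is_transducer U"
  proof (rule is_transducer_morphism[OF mor trT(1)])
    fix i w assume "i \<in> states U" and w: "w \<noteq> []" "step_word U w i = i"
    then obtain q where q: "q \<in> states T" "i = g q"
      by (auto simp: U_def)
    have "g (step_word T w q) = g q"
      using tr_morphism_words(1)[OF mor(1) q(1), of w] w q by simp
    then have "step_word T w q = q"
      using g q(1) step_word_in_states[OF trT(1) q(1)] by (meson inj_onD)
    then show "out_word U w i \<noteq> []"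
      using tr_morphism_words(2)[OF mor(1) q(1), of w] trT(1) w(1) q by (simp add: is_transducer_def)
  qed
  have sm: "state_map U (g q) = state_map T q" if "q \<in> states T" for q
    by (rule tr_morphism_state_map[OF mor(1) that])
  have U: "reduced U"
    unfolding reduced_def
  proof (intro conjI ballI)
    show "is_core U"
      by (rule is_core_morphism[OF mor trT trU])
    show "weakly_minimal U"
      using T sm unfolding weakly_minimal_def reduced_def mor(2)[symmetric] by auto
    show "common_prefixes U [] i = {[]}" if i: "i \<in> states U" for i
    proof -
      obtain q where q: "q \<in> states T" "i = g q"
        using i by (auto simp: U_def)
      then show ?thesis
        using common_prefixes_cong[OF sm[OF q(1)]] T by (simp add: reduced_def)
    qed
  qed (rule trU)
  have "tr_equiv T U"
    using sm mor(2) by (intro tr_equiv_if_state_maps[OF T U, of g]) auto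
  then show ?thesis
    using U tr_equiv_sym by blast
qed

text \<open>The constant elements of \<open>\<M>\<^sub>n\<close> are the transducers \<open>Z\<^sub>x\<close>.\<close>
lemma reduced_iff_M_transducers: "reduced T \<longleftrightarrow> T \<in> M_transducers \<and> nonconstant T"
proof
  assume T: "reduced T"
  then have "strongly_connected T"
    using strongly_connected_if_core by (auto simp: reduced_def)
  then show "T \<in> M_transducers \<and> nonconstant T"
    using T reduced_nonconstant[OF T]
    by (simp add: M_transducers_def reduced_def minimal_def complete_response_iff is_core_def)
next
  assume T: "T \<in> M_transducers \<and> nonconstant T"
  have "\<not> (\<exists>s x. states T = {s} \<and> (\<forall>a. out T a s = x) \<and> prime_word x \<and> least_rotation x)"
  proof
    assume "\<exists>s x. states T = {s} \<and> (\<forall>a. out T a s = x) \<and> prime_word x \<and> least_rotation x"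
    then obtain s where s: "states T = {s}" "\<forall>a. out T a s = out T undefined s"
      by metis
    then have st: "step T a s = s" for a
      using T by (auto simp: M_transducers_def is_transducer_def)
    have "out_word T w s = word_power (out T undefined s) (length w)" for w
      using s(2) by (induction w) (simp_all add: st)
    then have "state_map T s x = state_map T s y" for x y
      by (simp add: state_map_def)
    then show False
      using T s by (auto simp: nonconstant_def)
  qed
  then show "reduced T"
    using T by (auto simp: M_transducers_def minimal_def reduced_def complete_response_iff)
qed

section \<open>Transducers inducing clopen embeddings\<close>

text \<open>Demands neither core nor minimal, so that the property passes to raw products as well as
  to cores.\<close>

definition clopen_embedding :: "('a, 'q) transducer \<Rightarrow> bool" where
  "clopen_embedding T \<longleftrightarrow> sync_transducer T \<and> nonconstant T \<and>
     (\<forall>q\<in>states T. inj (state_map T q) \<and> finitary (image_of_state T q))"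

lemma clopen_embeddingD:
  assumes "clopen_embedding T"
  shows "is_transducer T" "strongly_synchronizing T" "sync_transducer T" "nonconstant T"
    "\<And>q. q \<in> states T \<Longrightarrow> inj (state_map T q)"
    "\<And>q. q \<in> states T \<Longrightarrow> finitary (image_of_state T q)"
  using assms by (simp_all add: clopen_embedding_def sync_transducer_def)

lemma clopen_embedding_core: "clopen_embedding T \<Longrightarrow> clopen_embedding (core T)"
  using states_core_subset[of T] is_transducer_core[of T] strongly_synchronizing_core[of T]
  unfolding clopen_embedding_def sync_transducer_def nonconstant_def image_of_state_def state_map_core
  by (simp add: subset_iff)

lemma image_of_state_tr_product:
  assumes "is_transducer T" "is_transducer U" "p \<in> states T" "q \<in> states U"
  shows "image_of_state (tr_product T U) (p, q) = state_map U q ` image_of_state T p"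
  by (simp add: image_of_state_def state_map_tr_product[OF assms] image_image)

lemma clopen_embedding_tr_product:
  fixes T :: "('a::finite, 'p) transducer" and U :: "('a, 'q) transducer"
  assumes T: "clopen_embedding T" and U: "clopen_embedding U"
  shows "clopen_embedding (tr_product T U)"
proof -
  note T = clopen_embeddingD[OF T] and U = clopen_embeddingD[OF U]
  have "inj (state_map (tr_product T U) (p, q)) \<and> finitary (image_of_state (tr_product T U) (p, q)) \<and>
    (\<exists>x y. state_map (tr_product T U) (p, q) x \<noteq> state_map (tr_product T U) (p, q) y)"
    if pq: "p \<in> states T" "q \<in> states U" for p q
  proof (intro conjI)
    show inj: "inj (state_map (tr_product T U) (p, q))"
      unfolding inj_def state_map_tr_product[OF T(1) U(1) pq]
      using injD[OF T(5)[OF pq(1)]] injD[OF U(5)[OF pq(2)]] by blast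
    show "finitary (image_of_state (tr_product T U) (p, q))"
      unfolding image_of_state_tr_product[OF T(1) U(1) pq]
      using U(6) T(6)[OF pq(1)] by (intro finitary_state_map_image[OF U(1) pq(2)])
    obtain x y where "state_map T p x \<noteq> state_map T p y"
      using T(4) pq(1) unfolding nonconstant_def by blast
    then have "x \<noteq> y" by auto
    then show "\<exists>x y. state_map (tr_product T U) (p, q) x \<noteq> state_map (tr_product T U) (p, q) y"
      using inj unfolding inj_def by blast
  qed
  then show ?thesis
    using sync_transducer_tr_product[OF T(3) U(3)]
    by (auto simp: clopen_embedding_def nonconstant_def)
qed

lemma clopen_embedding_reduction:
  assumes C: "clopen_embedding C" "is_core C"
  shows "clopen_embedding (reduction C)"
proof -
  note Cd = clopen_embeddingD[OF C(1)]
  have R: "reduced (reduction C)"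
    by (rule reduced_reduction[OF Cd(1,4) C(2)])
  have "inj (state_map (reduction C) K) \<and> finitary (image_of_state (reduction C) K)"
    if K: "K \<in> states (reduction C)" for K
  proof -
    obtain q where q: "q \<in> states C" "\<And>x. state_map C q x = Lam C [] q \<frown> state_map (reduction C) K x"
      using reduction_state_maps[OF Cd(1,4) K] by blast
    have "inj (state_map (reduction C) K)"
      using Cd(5)[OF q(1)] q(2) unfolding inj_def by simp
    moreover have "image_of_state C q = conc (Lam C [] q) ` image_of_state (reduction C) K"
      by (simp add: image_of_state_def q(2) image_image)
    then have "finitary (image_of_state (reduction C) K)"
      using Cd(6)[OF q(1)] finitary_conc_iff by metis
    ultimately show ?thesis ..
  qed
  then show ?thesis
    using reduced_sync[OF R] reduced_nonconstant[OF R] by (simp add: clopen_embedding_def)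
qed

lemma clopen_embedding_reduced_equiv:
  assumes T: "reduced T" and S: "reduced S" "clopen_embedding S" and eq: "tr_equiv T S"
  shows "clopen_embedding T"
  unfolding clopen_embedding_def
proof (intro conjI ballI)
  fix q assume "q \<in> states T"
  then obtain p where p: "p \<in> states S" "state_map S p = state_map T q"
    using reduced_state_maps_subset[OF T S(1) eq] by blast
  then show "inj (state_map T q)" "finitary (image_of_state T q)"
    using clopen_embeddingD(5,6)[OF S(2) p(1)] unfolding image_of_state_def by simp_all
qed (use reduced_sync[OF T] reduced_nonconstant[OF T] in simp_all)

section \<open>The groups of transducers\<close>

text \<open>Extends \<open>tclass\<close> to representatives that may be neither core nor minimal;
  the two agree on reduced transducers.\<close>

definition reduced_class :: "('a, 'q) transducer \<Rightarrow> 'a tclass" where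
  "reduced_class C = {T. reduced T \<and> tr_equiv T C}"

lemma reduced_class_cong:
  assumes "tr_equiv C D" "is_transducer C" "is_transducer D"
  shows "reduced_class C = reduced_class D"
  unfolding reduced_class_def using tr_equiv_trans[OF _ assms(1,2)] tr_equiv_trans[OF _ tr_equiv_sym[OF assms(1)] assms(3)]
  by blast

lemma tr_equiv_reduction_core:
  assumes "clopen_embedding C"
  shows "tr_equiv (reduction (core C)) C"
proof -
  note C = clopen_embeddingD[OF assms] and CC = clopen_embeddingD[OF clopen_embedding_core[OF assms]]
  have "tr_equiv (core C) C"
    using C states_core_subset by (intro tr_equiv_sub) auto
  then show ?thesis
    using tr_equiv_trans[OF tr_equiv_reduction[OF CC(1,4,2)] _ CC(1)] by blast
qed

lemma reduced_reduction_core: "clopen_embedding C \<Longrightarrow> reduced (reduction (core C))"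
  by (intro reduced_reduction clopen_embeddingD(1,4) clopen_embedding_core is_core_core clopen_embeddingD(2))

lemma reduced_class_nonempty:
  fixes C :: "('a::linorder, 'q) transducer"
  assumes "clopen_embedding C"
  obtains T where "T \<in> reduced_class C"
proof -
  have R: "reduced (reduction (core C))"
    by (rule reduced_reduction_core[OF assms])
  then obtain T :: "('a, nat) transducer" where "reduced T" "tr_equiv T (reduction (core C))"
    using ex_nat_reduced by blast
  then have "T \<in> reduced_class C"
    using tr_equiv_trans[OF _ tr_equiv_reduction_core[OF assms]] R
    by (auto simp: reduced_class_def reduced_def)
  then show ?thesis
    by (rule that)
qed

text \<open>The argument passes through the reduction of the core, whose state maps are those of
  states of \<open>C\<close> with a fixed prefix removed. This keeps injectivity and clopen
  images.\<close>

lemma clopen_embedding_reduced_class: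
  fixes C :: "('a::linorder, 'q) transducer"
  assumes C: "clopen_embedding C" and T: "T \<in> reduced_class C"
  shows "clopen_embedding T"
proof -
  note Cd = clopen_embeddingD[OF C]
  have emb: "clopen_embedding (reduction (core C))"
    by (rule clopen_embedding_reduction[OF clopen_embedding_core[OF C] is_core_core[OF Cd(1,2)]])
  have eq: "tr_equiv T (reduction (core C))"
    using T tr_equiv_trans[OF _ tr_equiv_sym[OF tr_equiv_reduction_core[OF C]] Cd(1)]
    by (auto simp: reduced_class_def)
  show ?thesis
    using T clopen_embedding_reduced_equiv[OF _ reduced_reduction_core[OF C] emb eq]
    by (simp add: reduced_class_def)
qed

lemma reduced_class_eq:
  fixes C :: "('a::linorder, 'q) transducer"
  assumes "clopen_embedding C" "T \<in> reduced_class C"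
  shows "reduced_class T = reduced_class C"
  using assms clopen_embeddingD(1) by (intro reduced_class_cong) (auto simp: reduced_class_def reduced_def)

lemma reduced_class_eq_iff:
  fixes C :: "('a::linorder, 'p) transducer" and D :: "('a, 'q) transducer"
  assumes C: "clopen_embedding C" and D: "clopen_embedding D"
  shows "reduced_class C = reduced_class D \<longleftrightarrow> tr_equiv C D"
proof
  assume eq: "reduced_class C = reduced_class D"
  obtain T where T: "T \<in> reduced_class C"
    by (rule reduced_class_nonempty[OF C])
  then have "tr_equiv C T" "tr_equiv T D" "is_transducer T"
    using eq tr_equiv_sym by (auto simp: reduced_class_def reduced_def)
  then show "tr_equiv C D"
    by (rule tr_equiv_trans)
next
  show "tr_equiv C D \<Longrightarrow> reduced_class C = reduced_class D"
    by (intro reduced_class_cong clopen_embeddingD(1)[OF C] clopen_embeddingD(1)[OF D])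
qed

section \<open>Elements and products of the monoid in terms of reduced transducers\<close>

lemma tclass_reduced:
  assumes S: "reduced S"
  shows "tclass S = reduced_class S"
proof -
  have "reduced T" if T: "T \<in> M_transducers" and eq: "tr_equal T S" for T
  proof -
    have "nonconstant T"
      using eq reduced_nonconstant[OF S] by (auto simp: tr_equal_def nonconstant_def dest: bij_betwE)
    then show ?thesis
      using T reduced_iff_M_transducers by blast
  qed
  then show ?thesis
    using reduced_tr_equiv_iff_equal[OF _ S] reduced_iff_M_transducers
    by (auto simp: tclass_def reduced_class_def)
qed

lemma tclass_reduction_core:
  assumes "clopen_embedding C"
  shows "tclass (reduction (core C)) = reduced_class C"
  using tclass_reduced[OF reduced_reduction_core[OF assms]] tr_equiv_reduction_core[OF assms]
    reduced_reduction_core[OF assms] clopen_embeddingD(1)[OF assms]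
  by (simp add: reduced_class_cong reduced_def)

lemma two_letters: "2 \<le> CARD('a::finite) \<Longrightarrow> \<exists>a b :: 'a. a \<noteq> b"
  using card_le_Suc0_iff_eq[of "UNIV :: 'a set"] by auto

text \<open>With at least two letters an injective state map is not constant. This excludes the
  constant elements, so every remaining one is the class of a reduced transducer.\<close>

lemma carrier_O_tilde:
  assumes n: "2 \<le> CARD('a::{finite,linorder})"
  shows "A \<in> carrier (O_tilde :: 'a tclass monoid) \<longleftrightarrow>
    (\<exists>T :: ('a, nat) transducer. reduced T \<and> clopen_embedding T \<and> A = reduced_class T)"
proof
  assume A: "A \<in> carrier (O_tilde :: 'a tclass monoid)"
  then obtain T where T: "T \<in> M_transducers" "A = tclass T"
    by (auto simp: O_tilde_def M_monoid_def)
  have TA: "T \<in> A"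
    using T by (auto simp: tclass_def tr_equal_def intro!: exI[of _ id])
  have emb: "inj (state_map T q) \<and> finitary (image_of_state T q)" if "q \<in> states T" for q
    using A TA that by (simp add: O_tilde_def flip: clopen_iff_finitary)
  obtain a b :: 'a where "a \<noteq> b"
    using two_letters[OF n] by blast
  then have "(\<lambda>_ :: nat. a) \<noteq> (\<lambda>_. b)"
    by (simp add: fun_eq_iff)
  then have "nonconstant T"
    using emb unfolding nonconstant_def inj_def by blast
  then have "reduced T"
    using T(1) reduced_iff_M_transducers by blast
  then show "\<exists>T :: ('a, nat) transducer. reduced T \<and> clopen_embedding T \<and> A = reduced_class T"
    using T(2) emb tclass_reduced[of T] reduced_sync[of T] reduced_nonconstant[of T]
    by (intro exI[of _ T]) (simp add: clopen_embedding_def)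
next
  assume "\<exists>T :: ('a, nat) transducer. reduced T \<and> clopen_embedding T \<and> A = reduced_class T"
  then obtain T :: "('a, nat) transducer" where T: "reduced T" "clopen_embedding T" "A = reduced_class T" by blast
  have "A = tclass T" "T \<in> M_transducers"
    using T tclass_reduced reduced_iff_M_transducers by blast+
  moreover have "clopen_embedding S" if "S \<in> A" for S
    using clopen_embedding_reduced_class T(2,3) that by blast
  ultimately show "A \<in> carrier (O_tilde :: 'a tclass monoid)"
    unfolding O_tilde_def M_monoid_def
    by (auto simp: clopen_embedding_def clopen_iff_finitary[symmetric])
qed

lemma carrier_O_tildeE:
  fixes A :: "'a::{finite,linorder} tclass"
  assumes n: "2 \<le> CARD('a)" and A: "A \<in> carrier O_tilde"
  obtains T :: "('a::{finite,linorder}, nat) transducer" where "clopen_embedding T" "A = reduced_class T"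
proof -
  obtain T :: "('a, nat) transducer" where "reduced T" "clopen_embedding T" "A = reduced_class T"
    using A unfolding carrier_O_tilde[OF n] by blast
  then show ?thesis
    using that[of T] by simp
qed

lemma reduced_class_in_O_tilde:
  fixes C :: "('a::{finite,linorder}, 'q) transducer"
  assumes n: "2 \<le> CARD('a)" and C: "clopen_embedding C"
  shows "reduced_class C \<in> carrier O_tilde"
proof -
  obtain T where T: "T \<in> reduced_class C"
    by (rule reduced_class_nonempty[OF C])
  then have "reduced T"
    by (simp add: reduced_class_def)
  then show ?thesis
    unfolding carrier_O_tilde[OF n]
    using clopen_embedding_reduced_class[OF C T] reduced_class_eq[OF C T, symmetric] by blast
qed

lemma O_tilde_member:
  fixes A :: "'a::{finite,linorder} tclass"
  assumes n: "2 \<le> CARD('a)" and A: "A \<in> carrier O_tilde" and T: "T \<in> A"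
  shows "reduced T" "clopen_embedding T" "A = reduced_class T"
proof -
  obtain S :: "('a, nat) transducer" where S: "clopen_embedding S" "A = reduced_class S"
    by (rule carrier_O_tildeE[OF n A]) (rule that)
  then show "clopen_embedding T" "A = reduced_class T"
    using T clopen_embedding_reduced_class[OF S(1)] reduced_class_eq[OF S(1)] by simp_all
  show "reduced T"
    using T unfolding S(2) by (simp add: reduced_class_def)
qed

text \<open>The product of the monoid is a union over all pairs of representatives. Each pair
  contributes the same class because equivalence is compatible with products; from here on reduction
  disappears from calculations.\<close>

lemma mult_O_tilde:
  fixes C :: "('a::{finite,linorder}, 'p) transducer" and D :: "('a, 'q) transducer"
  assumes C: "clopen_embedding C" and D: "clopen_embedding D"
  shows "reduced_class C \<otimes>\<^bsub>O_tilde\<^esub> reduced_class D = reduced_class (tr_product C D)"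
proof -
  note Cd = clopen_embeddingD[OF C] and Dd = clopen_embeddingD[OF D]
  have *: "tclass (reduction (core (tr_product T U))) = reduced_class (tr_product C D)"
    if T: "T \<in> reduced_class C" and U: "U \<in> reduced_class D" for T U
  proof -
    note Te = clopen_embedding_reduced_class[OF C T] and Ue = clopen_embedding_reduced_class[OF D U]
    note Td = clopen_embeddingD[OF Te] and Ud = clopen_embeddingD[OF Ue]
    have "tr_equiv (tr_product T U) (tr_product C D)"
      using T U Cd Dd Td Ud by (intro tr_equiv_tr_product) (auto simp: reduced_class_def)
    then show ?thesis
      using tclass_reduction_core[OF clopen_embedding_tr_product[OF Te Ue]] Cd Dd Td Ud
        is_transducer_tr_product reduced_class_cong by metis
  qed
  obtain T U where "T \<in> reduced_class C" "U \<in> reduced_class D"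
    using reduced_class_nonempty[OF C] reduced_class_nonempty[OF D] by metis
  then show ?thesis
    using * by (auto simp: O_tilde_def M_monoid_def)
qed

section \<open>The identity transducer and the monoid laws\<close>

lemma word_id_transducer [simp]: "step_word id_transducer w q = q" "out_word id_transducer w q = w"
  by (induction w) (auto simp: id_transducer_def)

lemma states_id_transducer [simp]: "states id_transducer = {()}"
  by (simp add: id_transducer_def)

lemma is_transducer_id: "is_transducer id_transducer"
  by (simp add: is_transducer_def)

lemma state_map_id_transducer [simp]: "state_map id_transducer q x = x"
  by (rule state_map_unique[OF is_transducer_id, symmetric]) (simp, metis word_id_transducer(2) prefix_suffix)

lemma sync_level_id: "sync_level id_transducer k"
  by (simp add: sync_level_def)

text \<open>A nonempty common prefix would fix the first letter of every infinite word, which two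
  letters prevent.\<close>

lemma reduced_id_transducer:
  assumes n: "2 \<le> CARD('a::finite)"
  shows "reduced (id_transducer :: ('a, unit) transducer)"
proof -
  let ?I = "id_transducer :: ('a, unit) transducer"
  have "states (core ?I) = states ?I"
    using states_core[of "()" ?I] sync_level_id Ex_list_of_length[of 0] by auto
  then have "is_core ?I"
    using sync_level_id by (auto simp: is_core_def strongly_synchronizing_def)
  moreover have "u = []" if u: "u \<in> common_prefixes ?I [] ()" for u
  proof (rule ccontr)
    assume "u \<noteq> []"
    have "x 0 = u ! 0" for x :: "nat \<Rightarrow> 'a"
    proof -
      have "prefix (length u) x = u"
        using u by (simp add: common_prefixes_def)
      then show ?thesis
        using \<open>u \<noteq> []\<close> by (metis add_0 diff_zero length_greater_0_conv subsequence_nth)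
    qed
    from this[of "\<lambda>_. a" for a] have const: "a = u ! 0" for a :: 'a .
    have "a = b" for a b :: 'a
      using const[of a] const[of b] by simp
    then show False
      using two_letters[OF n] by blast
  qed
  then have "common_prefixes ?I [] () = {[]}"
    by (auto simp: Nil_common_prefix)
  ultimately show ?thesis
    using is_transducer_id by (simp add: reduced_def weakly_minimal_def)
qed

lemma clopen_embedding_id:
  assumes n: "2 \<le> CARD('a::finite)"
  shows "clopen_embedding (id_transducer :: ('a, unit) transducer)"
proof -
  have "finitary (UNIV :: (nat \<Rightarrow> 'a) set)"
    by (simp add: finitary_def determined_def)
  then show ?thesis
    using reduced_sync[OF reduced_id_transducer[OF n]] reduced_nonconstant[OF reduced_id_transducer[OF n]]
    by (simp add: clopen_embedding_def image_of_state_def inj_def)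
qed

lemma tr_equiv_id_left:
  assumes "is_transducer C" "strongly_synchronizing C"
  shows "tr_equiv (tr_product id_transducer C) C"
proof -
  obtain k where k: "sync_level C k"
    using assms(2) by (auto simp: strongly_synchronizing_def)
  have "prefix_equiv 0 (state_map (tr_product id_transducer C) (step_word (tr_product id_transducer C) w r))
      (state_map C (step_word C w q))"
    if w: "k \<le> length w" and r: "r \<in> states (tr_product id_transducer C)" and q: "q \<in> states C" for w r q
  proof -
    obtain p where p: "r = ((), p)" "p \<in> states C"
      using r by auto
    have "state_map (tr_product id_transducer C) ((), step_word C w p) = state_map C (step_word C w p)"
      using state_map_tr_product[OF is_transducer_id assms(1) _ step_word_in_states[OF assms(1) p(2)]]
      by (simp add: fun_eq_iff)
    moreover have "step_word C w p = step_word C w q"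
      by (rule sync_levelD[OF k assms(1) w p(2) q])
    ultimately show ?thesis
      using p(1) prefix_equiv_refl by simp
  qed
  then show ?thesis
    unfolding tr_equiv_def by blast
qed

lemma tr_equiv_id_right:
  assumes "is_transducer C" "strongly_synchronizing C"
  shows "tr_equiv (tr_product C id_transducer) C"
proof -
  obtain k where k: "sync_level C k"
    using assms(2) by (auto simp: strongly_synchronizing_def)
  have "prefix_equiv 0 (state_map (tr_product C id_transducer) (step_word (tr_product C id_transducer) w r))
      (state_map C (step_word C w q))"
    if w: "k \<le> length w" and r: "r \<in> states (tr_product C id_transducer)" and q: "q \<in> states C" for w r q
  proof -
    obtain p where p: "r = (p, ())" "p \<in> states C"
      using r by auto
    have "state_map (tr_product C id_transducer) (step_word C w p, ()) = state_map C (step_word C w p)"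
      using state_map_tr_product[OF assms(1) is_transducer_id step_word_in_states[OF assms(1) p(2)]]
      by (simp add: fun_eq_iff)
    moreover have "step_word C w p = step_word C w q"
      by (rule sync_levelD[OF k assms(1) w p(2) q])
    ultimately show ?thesis
      using p(1) prefix_equiv_refl by simp
  qed
  then show ?thesis
    unfolding tr_equiv_def by blast
qed

lemma one_O_tilde:
  assumes n: "2 \<le> CARD('a::{finite,linorder})"
  shows "\<one>\<^bsub>O_tilde\<^esub> = reduced_class (id_transducer :: ('a, unit) transducer)"
  using tclass_reduced[OF reduced_id_transducer[OF n]] by (simp add: O_tilde_def M_monoid_def)

lemma monoid_O_tilde:
  assumes n: "2 \<le> CARD('a::{finite,linorder})"
  shows "monoid (O_tilde :: 'a tclass monoid)"
proof (rule monoidI)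
  let ?I = "id_transducer :: ('a, unit) transducer"
  note I = clopen_embedding_id[OF n]
  show "\<one>\<^bsub>O_tilde\<^esub> \<in> carrier (O_tilde :: 'a tclass monoid)"
    unfolding one_O_tilde[OF n] by (rule reduced_class_in_O_tilde[OF n I])
  fix A assume "A \<in> carrier (O_tilde :: 'a tclass monoid)"
  then obtain T :: "('a, nat) transducer" where T: "clopen_embedding T" "A = reduced_class T"
    by (rule carrier_O_tildeE[OF n]) (rule that)
  note Td = clopen_embeddingD[OF T(1)]
  show "\<one>\<^bsub>O_tilde\<^esub> \<otimes>\<^bsub>O_tilde\<^esub> A = A" "A \<otimes>\<^bsub>O_tilde\<^esub> \<one>\<^bsub>O_tilde\<^esub> = A"
    unfolding one_O_tilde[OF n] T(2) mult_O_tilde[OF I T(1)] mult_O_tilde[OF T(1) I]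
    by (intro reduced_class_cong tr_equiv_id_left tr_equiv_id_right is_transducer_tr_product is_transducer_id Td)+
  fix B assume "B \<in> carrier (O_tilde :: 'a tclass monoid)"
  then obtain U :: "('a, nat) transducer" where U: "clopen_embedding U" "B = reduced_class U"
    by (rule carrier_O_tildeE[OF n]) (rule that)
  note Ud = clopen_embeddingD[OF U(1)]
  show "A \<otimes>\<^bsub>O_tilde\<^esub> B \<in> carrier O_tilde"
    unfolding T(2) U(2) mult_O_tilde[OF T(1) U(1)]
    by (intro reduced_class_in_O_tilde[OF n] clopen_embedding_tr_product T(1) U(1))
  fix C assume "C \<in> carrier (O_tilde :: 'a tclass monoid)"
  then obtain V :: "('a, nat) transducer" where V: "clopen_embedding V" "C = reduced_class V"
    by (rule carrier_O_tildeE[OF n]) (rule that)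
  note Vd = clopen_embeddingD[OF V(1)]
  show "A \<otimes>\<^bsub>O_tilde\<^esub> B \<otimes>\<^bsub>O_tilde\<^esub> C = A \<otimes>\<^bsub>O_tilde\<^esub> (B \<otimes>\<^bsub>O_tilde\<^esub> C)"
    unfolding T(2) U(2) V(2) mult_O_tilde[OF T(1) U(1)] mult_O_tilde[OF U(1) V(1)]
      mult_O_tilde[OF T(1) clopen_embedding_tr_product[OF U(1) V(1)]]
      mult_O_tilde[OF clopen_embedding_tr_product[OF T(1) U(1)] V(1)]
    by (intro reduced_class_cong tr_equiv_tr_product_assoc is_transducer_tr_product Td(1,2) Ud(1,2) Vd(1,2))
qed

lemma group_O_group: "2 \<le> CARD('a::{finite,linorder}) \<Longrightarrow> group (O_group :: 'a tclass monoid)"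
  unfolding O_group_def by (intro monoid.units_group monoid_O_tilde)

lemma O_group_simps [simp]:
  "carrier O_group = Units O_tilde" "\<one>\<^bsub>O_group\<^esub> = \<one>\<^bsub>O_tilde\<^esub>" "A \<otimes>\<^bsub>O_group\<^esub> B = A \<otimes>\<^bsub>O_tilde\<^esub> B"
  by (simp_all add: O_group_def units_of_def)

lemma Units_O_tildeD: "A \<in> Units O_tilde \<Longrightarrow> A \<in> carrier O_tilde"
  by (simp add: Units_def)

subsection \<open>The signature\<close>

text \<open>At a synchronizing level \<open>k\<close>, the cones of depth \<open>k\<close> are
  mapped from \<open>p\<close> and from \<open>q\<close> to images of the same states with words in
  front, so both residues are the same sum.\<close>

lemma cone_residue_image_const:
  fixes T :: "('a::finite, 'q) transducer"
  assumes T: "clopen_embedding T" and pq: "p \<in> states T" "q \<in> states T"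
  shows "cone_residue (image_of_state T p) = cone_residue (image_of_state T q)"
proof -
  note Td = clopen_embeddingD[OF T]
  obtain k where k: "sync_level T k"
    using Td(2) by (auto simp: strongly_synchronizing_def)
  have det: "determined k (UNIV :: (nat \<Rightarrow> 'a) set)"
    by (simp add: determined_def)
  have st: "step_word T w p = step_word T w q" if "w \<in> prefix k ` UNIV" for w
    using that sync_levelD[OF k Td(1) _ pq] by auto
  have "cone_residue (image_of_state T p)
      = (\<Sum>w\<in>prefix k ` UNIV. cone_residue (image_of_state T (step_word T w p))) mod (CARD('a) - 1)"
    unfolding image_of_state_def[of T p]
    by (rule cone_residue_state_map_image[OF Td(1) pq(1) Td(6) Td(5)[OF pq(1)] det])
  also have "\<dots> = (\<Sum>w\<in>prefix k ` UNIV. cone_residue (image_of_state T (step_word T w q))) mod (CARD('a) - 1)"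
    using st by simp
  also have "\<dots> = cone_residue (image_of_state T q)"
    unfolding image_of_state_def[of T q]
    by (rule cone_residue_state_map_image[OF Td(1) pq(2) Td(6) Td(5)[OF pq(2)] det, symmetric])
  finally show ?thesis .
qed

text \<open>After a long word the two images are one clopen set with different words in front, and
  prepending a word preserves the residue.\<close>

lemma cone_residue_image_equiv:
  fixes T :: "('a::finite, 'p) transducer" and S :: "('a, 'q) transducer"
  assumes T: "clopen_embedding T" and S: "clopen_embedding S" and eq: "tr_equiv T S"
    and p: "p \<in> states T" and q: "q \<in> states S"
  shows "cone_residue (image_of_state T p) = cone_residue (image_of_state S q)"
proof -
  note Td = clopen_embeddingD[OF T] and Sd = clopen_embeddingD[OF S]
  obtain K B where KB: "\<And>w p q. K \<le> length w \<Longrightarrow> p \<in> states T \<Longrightarrow> q \<in> states S \<Longrightarrow>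
    prefix_equiv B (state_map T (step_word T w p)) (state_map S (step_word S w q))"
    using tr_equivE[OF eq] by blast
  obtain w :: "'a list" where w: "length w = K"
    using Ex_list_of_length by blast
  define p' q' where "p' = step_word T w p" and "q' = step_word S w q"
  have st: "p' \<in> states T" "q' \<in> states S"
    unfolding p'_def q'_def by (rule step_word_in_states[OF Td(1) p] step_word_in_states[OF Sd(1) q])+
  have "prefix_equiv B (state_map T p') (state_map S q')"
    unfolding p'_def q'_def by (rule KB) (use w p q in simp_all)
  then obtain a b h where ab: "length a \<le> B" "length b \<le> B"
    "\<And>x. state_map T p' x = a \<frown> h x" "\<And>x. state_map S q' x = b \<frown> h x"
    by (rule prefix_equivE) (rule that)
  have im: "image_of_state T p' = conc a ` range h" "image_of_state S q' = conc b ` range h"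
    by (simp_all add: image_of_state_def ab(3,4) image_image)
  have "finitary (range h)"
    using Td(6)[OF st(1)] by (simp add: im finitary_conc_iff)
  then have "cone_residue (image_of_state T p') = cone_residue (image_of_state S q')"
    by (simp add: im cone_residue_conc)
  then show ?thesis
    using cone_residue_image_const[OF T p st(1)] cone_residue_image_const[OF S q st(2)] by simp
qed

lemma sig_eq:
  fixes C :: "('a::{finite,linorder}, 'q) transducer"
  assumes C: "clopen_embedding C" and q: "q \<in> states C"
  shows "sig (reduced_class C) = cone_residue (image_of_state C q)"
  unfolding sig_def
proof (rule the_equality)
  have *: "min_cones T p mod (CARD('a) - 1) = cone_residue (image_of_state C q)"
    if "T \<in> reduced_class C" "p \<in> states T" for T p
  proof -
    have T: "clopen_embedding T" "tr_equiv T C"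
      using clopen_embedding_reduced_class[OF C] that by (auto simp: reduced_class_def)
    have "min_cones T p mod (CARD('a) - 1) = cone_residue (image_of_state T p)"
      unfolding min_cones_def by (rule least_cones_residue[OF clopen_embeddingD(6)[OF T(1) that(2)]])
    also have "\<dots> = cone_residue (image_of_state C q)"
      by (rule cone_residue_image_equiv[OF T(1) C T(2) that(2) q])
    finally show ?thesis .
  qed
  then show "\<forall>T\<in>reduced_class C. \<forall>p\<in>states T. min_cones T p mod (CARD('a) - 1) = cone_residue (image_of_state C q)"
    by blast
  fix s assume s: "\<forall>T\<in>reduced_class C. \<forall>p\<in>states T. min_cones T p mod (CARD('a) - 1) = s"
  obtain T where T: "T \<in> reduced_class C"
    by (rule reduced_class_nonempty[OF C])
  moreover obtain p where "p \<in> states T"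
    using clopen_embeddingD(1)[OF clopen_embedding_reduced_class[OF C T]] by (auto simp: is_transducer_def)
  ultimately show "s = cone_residue (image_of_state C q)"
    using s * by metis
qed

text \<open>Decompose the image of the first factor into \<open>m\<close> cones. The second factor
  maps each of them to a set of residue \<open>sig B\<close>, so the image under the product has
  residue \<open>m * sig B\<close>.\<close>

lemma sig_mult:
  fixes A B :: "'a::{finite,linorder} tclass"
  assumes n: "2 \<le> CARD('a)" and A: "A \<in> carrier O_tilde" and B: "B \<in> carrier O_tilde"
  shows "sig (A \<otimes>\<^bsub>O_tilde\<^esub> B) = sig A * sig B mod (CARD('a) - 1)"
proof -
  obtain T :: "('a, nat) transducer" where T: "clopen_embedding T" "A = reduced_class T"
    by (rule carrier_O_tildeE[OF n A]) (rule that)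
  obtain U :: "('a, nat) transducer" where U: "clopen_embedding U" "B = reduced_class U"
    by (rule carrier_O_tildeE[OF n B]) (rule that)
  note Td = clopen_embeddingD[OF T(1)] and Ud = clopen_embeddingD[OF U(1)]
  obtain p q where pq: "p \<in> states T" "q \<in> states U"
    using Td(1) Ud(1) by (auto simp: is_transducer_def)
  obtain k where k: "determined k (image_of_state T p)"
    using Td(6)[OF pq(1)] by (auto simp: finitary_def)
  let ?W = "prefix k ` image_of_state T p" and ?s = "cone_residue (image_of_state U q)"
  have "sig (A \<otimes>\<^bsub>O_tilde\<^esub> B) = cone_residue (state_map U q ` image_of_state T p)"
    using sig_eq[OF clopen_embedding_tr_product[OF T(1) U(1)], of "(p, q)"] pq
      image_of_state_tr_product[OF Td(1) Ud(1) pq] mult_O_tilde[OF T(1) U(1)] T(2) U(2) by simp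
  also have "\<dots> = (\<Sum>w\<in>?W. cone_residue (image_of_state U (step_word U w q))) mod (CARD('a) - 1)"
    by (rule cone_residue_state_map_image[OF Ud(1) pq(2) Ud(6) Ud(5)[OF pq(2)] k])
  also have "\<dots> = (\<Sum>w\<in>?W. ?s) mod (CARD('a) - 1)"
    using cone_residue_image_const[OF U(1) step_word_in_states[OF Ud(1) pq(2)] pq(2)] by simp
  also have "\<dots> = cone_residue (image_of_state T p) * ?s mod (CARD('a) - 1)"
    by (simp add: cone_residue_eq[OF k] mod_mult_left_eq)
  finally show ?thesis
    using sig_eq[OF T(1) pq(1)] sig_eq[OF U(1) pq(2)] T(2) U(2) by simp
qed

lemma sig_one:
  assumes n: "2 \<le> CARD('a::{finite,linorder})"
  shows "sig \<one>\<^bsub>(O_tilde :: 'a tclass monoid)\<^esub> = 1 mod (CARD('a) - 1)"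
  using sig_eq[OF clopen_embedding_id[OF n], of "()"]
  by (simp add: one_O_tilde[OF n] image_of_state_def cone_residue_UNIV)

lemma subgroup_Or_group:
  assumes n: "2 \<le> CARD('a::{finite,linorder})"
  shows "subgroup (carrier (Or_group r :: 'a tclass monoid)) O_group"
proof -
  let ?G = "O_group :: 'a tclass monoid" and ?m = "CARD('a) - 1"
  interpret group ?G
    by (rule group_O_group[OF n])
  have sig: "sig (A \<otimes>\<^bsub>?G\<^esub> B) = sig A * sig B mod ?m" if AB: "A \<in> carrier ?G" "B \<in> carrier ?G" for A B
    using sig_mult[OF n, of A B] Units_O_tildeD[of A] Units_O_tildeD[of B] AB by simp
  have one: "sig \<one>\<^bsub>?G\<^esub> = 1 mod ?m"
    using sig_one[OF n] by simp
  have car: "A \<in> carrier (Or_group r) \<longleftrightarrow> A \<in> carrier ?G \<and> (r * sig A) mod ?m = r mod ?m" for A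
    by (simp add: Or_group_def)
  \<comment> \<open>Left multiplication by an element of the subset does not change
    \<open>r * sig B\<close> modulo \<open>?m\<close>. Taking \<open>B\<close> to be the inverse
    gives closure under inverses without dividing by a signature.\<close>
  have act: "(r * sig (A \<otimes>\<^bsub>?G\<^esub> B)) mod ?m = (r * sig B) mod ?m"
    if "A \<in> carrier (Or_group r)" "B \<in> carrier ?G" for A B
  proof -
    have "(r * sig (A \<otimes>\<^bsub>?G\<^esub> B)) mod ?m = (r * (sig A * sig B)) mod ?m"
      using sig that by (simp add: car mod_mult_right_eq)
    also have "\<dots> = ((r * sig A) mod ?m * sig B) mod ?m"
      by (simp add: mod_mult_left_eq mult.assoc)
    also have "\<dots> = (r * sig B) mod ?m"
      using that by (simp add: car mod_mult_left_eq)
    finally show ?thesis .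
  qed
  show ?thesis
  proof
    show "carrier (Or_group r) \<subseteq> carrier ?G"
      using car by blast
    show "\<one>\<^bsub>?G\<^esub> \<in> carrier (Or_group r)"
      using one_closed one by (simp add: car mod_mult_right_eq del: O_group_simps)
    show "A \<otimes>\<^bsub>?G\<^esub> B \<in> carrier (Or_group r)"
      if "A \<in> carrier (Or_group r)" "B \<in> carrier (Or_group r)" for A B
      using that act[of A B] m_closed by (simp add: car del: O_group_simps)
    show "inv\<^bsub>?G\<^esub> A \<in> carrier (Or_group r)" if A: "A \<in> carrier (Or_group r)" for A
    proof -
      have AG: "A \<in> carrier ?G"
        using A car by blast
      have "(r * sig (inv\<^bsub>?G\<^esub> A)) mod ?m = (r * sig \<one>\<^bsub>?G\<^esub>) mod ?m"
        using act[OF A inv_closed[OF AG]] r_inv[OF AG] by simp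
      also have "\<dots> = r mod ?m"
        unfolding one by (simp add: mod_mult_right_eq)
      finally show ?thesis
        using inv_closed[OF AG] by (simp add: car del: O_group_simps)
    qed
  qed
qed

text \<open>The congruence is vacuous, both sides being multiples of the modulus.\<close>

lemma Or_group_full:
  "(Or_group (CARD('a::{finite,linorder}) - 1) :: 'a tclass monoid) = O_group"
  by (simp add: Or_group_def)

lemma group_Or_group:
  assumes n: "2 \<le> CARD('a::{finite,linorder})"
  shows "group (Or_group r :: 'a tclass monoid)"
proof -
  have "Or_group r = (O_group :: 'a tclass monoid)\<lparr>carrier := carrier (Or_group r)\<rparr>"
    by (simp add: Or_group_def)
  then show ?thesis
    using subgroup.subgroup_is_group[OF subgroup_Or_group[OF n] group_O_group[OF n]] by metis
qed

subsection \<open>Length-preserving loops\<close>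

text \<open>Stated through \<open>loop_out\<close>, the form in which the property passes to
  equivalent transducers and to products.\<close>

definition length_preserving :: "('a, 'q) transducer \<Rightarrow> bool" where
  "length_preserving T \<longleftrightarrow> (\<forall>w. w \<noteq> [] \<longrightarrow> length (loop_out T w) = length w)"

lemma length_preservingD:
  assumes "length_preserving T" "sync_transducer T" "q \<in> states T" "step_word T w q = q"
  shows "length (out_word T w q) = length w"
proof (cases "w = []")
  case False
  then show ?thesis
    using assms loop_state_eqI[OF assms(2) False assms(3,4)] by (auto simp: length_preserving_def loop_out_def)
qed simp

lemma length_loop_out_equiv:
  assumes "sync_transducer T" "nonconstant T" "sync_transducer S" "tr_equiv T S" "w \<noteq> []"
  shows "length (loop_out T w) = length (loop_out S w)"
proof -
  obtain a b e where "loop_out T w @ a = a @ e" "loop_out S w @ b = b @ e"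
    by (rule tr_equiv_loop_out[OF assms])
  then show ?thesis
    by (metis add.commute add_right_cancel length_append)
qed

lemma reduced_class_in_L_tilde:
  fixes C :: "('a::{finite,linorder}, 'q) transducer"
  assumes n: "2 \<le> CARD('a)" and C: "clopen_embedding C"
  shows "reduced_class C \<in> carrier L_tilde \<longleftrightarrow> length_preserving C"
proof -
  note Cd = clopen_embeddingD[OF C]
  have M: "reduced_class C \<in> carrier M_monoid"
    using reduced_class_in_O_tilde[OF n C] by (simp add: O_tilde_def)
  have *: "(\<forall>q\<in>states T. \<forall>w. step_word T w q = q \<longrightarrow> length (out_word T w q) = length w)
      \<longleftrightarrow> length_preserving C" if T: "T \<in> reduced_class C" for T
  proof -
    note Td = clopen_embeddingD[OF clopen_embedding_reduced_class[OF C T]]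
    have "length_preserving T \<longleftrightarrow> length_preserving C"
      using T length_loop_out_equiv[OF Td(3,4) Cd(3)] by (auto simp: reduced_class_def length_preserving_def)
    moreover have "length_preserving T"
      if "\<forall>q\<in>states T. \<forall>w. step_word T w q = q \<longrightarrow> length (out_word T w q) = length w"
      using that loop_state[OF Td(3)] by (simp add: length_preserving_def loop_out_def)
    ultimately show ?thesis
      using length_preservingD[OF _ Td(3)] by blast
  qed
  obtain T where "T \<in> reduced_class C"
    by (rule reduced_class_nonempty[OF C])
  then show ?thesis
    using * M by (auto simp: L_tilde_def)
qed

lemma length_preserving_tr_product:
  assumes "sync_transducer T" "sync_transducer U" "length_preserving T" "length_preserving U"
  shows "length_preserving (tr_product T U)"
  using assms loop_out_nonempty[OF assms(1)] by (simp add: length_preserving_def loop_out_tr_product)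

text \<open>Loops of \<open>U\<close> followed by \<open>T\<close> preserve length since this
  product is equivalent to the identity, and \<open>T\<close> does not alter the length of what
  \<open>U\<close> writes on a loop.\<close>

lemma length_preserving_inverse:
  fixes T U :: "('a::finite, 'q) transducer"
  assumes n: "2 \<le> CARD('a)" and T: "clopen_embedding T" "length_preserving T" and U: "clopen_embedding U"
    and eq: "tr_equiv (tr_product U T) id_transducer"
  shows "length_preserving U"
  unfolding length_preserving_def
proof (intro allI impI)
  fix w :: "'a list" assume w: "w \<noteq> []"
  note Td = clopen_embeddingD[OF T(1)] and Ud = clopen_embeddingD[OF U]
    and Id = clopen_embeddingD[OF clopen_embedding_id[OF n]]
    and P = clopen_embeddingD[OF clopen_embedding_tr_product[OF U T(1)]]
  have "length (loop_out (tr_product U T) w) = length w"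
    using length_loop_out_equiv[OF P(3,4) Id(3) eq w] by (simp add: loop_out_def)
  then show "length (loop_out U w) = length w"
    using T(2) loop_out_nonempty[OF Ud(3) w] loop_out_tr_product[OF Ud(3) Td(3) w]
    by (simp add: length_preserving_def)
qed

lemma subgroup_L_group:
  assumes n: "2 \<le> CARD('a::{finite,linorder})"
  shows "subgroup (carrier (L_group :: 'a tclass monoid)) O_group"
proof -
  let ?G = "O_group :: 'a tclass monoid"
  interpret group ?G
    by (rule group_O_group[OF n])
  have car: "A \<in> carrier L_group \<longleftrightarrow> A \<in> carrier ?G \<and> A \<in> carrier L_tilde" for A
    by (simp add: L_group_def)
  have carE: "\<exists>T :: ('a, nat) transducer. clopen_embedding T \<and> A = reduced_class T"
    if A: "A \<in> carrier ?G" for A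
  proof -
    have "A \<in> carrier O_tilde"
      using A Units_O_tildeD by simp
    then obtain T :: "('a, nat) transducer" where "clopen_embedding T" "A = reduced_class T"
      by (rule carrier_O_tildeE[OF n]) (rule that)
    then show ?thesis by blast
  qed
  note L = reduced_class_in_L_tilde[OF n]
  show ?thesis
  proof
    show "carrier L_group \<subseteq> carrier ?G"
      using car by blast
    have "length_preserving (id_transducer :: ('a, unit) transducer)"
      by (simp add: length_preserving_def loop_out_def)
    then have "\<one>\<^bsub>?G\<^esub> \<in> carrier L_tilde"
      using L[OF clopen_embedding_id[OF n]] by (simp add: one_O_tilde[OF n])
    then show "\<one>\<^bsub>?G\<^esub> \<in> carrier L_group"
      using one_closed by (simp add: car del: O_group_simps)
    show "A \<otimes>\<^bsub>?G\<^esub> B \<in> carrier L_group" if A: "A \<in> carrier L_group" and B: "B \<in> carrier L_group" for A B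
    proof -
      obtain T :: "('a, nat) transducer" where T: "clopen_embedding T" "A = reduced_class T"
        using carE A car by blast
      obtain U :: "('a, nat) transducer" where U: "clopen_embedding U" "B = reduced_class U"
        using carE B car by blast
      have "length_preserving T" "length_preserving U"
        using A B car L T U by blast+
      then have "reduced_class (tr_product T U) \<in> carrier L_tilde"
        using L[OF clopen_embedding_tr_product[OF T(1) U(1)]] length_preserving_tr_product
          clopen_embeddingD(3)[OF T(1)] clopen_embeddingD(3)[OF U(1)] by blast
      then have "A \<otimes>\<^bsub>?G\<^esub> B \<in> carrier L_tilde"
        using mult_O_tilde[OF T(1) U(1)] T(2) U(2) by simp
      then show ?thesis
        using A B car m_closed by blast
    qed
    show "inv\<^bsub>?G\<^esub> A \<in> carrier L_group" if A: "A \<in> carrier L_group" for A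
    proof -
      have AG: "A \<in> carrier ?G"
        using A car by blast
      obtain T :: "('a, nat) transducer" where T: "clopen_embedding T" "A = reduced_class T"
        using carE AG by blast
      obtain U :: "('a, nat) transducer" where U: "clopen_embedding U" "inv\<^bsub>?G\<^esub> A = reduced_class U"
        using carE inv_closed[OF AG] by blast
      have "length_preserving T"
        using A car L T by blast
      have "reduced_class (tr_product U T) = reduced_class (id_transducer :: ('a, unit) transducer)"
        using l_inv[OF AG] mult_O_tilde[OF U(1) T(1)] U(2) T(2) one_O_tilde[OF n] by simp
      then have "tr_equiv (tr_product U T) (id_transducer :: ('a, unit) transducer)"
        using reduced_class_eq_iff[OF clopen_embedding_tr_product[OF U(1) T(1)] clopen_embedding_id[OF n]]
        by blast
      then have "length_preserving U"
        by (rule length_preserving_inverse[OF n T(1) \<open>length_preserving T\<close> U(1)])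
      then show ?thesis
        using L[OF U(1)] U(2) inv_closed[OF AG] car by simp
    qed
  qed
qed

section \<open>Periodic points\<close>

definition shift_by :: "int \<Rightarrow> (int \<Rightarrow> 'a) \<Rightarrow> (int \<Rightarrow> 'a)" where
  "shift_by k x = (\<lambda>i. x (i - k))"

lemma shift_by_0 [simp]: "shift_by 0 x = x"
  and shift_by_shift_by [simp]: "shift_by j (shift_by k x) = shift_by (j + k) x"
  and shift_map_eq: "shift_map = shift_by 1"
  by (simp_all add: shift_by_def shift_map_def fun_eq_iff algebra_simps)

lemma shift_by_commute: "shift_by j (shift_by k x) = shift_by k (shift_by j x)"
  by (simp add: add.commute)

lemma shift_map_funpow: "(shift_map ^^ k) x = shift_by (int k) x"
  by (induction k) (simp_all add: shift_map_eq)

definition periodic_word :: "'a list \<Rightarrow> (int \<Rightarrow> 'a)" where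
  "periodic_word w = (\<lambda>i. w ! nat (i mod int (length w)))"

lemma shift_by_period_multiple:
  assumes "shift_by p x = x"
  shows "shift_by (k * p) x = x"
proof -
  have *: "shift_by (int m * p) x = x" for m
  proof (induction m)
    case (Suc m)
    have "shift_by (int (Suc m) * p) x = shift_by (int m * p) (shift_by p x)"
      by (simp add: algebra_simps)
    then show ?case
      using Suc assms by simp
  qed simp
  show ?thesis
  proof (cases "k \<ge> 0")
    case True
    then show ?thesis
      using *[of "nat k"] by simp
  next
    case False
    have "shift_by (k * p) x = shift_by (k * p) (shift_by (int (nat (- k)) * p) x)"
      by (simp only: *)
    also have "\<dots> = x"
      using False by simp
    finally show ?thesis .
  qed
qed

lemma periodic_word_eqI:
  assumes "shift_by (int (length w)) x = x" "\<And>j. j < length w \<Longrightarrow> x (int j) = w ! j" "w \<noteq> []"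
  shows "periodic_word w = x"
proof
  fix i
  let ?L = "int (length w)"
  have r: "0 \<le> i mod ?L" "i mod ?L < ?L"
    using assms(3) by simp_all
  then have n: "nat (i mod ?L) < length w" "int (nat (i mod ?L)) = i mod ?L"
    by linarith+
  have "x i = shift_by ((i div ?L) * ?L) x i"
    using shift_by_period_multiple[OF assms(1)] by metis
  also have "\<dots> = x (i mod ?L)"
    by (simp add: shift_by_def minus_div_mult_eq_mod)
  also have "\<dots> = periodic_word w i"
    using assms(2)[OF n(1)] n(2) by (simp add: periodic_word_def)
  finally show "periodic_word w i = x i" by simp
qed

lemma shift_by_periodic_word: "shift_by (k * int (length w)) (periodic_word w) = periodic_word w"
proof -
  have "shift_by (int (length w)) (periodic_word w) = periodic_word w"
    by (simp add: shift_by_def periodic_word_def)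
  then show ?thesis
    by (rule shift_by_period_multiple)
qed

lemma periodic_word_nth: "j < length w \<Longrightarrow> periodic_word w (int j) = w ! j"
  by (simp add: periodic_word_def)

text \<open>The equation places \<open>e\<close> at position \<open>length a\<close> of the
  repetition of \<open>u\<close>.\<close>

lemma periodic_word_conjugate:
  assumes "u @ a = a @ e" "u \<noteq> []"
  shows "periodic_word e = shift_by (- int (length a)) (periodic_word u)"
proof (rule periodic_word_eqI)
  have len: "length e = length u"
    using arg_cong[OF assms(1), of length] by simp
  \<comment> \<open>Since \<open>u @ a\<close> also starts with \<open>a\<close>, it has period
    \<open>length u\<close>.\<close>
  have nth: "(u @ a) ! j = periodic_word u (int j)" if "j < length (u @ a)" for j
    using that
  proof (induction j rule: less_induct)
    case (less j)
    show ?case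
    proof (cases "j < length u")
      case True
      then show ?thesis
        by (simp add: nth_append periodic_word_nth)
    next
      case False
      have "(u @ a) ! j = (u @ a) ! (j - length u)"
        using False less.prems assms(1) by (metis add_diff_inverse_nat length_append nat_add_left_cancel_less nth_append)
      also have "\<dots> = periodic_word u (int (j - length u))"
        using less.prems False assms(2) by (intro less.IH) (cases u; auto)+
      also have "\<dots> = shift_by (int (length u)) (periodic_word u) (int j)"
        using False by (simp add: shift_by_def of_nat_diff)
      also have "\<dots> = periodic_word u (int j)"
        using shift_by_periodic_word[of 1 u] by simp
      finally show ?thesis .
    qed
  qed
  show "shift_by (int (length e)) (shift_by (- int (length a)) (periodic_word u))
      = shift_by (- int (length a)) (periodic_word u)"
    using shift_by_periodic_word[of 1 u]
    by (simp only: len shift_by_commute[of "int (length u)"] mult_1)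
  show "shift_by (- int (length a)) (periodic_word u) (int j) = e ! j" if "j < length e" for j
  proof -
    have "e ! j = (u @ a) ! (length a + j)"
      unfolding assms(1) by simp
    also have "\<dots> = periodic_word u (int (length a + j))"
      using that len by (intro nth) simp
    finally show ?thesis
      by (simp add: shift_by_def add.commute)
  qed
  show "e \<noteq> []"
    using len assms(2) by auto
qed

lemma nth_word_power: "j < s * length w \<Longrightarrow> word_power w s ! j = w ! (j mod length w)"
proof (induction s arbitrary: j)
  case (Suc s)
  show ?case
  proof (cases "j < length w")
    case False
    then show ?thesis
      using Suc.IH[of "j - length w"] Suc.prems by (simp add: nth_append le_mod_geq)
  qed (simp add: nth_append)
qed simp

lemma periodic_word_power:
  assumes "w \<noteq> []" "s > 0"
  shows "periodic_word (word_power w s) = periodic_word w"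
proof (rule periodic_word_eqI)
  show "shift_by (int (length (word_power w s))) (periodic_word w) = periodic_word w"
    using shift_by_periodic_word[of "int s" w] by simp
  show "periodic_word w (int j) = word_power w s ! j" if "j < length (word_power w s)" for j
    using that nth_word_power[of j s w] by (simp add: periodic_word_def zmod_int[symmetric])
  show "word_power w s \<noteq> []"
    using assms by (cases s) simp_all
qed

lemma periodic_word_rotate:
  assumes "w \<noteq> []"
  shows "periodic_word (rotate k w) = shift_by (- int k) (periodic_word w)"
proof (rule periodic_word_eqI)
  show "shift_by (int (length (rotate k w))) (shift_by (- int k) (periodic_word w))
      = shift_by (- int k) (periodic_word w)"
    using shift_by_periodic_word[of 1 w]
    by (simp only: length_rotate shift_by_commute[of "int (length w)"] mult_1)
  show "shift_by (- int k) (periodic_word w) (int j) = rotate k w ! j" if "j < length (rotate k w)" for j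
    using that nth_rotate[of j w k]
    by (simp add: shift_by_def periodic_word_def zmod_int[symmetric] add.commute flip: of_nat_add)
qed (use assms in simp)

section \<open>Least periods and prime words\<close>

lemma least_period_shift_by: "least_period (shift_by k x) = least_period x"
proof -
  have "shift_by (int m) (shift_by k x) = shift_by k x \<longleftrightarrow> shift_by (int m) x = x" for m
  proof
    assume "shift_by (int m) (shift_by k x) = shift_by k x"
    then have "shift_by (- k) (shift_by (int m) (shift_by k x)) = shift_by (- k) (shift_by k x)"
      by simp
    then show "shift_by (int m) x = x" by simp
  next
    assume "shift_by (int m) x = x"
    then have "shift_by k (shift_by (int m) x) = shift_by k x"
      by simp
    then show "shift_by (int m) (shift_by k x) = shift_by k x"
      by (simp add: add.commute)
  qed
  then show ?thesis
    by (simp add: least_period_def shift_map_funpow)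
qed

lemma least_period:
  assumes "0 < p" "shift_by (int p) x = x"
  shows "0 < least_period x" "shift_by (int (least_period x)) x = x" "least_period x dvd p"
proof -
  let ?P = "\<lambda>k. 0 < k \<and> shift_by (int k) x = x"
  let ?l = "least_period x"
  have l: "?P ?l"
    unfolding least_period_def shift_map_funpow by (rule LeastI[of ?P p]) (use assms in simp)
  then show "0 < ?l" "shift_by (int ?l) x = x" by simp_all
  have "shift_by (int (p mod ?l)) x = shift_by (int (p mod ?l)) (shift_by (int (p div ?l) * int ?l) x)"
    using shift_by_period_multiple[of "int ?l" x "int (p div ?l)"] l by simp
  also have "\<dots> = shift_by (int (p mod ?l + p div ?l * ?l)) x"
    by (simp only: shift_by_shift_by of_nat_add of_nat_mult)
  also have "\<dots> = x"
    using assms(2) by (simp only: mod_div_mult_eq)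
  finally have *: "shift_by (int (p mod ?l)) x = x" .
  have "p mod ?l = 0"
  proof (rule ccontr)
    assume "p mod ?l \<noteq> 0"
    then have "?l \<le> p mod ?l"
      using * unfolding least_period_def[of x] shift_map_funpow by (intro Least_le) simp
    then show False
      using l mod_less_divisor[of ?l p] by linarith
  qed
  then show "?l dvd p" by auto
qed

lemma least_period_periodic_word:
  assumes "w \<noteq> []"
  shows "0 < least_period (periodic_word w)"
    "shift_by (int (least_period (periodic_word w))) (periodic_word w) = periodic_word w"
    "least_period (periodic_word w) dvd length w"
  using least_period[of "length w" "periodic_word w"] shift_by_periodic_word[of 1 w] assms by simp_all

text \<open>Translates primality into dynamics: the least period divides the length, and
  \<open>w\<close> is a power of its prefix of that length.\<close>

lemma prime_word_iff_least_period:
  assumes w: "w \<noteq> []"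
  shows "prime_word w \<longleftrightarrow> least_period (periodic_word w) = length w"
proof
  let ?P = "least_period (periodic_word w)"
  note P = least_period_periodic_word[OF w]
  assume pw: "prime_word w"
  have Pw: "?P \<le> length w"
    using P(3) w by (simp add: dvd_imp_le)
  have "w = word_power (take ?P w) (length w div ?P)"
  proof (rule nth_equalityI)
    show len: "length w = length (word_power (take ?P w) (length w div ?P))"
      using Pw P(3) by (simp add: min_absorb2 dvd_div_mult_self)
    fix j assume j: "j < length w"
    have "w ! j = shift_by (int (j div ?P) * int ?P) (periodic_word w) (int j)"
      using shift_by_period_multiple[OF P(2)] periodic_word_nth[OF j] by simp
    also have "int j - int (j div ?P) * int ?P = int (j mod ?P)"
      using div_mult_mod_eq[of j ?P] by (metis add_diff_cancel_left' of_nat_add of_nat_mult)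
    then have "shift_by (int (j div ?P) * int ?P) (periodic_word w) (int j) = periodic_word w (int (j mod ?P))"
      by (simp add: shift_by_def)
    also have "\<dots> = w ! (j mod ?P)"
      using P(1) Pw by (intro periodic_word_nth) (metis mod_less_divisor order_less_le_trans)
    also have "\<dots> = word_power (take ?P w) (length w div ?P) ! j"
      using nth_word_power[of j "length w div ?P" "take ?P w"] j len P(1) Pw
      by (simp add: min_absorb2)
    finally show "w ! j = word_power (take ?P w) (length w div ?P) ! j" .
  qed
  then have "\<not> length (take ?P w) < length w"
    using pw unfolding prime_word_def by blast
  then show "?P = length w"
    using Pw by simp
next
  assume l: "least_period (periodic_word w) = length w"
  show "prime_word w"
    unfolding prime_word_def
  proof (intro conjI w notI, elim exE conjE)
    fix u k assume u: "length u < length w" "w = word_power u k"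
    have "u \<noteq> []" "k > 0"
      using u w by (cases u; cases k; auto simp: word_power_def)+
    then have "periodic_word w = periodic_word u"
      unfolding u(2) by (rule periodic_word_power)
    then have "length w dvd length u"
      using least_period_periodic_word(3)[OF \<open>u \<noteq> []\<close>] l by simp
    then show False
      using u(1) \<open>u \<noteq> []\<close> by (simp add: nat_dvd_not_less)
  qed
qed

lemma prime_root:
  "w \<noteq> [] \<Longrightarrow> \<exists>v s. prime_word v \<and> 1 \<le> s \<and> w = word_power v s"
proof (induction "length w" arbitrary: w rule: less_induct)
  case less
  show ?case
  proof (cases "prime_word w")
    case True
    then show ?thesis
      by (intro exI[of _ w] exI[of _ 1]) simp
  next
    case False
    then obtain u k where u: "length u < length w" "w = word_power u k"
      using less.prems by (auto simp: prime_word_def)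
    then have "u \<noteq> []" "k > 0"
      using less.prems by (cases u; cases k; auto simp: word_power_def)+
    then obtain v s where "prime_word v" "1 \<le> s" "u = word_power v s"
      using less.hyps[OF u(1)] by blast
    then show ?thesis
      using u(2) \<open>k > 0\<close> word_power_mult[of v s k] by (intro exI[of _ v] exI[of _ "k * s"]) simp
  qed
qed

text \<open>Identifies a nonempty word with its powers and its rotations, so that loop outputs can
  be compared without extracting their prime roots.\<close>

definition same_orbit :: "'a list \<Rightarrow> 'a list \<Rightarrow> bool" where
  "same_orbit u v \<longleftrightarrow> (\<exists>k. periodic_word u = shift_by k (periodic_word v))"

lemma same_orbit_refl: "same_orbit u u"
  unfolding same_orbit_def by (rule exI[of _ 0]) simp

lemma same_orbit_sym: "same_orbit u v \<Longrightarrow> same_orbit v u"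
  unfolding same_orbit_def
proof (elim exE)
  fix k assume "periodic_word u = shift_by k (periodic_word v)"
  then have "periodic_word v = shift_by (- k) (periodic_word u)" by simp
  then show "\<exists>k. periodic_word v = shift_by k (periodic_word u)" ..
qed

lemma same_orbit_trans: "same_orbit u v \<Longrightarrow> same_orbit v w \<Longrightarrow> same_orbit u w"
  unfolding same_orbit_def by (metis shift_by_shift_by)

lemma same_orbit_conjugate: "u @ a = a @ e \<Longrightarrow> u \<noteq> [] \<Longrightarrow> same_orbit e u"
  unfolding same_orbit_def using periodic_word_conjugate by blast

lemma same_orbit_power: "w \<noteq> [] \<Longrightarrow> s > 0 \<Longrightarrow> same_orbit (word_power w s) w"
  unfolding same_orbit_def using periodic_word_power[of w s] by (intro exI[of _ 0]) simp

lemma same_orbit_rotate: "w \<noteq> [] \<Longrightarrow> same_orbit (rotate k w) w"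
  unfolding same_orbit_def using periodic_word_rotate by blast

lemma cyclic_word_rotate: "cyclic_word (rotate k w) = cyclic_word w"
proof -
  have "rotate j w \<in> range (\<lambda>m. rotate m (rotate k w))" for j
  proof (cases w)
    case (Cons a v)
    have "j + length v * k + k = j + length w * k"
      by (simp add: Cons)
    then have "rotate (j + length v * k) (rotate k w) = rotate (j + length w * k) w"
      by (simp only: rotate_rotate)
    also have "\<dots> = rotate j w"
      using rotate_conv_mod[of "j + length w * k" w] rotate_conv_mod[of j w] by simp
    finally show ?thesis
      by (metis rangeI)
  qed simp
  then show ?thesis
    unfolding cyclic_word_def by (auto simp: rotate_rotate)
qed

lemma rotate_if_same_orbit:
  assumes uv: "prime_word u" "prime_word v" "same_orbit u v"
  shows "\<exists>k. u = rotate k v"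
proof -
  obtain k where k: "periodic_word u = shift_by k (periodic_word v)"
    using uv(3) by (auto simp: same_orbit_def)
  have ne: "u \<noteq> []" "v \<noteq> []"
    using uv by (auto simp: prime_word_def)
  have "least_period (periodic_word u) = least_period (periodic_word v)"
    by (simp add: k least_period_shift_by)
  then have len: "length u = length v"
    using prime_word_iff_least_period uv(1,2) ne by metis
  let ?L = "int (length v)"
  \<comment> \<open>Rotating by \<open>m\<close> moves the periodic word by \<open>- m\<close>;
    \<open>m\<close> is the natural number representing \<open>- k\<close> modulo the
    period.\<close>
  define m where "m = nat ((- k) mod ?L)"
  have m: "int m = (- k) mod ?L"
    using ne by (simp add: m_def)
  have "periodic_word (rotate m v) = shift_by (- int m) (periodic_word v)"
    by (rule periodic_word_rotate[OF ne(2)])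
  also have "\<dots> = shift_by (- int m) (shift_by (- ((- k) div ?L) * ?L) (periodic_word v))"
    by (simp only: shift_by_periodic_word)
  also have "- int m + (- ((- k) div ?L) * ?L) = k"
    using mod_div_mult_eq[of "- k" ?L] unfolding m minus_mult_left[symmetric] by linarith
  then have "shift_by (- int m) (shift_by (- ((- k) div ?L) * ?L) (periodic_word v)) = periodic_word u"
    using k by simp
  finally have "rotate m v ! j = u ! j" if "j < length u" for j
    using that len periodic_word_nth[of j u] periodic_word_nth[of j "rotate m v"] by simp
  then have "u = rotate m v"
    using len by (intro nth_equalityI) simp_all
  then show ?thesis ..
qed

lemma cyclic_word_eq_if_same_orbit:
  "prime_word u \<Longrightarrow> prime_word v \<Longrightarrow> same_orbit u v \<Longrightarrow> cyclic_word u = cyclic_word v"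
  using rotate_if_same_orbit cyclic_word_rotate by blast

lemma cyclic_word_member:
  assumes "prime_word v" "u \<in> cyclic_word v"
  shows "prime_word u" "same_orbit u v"
proof -
  have v: "v \<noteq> []"
    using assms(1) by (simp add: prime_word_def)
  obtain k where u: "u = rotate k v"
    using assms(2) by (auto simp: cyclic_word_def)
  show "same_orbit u v"
    unfolding u by (rule same_orbit_rotate[OF v])
  have "least_period (periodic_word u) = least_period (periodic_word v)"
    by (simp add: u periodic_word_rotate[OF v] least_period_shift_by)
  then show "prime_word u"
    using assms(1) v prime_word_iff_least_period[of u] prime_word_iff_least_period[of v] by (simp add: u)
qed

lemma self_in_cyclic_word: "w \<in> cyclic_word w"
  unfolding cyclic_word_def by (rule range_eqI[of _ _ 0]) simp

section \<open>The action on prime cyclic words\<close>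

text \<open>Words in one orbit are powers of rotations of one prime word. Powers of the input give
  powers of the output, and rotating the input conjugates the output.\<close>

lemma same_orbit_loop_out:
  assumes T: "sync_transducer T" and uv: "same_orbit u v" "u \<noteq> []" "v \<noteq> []"
  shows "same_orbit (loop_out T u) (loop_out T v)"
proof -
  obtain u' s where u': "prime_word u'" "1 \<le> s" "u = word_power u' s"
    using prime_root[OF uv(2)] by blast
  obtain v' t where v': "prime_word v'" "1 \<le> t" "v = word_power v' t"
    using prime_root[OF uv(3)] by blast
  have ne: "u' \<noteq> []" "v' \<noteq> []"
    using u' v' by (auto simp: prime_word_def)
  have su: "same_orbit u u'" "same_orbit v v'"
    unfolding u'(3) v'(3) using ne u' v' by (simp_all add: same_orbit_power)
  then have "same_orbit u' v'"
    using uv(1) same_orbit_sym same_orbit_trans by metis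
  then obtain k where k: "u' = rotate k v'"
    using rotate_if_same_orbit u' v' by blast
  define a b where "a = take (k mod length v') v'" and "b = drop (k mod length v') v'"
  have ab: "v' = a @ b" "u' = b @ a"
    using k by (simp_all add: a_def b_def rotate_drop_take)
  obtain c where "loop_out T (a @ b) @ c = c @ loop_out T (b @ a)"
    using loop_out_append_commute[OF T] ne(2) ab(1) by blast
  then have "same_orbit (loop_out T u') (loop_out T v')"
    using loop_out_nonempty[OF T ne(2)] unfolding ab by (intro same_orbit_conjugate)
  moreover have "same_orbit (loop_out T u) (loop_out T u')" "same_orbit (loop_out T v) (loop_out T v')"
    unfolding u'(3) v'(3) using ne u' v' loop_out_nonempty[OF T]
    by (simp_all add: loop_out_word_power[OF T] same_orbit_power)
  ultimately show ?thesis
    using same_orbit_sym same_orbit_trans by metis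
qed

lemma same_orbit_loop_out_equiv:
  assumes "sync_transducer T" "nonconstant T" "sync_transducer S" "tr_equiv T S" "w \<noteq> []"
  shows "same_orbit (loop_out T w) (loop_out S w)"
proof -
  obtain a b e where ab: "loop_out T w @ a = a @ e" "loop_out S w @ b = b @ e"
    by (rule tr_equiv_loop_out[OF assms])
  have "same_orbit e (loop_out T w)" "same_orbit e (loop_out S w)"
    using same_orbit_conjugate ab loop_out_nonempty assms by blast+
  then show ?thesis
    using same_orbit_sym same_orbit_trans by blast
qed

text \<open>Allows the action to be computed with any transducer \<open>C\<close> of the class,
  reduced or not, and with any prime word in the orbit of its loop output.\<close>

lemma cyclic_action_eq:
  assumes C: "clopen_embedding C" and w: "prime_word w" and v: "prime_word v"
    and orb: "same_orbit v (loop_out C w)"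
  shows "cyclic_action (reduced_class C) (cyclic_word w) = cyclic_word v"
proof -
  note Cd = clopen_embeddingD[OF C]
  have wne: "w \<noteq> []"
    using w by (simp add: prime_word_def)
  have *: "cyclic_word v' = cyclic_word v"
    if T: "T \<in> reduced_class C" and w': "w' \<in> cyclic_word w" and v': "prime_word v'" "1 \<le> s"
      and o: "out_word T w' (loop_state T w') = word_power v' s" for T w' v' s
  proof -
    note Td = clopen_embeddingD[OF clopen_embedding_reduced_class[OF C T]]
    have w'ne: "w' \<noteq> []"
      using cyclic_word_member(1)[OF w w'] by (simp add: prime_word_def)
    have "same_orbit (loop_out T w') v'"
      using v' o same_orbit_power[of v' s] by (simp add: loop_out_def prime_word_def)
    moreover have "same_orbit (loop_out T w') (loop_out T w)"
      by (rule same_orbit_loop_out[OF Td(3) cyclic_word_member(2)[OF w w'] w'ne wne])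
    moreover have "same_orbit (loop_out T w) (loop_out C w)"
      using T by (intro same_orbit_loop_out_equiv Td Cd wne) (simp add: reduced_class_def)
    ultimately have "same_orbit v' v"
      using orb same_orbit_sym same_orbit_trans by meson
    then show ?thesis
      by (rule cyclic_word_eq_if_same_orbit[OF v'(1) v])
  qed
  have "(THE d. \<forall>T\<in>reduced_class C. \<forall>w'\<in>cyclic_word w. \<exists>v' s. prime_word v' \<and> 1 \<le> s \<and>
      out_word T w' (loop_state T w') = word_power v' s \<and> d = cyclic_word v') = cyclic_word v"
  proof (rule the_equality)
    show "\<forall>T\<in>reduced_class C. \<forall>w'\<in>cyclic_word w. \<exists>v' s. prime_word v' \<and> 1 \<le> s \<and>
      out_word T w' (loop_state T w') = word_power v' s \<and> cyclic_word v = cyclic_word v'"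
    proof (intro ballI)
      fix T w' assume T: "T \<in> reduced_class C" and w': "w' \<in> cyclic_word w"
      note Td = clopen_embeddingD[OF clopen_embedding_reduced_class[OF C T]]
      have "w' \<noteq> []"
        using cyclic_word_member(1)[OF w w'] by (simp add: prime_word_def)
      then obtain v' s where "prime_word v'" "1 \<le> s" "loop_out T w' = word_power v' s"
        using prime_root loop_out_nonempty[OF Td(3)] by blast
      then show "\<exists>v' s. prime_word v' \<and> 1 \<le> s \<and>
          out_word T w' (loop_state T w') = word_power v' s \<and> cyclic_word v = cyclic_word v'"
        using *[OF T w', of v' s] unfolding loop_out_def by metis
    qed
    fix d assume d: "\<forall>T\<in>reduced_class C. \<forall>w'\<in>cyclic_word w. \<exists>v' s. prime_word v' \<and> 1 \<le> s \<and>
      out_word T w' (loop_state T w') = word_power v' s \<and> d = cyclic_word v'"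
    obtain T where "T \<in> reduced_class C"
      by (rule reduced_class_nonempty[OF C])
    then show "d = cyclic_word v"
      using d * self_in_cyclic_word by metis
  qed
  moreover have "cyclic_word w \<in> prime_cyclic_words"
    using w by (simp add: prime_cyclic_words_def)
  ultimately show ?thesis
    by (simp add: cyclic_action_def)
qed

lemma cyclic_action_ex:
  fixes C :: "('a::linorder, 'q) transducer"
  assumes C: "clopen_embedding C" and w: "prime_word w"
  obtains v where "prime_word v" "same_orbit v (loop_out C w)"
    "cyclic_action (reduced_class C) (cyclic_word w) = cyclic_word v"
proof -
  have wne: "w \<noteq> []"
    using w by (simp add: prime_word_def)
  obtain v s where v: "prime_word v" "1 \<le> s" "loop_out C w = word_power v s"
    using prime_root loop_out_nonempty[OF clopen_embeddingD(3)[OF C] wne] by blast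
  then have "same_orbit v (loop_out C w)"
    using same_orbit_sym[OF same_orbit_power[of v s]] by (simp add: prime_word_def)
  then show ?thesis
    using that[OF v(1)] cyclic_action_eq[OF C w v(1)] by blast
qed

lemma cyclic_action_extensional: "cyclic_action A \<in> extensional prime_cyclic_words"
  by (simp add: cyclic_action_def)

lemma cyclic_action_closed:
  assumes "2 \<le> CARD('a::{finite,linorder})" "A \<in> carrier (O_tilde :: 'a tclass monoid)" "c \<in> prime_cyclic_words"
  shows "cyclic_action A c \<in> prime_cyclic_words"
proof -
  obtain T :: "('a, nat) transducer" where T: "clopen_embedding T" "A = reduced_class T"
    by (rule carrier_O_tildeE[OF assms(1,2)]) (rule that)
  obtain w where w: "prime_word w" "c = cyclic_word w"
    using assms(3) by (auto simp: prime_cyclic_words_def)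
  obtain v where "prime_word v" "cyclic_action A c = cyclic_word v"
    using cyclic_action_ex[OF T(1) w(1)] T(2) w(2) by metis
  then show ?thesis
    by (simp add: prime_cyclic_words_def)
qed

lemma cyclic_action_mult:
  assumes n: "2 \<le> CARD('a::{finite,linorder})" and A: "A \<in> carrier (O_tilde :: 'a tclass monoid)"
    and B: "B \<in> carrier O_tilde"
  shows "cyclic_action (A \<otimes>\<^bsub>O_tilde\<^esub> B) = compose prime_cyclic_words (cyclic_action B) (cyclic_action A)"
proof (rule extensionalityI[OF cyclic_action_extensional])
  show "compose prime_cyclic_words (cyclic_action B) (cyclic_action A) \<in> extensional prime_cyclic_words"
    by (rule compose_extensional)
  fix c :: "'a list set" assume c: "c \<in> prime_cyclic_words"
  then obtain w where w: "prime_word w" "c = cyclic_word w"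
    by (auto simp: prime_cyclic_words_def)
  then have wne: "w \<noteq> []"
    by (simp add: prime_word_def)
  obtain T :: "('a, nat) transducer" where T: "clopen_embedding T" "A = reduced_class T"
    by (rule carrier_O_tildeE[OF n A]) (rule that)
  obtain U :: "('a, nat) transducer" where U: "clopen_embedding U" "B = reduced_class U"
    by (rule carrier_O_tildeE[OF n B]) (rule that)
  note Td = clopen_embeddingD[OF T(1)] and Ud = clopen_embeddingD[OF U(1)]
  obtain v where v: "prime_word v" "same_orbit v (loop_out T w)"
    "cyclic_action (reduced_class T) (cyclic_word w) = cyclic_word v"
    by (rule cyclic_action_ex[OF T(1) w(1)]) (rule that)
  obtain u where u: "prime_word u" "same_orbit u (loop_out U v)"
    "cyclic_action (reduced_class U) (cyclic_word v) = cyclic_word u"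
    by (rule cyclic_action_ex[OF U(1) v(1)]) (rule that)
  have vne: "v \<noteq> []"
    using v(1) by (simp add: prime_word_def)
  have "same_orbit (loop_out U v) (loop_out U (loop_out T w))"
    by (rule same_orbit_loop_out[OF Ud(3) v(2) vne loop_out_nonempty[OF Td(3) wne]])
  then have "same_orbit u (loop_out (tr_product T U) w)"
    using u(2) same_orbit_trans loop_out_tr_product[OF Td(3) Ud(3) wne] by metis
  then have "cyclic_action (A \<otimes>\<^bsub>O_tilde\<^esub> B) c = cyclic_word u"
    using cyclic_action_eq[OF clopen_embedding_tr_product[OF T(1) U(1)] w(1) u(1)]
      mult_O_tilde[OF T(1) U(1)] T(2) U(2) w(2) by simp
  then show "cyclic_action (A \<otimes>\<^bsub>O_tilde\<^esub> B) c
      = compose prime_cyclic_words (cyclic_action B) (cyclic_action A) c"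
    using c v(3) u(3) T(2) U(2) w(2) by (simp add: compose_def)
qed

lemma cyclic_action_one:
  assumes n: "2 \<le> CARD('a::{finite,linorder})" and c: "c \<in> prime_cyclic_words"
  shows "cyclic_action \<one>\<^bsub>(O_tilde :: 'a tclass monoid)\<^esub> c = c"
proof -
  obtain w where w: "prime_word w" "c = cyclic_word w"
    using c by (auto simp: prime_cyclic_words_def)
  then show ?thesis
    unfolding one_O_tilde[OF n] w(2)
    by (intro cyclic_action_eq[OF clopen_embedding_id[OF n]]) (simp_all add: loop_out_def same_orbit_refl)
qed

lemma cyclic_action_Bij:
  assumes n: "2 \<le> CARD('a::{finite,linorder})" and A: "A \<in> carrier (O_group :: 'a tclass monoid)"
  shows "cyclic_action A \<in> Bij prime_cyclic_words"
proof -
  let ?W = "prime_cyclic_words :: 'a list set set"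
  interpret group "O_group :: 'a tclass monoid"
    by (rule group_O_group[OF n])
  let ?B = "inv\<^bsub>O_group\<^esub> A"
  have AB: "A \<in> carrier O_tilde" "?B \<in> carrier O_tilde"
    using A inv_closed[OF A] Units_O_tildeD by simp_all
  have "cyclic_action ?B (cyclic_action A c) = c" "cyclic_action A (cyclic_action ?B c) = c"
    if c: "c \<in> ?W" for c
    using cyclic_action_mult[OF n AB] cyclic_action_mult[OF n AB(2,1)] c cyclic_action_one[OF n c]
      l_inv[OF A] r_inv[OF A] by (simp_all add: compose_def fun_eq_iff restrict_def) metis+
  then have "bij_betw (cyclic_action A) ?W ?W"
    using cyclic_action_closed[OF n AB(1)] cyclic_action_closed[OF n AB(2)]
    by (intro bij_betw_byWitness[of _ "cyclic_action ?B"]) auto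
  then show ?thesis
    using cyclic_action_extensional by (simp add: Bij_def)
qed

section \<open>The homomorphism to the symmetric group\<close>

lemma group_right_sym_group: "group (right_sym_group S)"
proof (rule groupI)
  fix f assume f: "f \<in> carrier (right_sym_group S)"
  show "\<one>\<^bsub>right_sym_group S\<^esub> \<otimes>\<^bsub>right_sym_group S\<^esub> f = f"
    using f compose_Id[OF Bij_imp_funcset Bij_imp_extensional] by (simp add: right_sym_group_def)
  show "\<exists>g\<in>carrier (right_sym_group S). g \<otimes>\<^bsub>right_sym_group S\<^esub> f = \<one>\<^bsub>right_sym_group S\<^esub>"
  proof (rule bexI)
    show "(\<lambda>x\<in>S. inv_into S f x) \<in> carrier (right_sym_group S)"
      using f restrict_inv_into_Bij by (simp add: right_sym_group_def)
    show "(\<lambda>x\<in>S. inv_into S f x) \<otimes>\<^bsub>right_sym_group S\<^esub> f = \<one>\<^bsub>right_sym_group S\<^esub>"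
      using f by (auto simp: right_sym_group_def Bij_def compose_def bij_betw_def f_inv_into_f fun_eq_iff)
  qed
next
  fix f g h assume "f \<in> carrier (right_sym_group S)" "g \<in> carrier (right_sym_group S)" "h \<in> carrier (right_sym_group S)"
  then show "f \<otimes>\<^bsub>right_sym_group S\<^esub> g \<otimes>\<^bsub>right_sym_group S\<^esub> h
      = f \<otimes>\<^bsub>right_sym_group S\<^esub> (g \<otimes>\<^bsub>right_sym_group S\<^esub> h)"
    using Bij_imp_funcset[of f S] by (auto simp: right_sym_group_def compose_def fun_eq_iff Pi_iff)
qed (simp_all add: right_sym_group_def compose_Bij id_Bij)

lemma cyclic_action_group_hom:
  assumes n: "2 \<le> CARD('a::{finite,linorder})"
  shows "group_hom (Or_group r :: 'a tclass monoid) (right_sym_group prime_cyclic_words) cyclic_action"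
proof (intro group_hom.intro group_hom_axioms.intro)
  show "cyclic_action \<in> hom (Or_group r :: 'a tclass monoid) (right_sym_group prime_cyclic_words)"
  proof (rule homI)
    fix A assume A: "A \<in> carrier (Or_group r :: 'a tclass monoid)"
    then have AO: "A \<in> carrier O_group"
      by (simp add: Or_group_def)
    then show "cyclic_action A \<in> carrier (right_sym_group prime_cyclic_words)"
      using cyclic_action_Bij[OF n] by (simp add: right_sym_group_def del: O_group_simps)
    fix B assume "B \<in> carrier (Or_group r :: 'a tclass monoid)"
    then have "B \<in> carrier O_group"
      by (simp add: Or_group_def)
    then have "A \<in> carrier O_tilde" "B \<in> carrier O_tilde"
      using AO Units_O_tildeD[of A] Units_O_tildeD[of B] by simp_all
    then show "cyclic_action (A \<otimes>\<^bsub>Or_group r\<^esub> B)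
        = cyclic_action A \<otimes>\<^bsub>right_sym_group prime_cyclic_words\<^esub> cyclic_action B"
      using cyclic_action_mult[OF n, of A B] by (simp add: Or_group_def right_sym_group_def)
  qed
qed (rule group_Or_group[OF n] group_right_sym_group)+

section \<open>Maps of bi-infinite words represented by annotated transducers\<close>

definition tail :: "(int \<Rightarrow> 'a) \<Rightarrow> int \<Rightarrow> (nat \<Rightarrow> 'a)" where
  "tail x i = (\<lambda>n. x (i + int n))"

lemma tail_apply [simp]: "tail x i n = x (i + int n)"
  by (simp add: tail_def)

lemma suffix_tail [simp]: "suffix n (tail x i) = tail x (i + int n)"
  by (simp add: fun_eq_iff add.assoc)

lemma tail_split: "tail x i = prefix n (tail x i) \<frown> tail x (i + int n)"
  using prefix_suffix[of "tail x i" n] by simp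

lemma prefix_tail_add:
  "prefix (m + n) (tail x i) = prefix m (tail x i) @ prefix n (tail x (i + int m))"
  by (rule nth_equalityI) (auto simp: nth_append of_nat_diff algebra_simps)

lemma tail_shift_by [simp]: "tail (shift_by k x) i = tail x (i - k)"
  by (simp add: fun_eq_iff shift_by_def algebra_simps)

lemma tails_eqI:
  assumes "\<And>m. \<exists>i \<le> m. tail x i = tail y i"
  shows "x = y"
proof
  fix m
  obtain i where "i \<le> m" "tail x i = tail y i"
    using assms by blast
  have "x (i + int n) = y (i + int n)" for n
    using fun_cong[OF \<open>tail x i = tail y i\<close>, of n] by simp
  from this[of "nat (m - i)"] show "x m = y m"
    using \<open>i \<le> m\<close> by simp
qed

text \<open>The least synchronizing level is taken for definiteness; by \<open>state_at_eq\<close>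
  every level gives the same state.\<close>

definition state_at :: "('a, 'q) transducer \<Rightarrow> (int \<Rightarrow> 'a) \<Rightarrow> int \<Rightarrow> 'q" where
  "state_at T x i = (let k = LEAST k. sync_level T k in forced_state T (prefix k (tail x (i - int k))))"

lemma state_at_eq:
  assumes T: "is_transducer T" and k: "sync_level T k" and p: "p \<in> states T"
  shows "state_at T x i = step_word T (prefix k (tail x (i - int k))) p"
proof -
  define l where "l = (LEAST k. sync_level T k)"
  have l: "sync_level T l" "l \<le> k"
    unfolding l_def using k by (auto intro: LeastI Least_le)
  have "prefix k (tail x (i - int k)) = prefix (k - l) (tail x (i - int k)) @ prefix l (tail x (i - int l))"
    using prefix_tail_add[of x "i - int k" "k - l" l] l(2) by (simp add: of_nat_diff)
  then have "step_word T (prefix k (tail x (i - int k))) p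
      = step_word T (prefix l (tail x (i - int l))) (step_word T (prefix (k - l) (tail x (i - int k))) p)"
    by simp
  also have "\<dots> = forced_state T (prefix l (tail x (i - int l)))"
    using l(1) step_word_in_states[OF T p] by (intro forced_state_eq[symmetric]) simp_all
  finally show ?thesis
    by (simp add: state_at_def Let_def l_def)
qed

lemma state_at_in_states:
  assumes "sync_transducer T"
  shows "state_at T x i \<in> states T"
proof -
  obtain p k where "p \<in> states T" "sync_level T k" "is_transducer T"
    using assms by (auto simp: sync_transducer_def is_transducer_def strongly_synchronizing_def)
  then show ?thesis
    by (simp add: state_at_eq step_word_in_states)
qed

lemma state_at_step:
  assumes "sync_transducer T"
  shows "step_word T (prefix n (tail x i)) (state_at T x i) = state_at T x (i + int n)"
proof -
  obtain p k where T: "p \<in> states T" "sync_level T k" "is_transducer T"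
    using assms by (auto simp: sync_transducer_def is_transducer_def strongly_synchronizing_def)
  have "sync_level T (k + n)"
    using sync_level_mono[OF T(2) _ T(3)] by simp
  then have "state_at T x (i + int n) = step_word T (prefix (k + n) (tail x (i - int k))) p"
    using state_at_eq[OF T(3) _ T(1), of "k + n" x "i + int n"] by simp
  then show ?thesis
    by (simp add: prefix_tail_add state_at_eq[OF T(3,2,1)])
qed

lemma state_at_cong:
  assumes T: "sync_transducer T" "sync_level T k"
    and eq: "prefix k (tail x (i - int k)) = prefix k (tail y (j - int k))"
  shows "state_at T x i = state_at T y j"
proof -
  obtain p where "p \<in> states T" "is_transducer T"
    using T(1) by (auto simp: sync_transducer_def is_transducer_def)
  then show ?thesis
    using T(2) eq by (simp add: state_at_eq)
qed

lemma state_at_shift_by: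
  assumes "sync_transducer T"
  shows "state_at T (shift_by k x) i = state_at T x (i - k)"
proof -
  obtain l where "sync_level T l"
    using assms by (auto simp: sync_transducer_def strongly_synchronizing_def)
  then show ?thesis
    using assms by (intro state_at_cong) (simp_all add: algebra_simps)
qed

lemma state_at_past:
  assumes T: "sync_transducer T" and "\<And>j. j < i \<Longrightarrow> x j = y j"
  shows "state_at T x i = state_at T y i"
proof -
  obtain k where k: "sync_level T k"
    using T by (auto simp: sync_transducer_def strongly_synchronizing_def)
  have "prefix k (tail x (i - int k)) = prefix k (tail y (i - int k))"
    using assms(2) by (intro nth_equalityI) simp_all
  then show ?thesis
    by (rule state_at_cong[OF T k])
qed

lemma state_map_at_step:
  assumes T: "sync_transducer T"
  shows "state_map T (state_at T x i) (tail x i) = out_word T (prefix n (tail x i)) (state_at T x i)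
    \<frown> state_map T (state_at T x (i + int n)) (tail x (i + int n))"
proof -
  have "is_transducer T"
    using T by (simp add: sync_transducer_def)
  then show ?thesis
    using state_map_conc[of T "state_at T x i" "prefix n (tail x i)" "tail x (i + int n)"]
      tail_split[of x i n] state_at_in_states[OF T] state_at_step[OF T, of x i n] by simp
qed

lemma annotation_step:
  assumes "annotation T \<alpha>" "sync_transducer T"
  shows "\<alpha> (state_at T x (i + int n)) + int n
    = \<alpha> (state_at T x i) + int (length (out_word T (prefix n (tail x i)) (state_at T x i)))"
  using assms(1) state_at_in_states[OF assms(2)] state_at_step[OF assms(2), of x i n, symmetric]
  by (simp add: annotation_def)

lemma annotation_bounded:
  assumes "sync_transducer T"
  shows "\<exists>B. \<forall>q\<in>states T. \<bar>\<alpha> q\<bar> \<le> int B"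
proof -
  have "finite (states T)"
    using assms by (simp add: sync_transducer_def is_transducer_def)
  then have "\<bar>\<alpha> q\<bar> \<le> Max ((\<lambda>q. \<bar>\<alpha> q\<bar>) ` states T)" if "q \<in> states T" for q
    using that by (intro Max_ge) auto
  then have "\<bar>\<alpha> q\<bar> \<le> int (nat (Max ((\<lambda>q. \<bar>\<alpha> q\<bar>) ` states T)))" if "q \<in> states T" for q
    using that by (meson int_nat_eq order_trans nat_le_iff order_refl)
  then show ?thesis by blast
qed

text \<open>Speaking of whole tails makes the relation compose: the tail of the image is exactly the
  input of the next transducer.\<close>

definition represents ::
    "('a, 'q) transducer \<Rightarrow> ('q \<Rightarrow> int) \<Rightarrow> ((int \<Rightarrow> 'a) \<Rightarrow> (int \<Rightarrow> 'a)) \<Rightarrow> bool" where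
  "represents T \<alpha> f \<longleftrightarrow>
     (\<forall>x i. tail (f x) (i + \<alpha> (state_at T x i)) = state_map T (state_at T x i) (tail x i))"

lemma representsD:
  "represents T \<alpha> f \<Longrightarrow>
    tail (f x) (i + \<alpha> (state_at T x i)) = state_map T (state_at T x i) (tail x i)"
  by (simp add: represents_def)

text \<open>The annotation is bounded, so the positions \<open>i + \<alpha> (state_at T x i)\<close>
  go to minus infinity with \<open>i\<close>, and the tails there determine the whole word.\<close>

lemma word_determined_by_tails:
  assumes T: "sync_transducer T"
    and "\<And>i. tail y (i + \<alpha> (state_at T x i)) = tail y' (i + \<alpha> (state_at T x i))"
  shows "y = y'"
proof (rule tails_eqI)
  fix m
  obtain B where B: "\<forall>q\<in>states T. \<bar>\<alpha> q\<bar> \<le> int B"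
    using annotation_bounded[OF T] by blast
  have "\<bar>\<alpha> (state_at T x (m - int B))\<bar> \<le> int B"
    using B state_at_in_states[OF T] by blast
  then have "m - int B + \<alpha> (state_at T x (m - int B)) \<le> m"
    by simp
  then show "\<exists>i\<le>m. tail y i = tail y' i"
    using assms(2) by blast
qed

lemma represents_unique:
  assumes "sync_transducer T" "represents T \<alpha> f" "represents T \<alpha> g"
  shows "f = g"
proof
  fix x
  show "f x = g x"
    using assms by (intro word_determined_by_tails[OF assms(1), of _ \<alpha> x]) (simp add: represents_def)
qed

lemma represents_ex:
  assumes T: "sync_transducer T" and \<alpha>: "annotation T \<alpha>"
  shows "\<exists>f. represents T \<alpha> f"
proof -
  obtain B where B: "\<And>q. q \<in> states T \<Longrightarrow> \<bar>\<alpha> q\<bar> \<le> int B"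
    using annotation_bounded[OF T] by blast
  \<comment> \<open>Letter \<open>m\<close> of the image as computed from position \<open>i\<close>;
    it is meaningful once \<open>i + \<alpha> (state_at T x i) \<le> m\<close>.\<close>
  define val where "val x i m = state_map T (state_at T x i) (tail x i) (nat (m - i - \<alpha> (state_at T x i)))" for x i m
  have step: "val x i m = val x (i + int n) m" if m: "i + int n + \<alpha> (state_at T x (i + int n)) \<le> m" for x i m n
  proof -
    let ?o = "out_word T (prefix n (tail x i)) (state_at T x i)"
    have len: "\<alpha> (state_at T x (i + int n)) + int n = \<alpha> (state_at T x i) + int (length ?o)"
      by (rule annotation_step[OF \<alpha> T])
    then have nl: "\<not> nat (m - i - \<alpha> (state_at T x i)) < length ?o"
      and idx: "nat (m - i - \<alpha> (state_at T x i)) - length ?o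
        = nat (m - (i + int n) - \<alpha> (state_at T x (i + int n)))"
      using m by linarith+
    then show ?thesis
      unfolding val_def state_map_at_step[OF T, of x i n] by (simp only: conc_snd[OF nl] idx)
  qed
  have val_eq: "val x i m = val x j m"
    if "i + \<alpha> (state_at T x i) \<le> m" "j + \<alpha> (state_at T x j) \<le> m" for x i j m
  proof (cases "i \<le> j")
    case True
    then show ?thesis
      using step[of i "nat (j - i)" x m] that by simp
  next
    case False
    then show ?thesis
      using step[of j "nat (i - j)" x m] that by simp
  qed
  \<comment> \<open>Starting at \<open>m - int B\<close> is early enough, because
    \<open>\<alpha>\<close> is at most \<open>B\<close> on states.\<close>
  have "tail (\<lambda>m. val x (m - int B) m) (i + \<alpha> (state_at T x i)) = state_map T (state_at T x i) (tail x i)" for x i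
  proof
    fix n
    let ?m = "i + \<alpha> (state_at T x i) + int n"
    have "val x (?m - int B) ?m = val x i ?m"
      using B[OF state_at_in_states[OF T], of x "?m - int B"] by (intro val_eq) linarith+
    then show "tail (\<lambda>m. val x (m - int B) m) (i + \<alpha> (state_at T x i)) n
        = state_map T (state_at T x i) (tail x i) n"
      by (simp add: val_def)
  qed
  then have "represents T \<alpha> (\<lambda>x m. val x (m - int B) m)"
    by (simp add: represents_def)
  then show ?thesis
    by (intro exI[of _ "\<lambda>x m. val x (m - int B) m"])
qed

lemma map_upto_eq_prefix: "map x [i - int k..i - 1] = prefix k (tail x (i - int k))"
  by (rule nth_equalityI) (simp_all add: add.commute)

text \<open>The definition places the outputs of single letters. By the annotation law consecutive
  outputs occupy adjacent positions, so they concatenate to the outputs on words and determine every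
  tail.\<close>

lemma annotated_map_eq:
  assumes T: "sync_transducer T" and \<alpha>: "annotation T \<alpha>" and f: "represents T \<alpha> f"
  shows "annotated_map T \<alpha> = f"
proof
  fix x
  have tr: "is_transducer T"
    using T by (simp add: sync_transducer_def)
  obtain k where k: "sync_level T k"
    using T by (auto simp: sync_transducer_def strongly_synchronizing_def)
  have forced: "forced_state T (map x [i - int k..i - 1]) = state_at T x i" if "sync_level T k" for i k
    unfolding map_upto_eq_prefix using that state_at_in_states[OF T]
    by (subst state_at_eq[OF tr that state_at_in_states[OF T]]) (simp add: forced_state_eq)
  define good where "good y \<longleftrightarrow> (\<forall>i j. j < length (out T (x i) (state_at T x i)) \<longrightarrow>
    y (i + \<alpha> (state_at T x i) + int j) = out T (x i) (state_at T x i) ! j)" for y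
  have cond: "(\<forall>i k. sync_level T k \<longrightarrow>
     (let q = forced_state T (map x [i - int k..i - 1]); w = out T (x i) q
      in \<forall>j<length w. y (i + \<alpha> q + int j) = w ! j)) \<longleftrightarrow> good y" for y
    using forced k by (auto simp: good_def Let_def)
  have "(THE y. good y) = f x"
  proof (rule the_equality)
    show "good (f x)"
      unfolding good_def
    proof (intro allI impI)
      fix i j
      let ?q = "state_at T x i"
      assume j: "j < length (out T (x i) ?q)"
      have "tail (f x) (i + \<alpha> ?q) j = state_map T ?q (tail x i) j"
        by (simp only: representsD[OF f])
      also have "\<dots> = out T (x i) ?q ! j"
        using state_map_at_step[OF T, of x i 1] j by simp
      finally show "f x (i + \<alpha> ?q + int j) = out T (x i) ?q ! j" by simp
    qed
    fix y assume y: "good y"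
    show "y = f x"
    proof (rule word_determined_by_tails[OF T])
      fix i
      let ?q = "state_at T x i"
      have "tail y (i + \<alpha> ?q) = state_map T ?q (tail x i)"
      proof (rule state_map_unique[OF tr state_at_in_states[OF T]])
        fix n
        have "prefix (length (out_word T (prefix n (tail x i)) ?q)) (tail y (i + \<alpha> ?q))
            = out_word T (prefix n (tail x i)) ?q"
        proof (induction n)
          case (Suc n)
          let ?o = "out_word T (prefix n (tail x i)) ?q" and ?q' = "state_at T x (i + int n)"
          let ?w = "out T (x (i + int n)) ?q'"
          have o: "out_word T (prefix (Suc n) (tail x i)) ?q = ?o @ ?w"
            using state_at_step[OF T, of x i n] by (simp add: subsequence_append[of _ n 1, simplified])
          have pos: "i + \<alpha> ?q + int (length ?o) = i + int n + \<alpha> ?q'"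
            using annotation_step[OF \<alpha> T, of x i n] by simp
          have w: "prefix (length ?w) (tail y (i + int n + \<alpha> ?q')) = ?w"
            using y by (intro nth_equalityI) (simp_all add: good_def)
          show ?case
            by (simp only: o length_append prefix_tail_add pos Suc w)
        qed simp
        then show "\<exists>z. tail y (i + \<alpha> ?q) = out_word T (prefix n (tail x i)) ?q \<frown> z"
          using prefix_eq_iff_conc by blast
      qed
      then show "tail y (i + \<alpha> ?q) = tail (f x) (i + \<alpha> ?q)"
        by (simp only: representsD[OF f])
    qed
  qed
  then show "annotated_map T \<alpha> x = f x"
    unfolding annotated_map_def cond .
qed

text \<open>Conjugating \<open>f\<close> by a shift gives a map represented by the same transducer
  and annotation, hence \<open>f\<close> itself.\<close>

lemma represents_shift_by_commute:
  assumes T: "sync_transducer T" and f: "represents T \<alpha> f"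
  shows "f (shift_by k x) = shift_by k (f x)"
proof -
  have "represents T \<alpha> (\<lambda>x. shift_by (- k) (f (shift_by k x)))"
    unfolding represents_def
  proof (intro allI)
    fix x i
    have "tail (f (shift_by k x)) (i + k + \<alpha> (state_at T x i)) = state_map T (state_at T x i) (tail x i)"
      using representsD[OF f, of "shift_by k x" "i + k"] by (simp add: state_at_shift_by[OF T])
    then show "tail (shift_by (- k) (f (shift_by k x))) (i + \<alpha> (state_at T x i))
        = state_map T (state_at T x i) (tail x i)"
      by (simp add: algebra_simps)
  qed
  then have "(\<lambda>x. shift_by (- k) (f (shift_by k x))) = f"
    by (rule represents_unique[OF T _ f])
  then have "shift_by k (shift_by (- k) (f (shift_by k x))) = shift_by k (f x)"
    by metis
  then show ?thesis by simp
qed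

lemma represents_dependence:
  assumes T: "sync_transducer T" and f: "represents T \<alpha> f"
  shows "\<exists>F. finite F \<and> (\<forall>x y. (\<forall>i\<in>F. x i = y i) \<longrightarrow> f x m = f y m)"
proof -
  obtain B where B: "\<And>q. q \<in> states T \<Longrightarrow> \<bar>\<alpha> q\<bar> \<le> int B"
    using annotation_bounded[OF T] by blast
  obtain k where k: "sync_level T k"
    using T by (auto simp: sync_transducer_def strongly_synchronizing_def)
  have tr: "is_transducer T"
    using T by (simp add: sync_transducer_def)
  define i where "i = m - int B"
  \<comment> \<open>With \<open>i = m - int B\<close>, letter \<open>m\<close> of the image has an
    index between 0 and \<open>2 * B\<close> in the tail written from position
    \<open>i\<close>.\<close>
  define M where "M = Suc (2 * B)"
  define N where "N = M * card (states T)"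
  let ?F = "{i - int k..i + int N}"
  have "f x m = f y m" if xy: "\<forall>j\<in>?F. x j = y j" for x y
  proof -
    have "prefix k (tail x (i - int k)) = prefix k (tail y (i - int k))"
      using xy by (intro nth_equalityI) simp_all
    then have q: "state_at T x i = state_at T y i"
      by (rule state_at_cong[OF T k])
    let ?q = "state_at T y i"
    have "prefix N (tail x i) = prefix N (tail y i)"
      using xy by (intro nth_equalityI) simp_all
    then have pr: "prefix M (state_map T ?q (tail x i)) = prefix M (state_map T ?q (tail y i))"
      unfolding N_def by (rule state_map_uniformly_continuous[OF tr state_at_in_states[OF T]])
    define n where "n = nat (m - (i + \<alpha> ?q))"
    have "n < M" "m = i + \<alpha> ?q + int n"
      using B[OF state_at_in_states[OF T], of y i] by (simp_all add: n_def i_def M_def)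
    then have "f x m = state_map T ?q (tail x i) n" "f y m = state_map T ?q (tail y i) n"
      using fun_cong[OF representsD[OF f, of x i], of n] fun_cong[OF representsD[OF f, of y i], of n] q
      by simp_all
    moreover have "state_map T ?q (tail x i) n = state_map T ?q (tail y i) n"
      using arg_cong[OF pr, of "\<lambda>u. u ! n"] \<open>n < M\<close> by simp
    ultimately show ?thesis by simp
  qed
  then show ?thesis
    by (intro exI[of _ ?F]) simp
qed

lemma represents_add_const:
  "represents T \<alpha> f \<Longrightarrow> represents T (\<lambda>q. \<alpha> q + c) (\<lambda>x. shift_by c (f x))"
  by (simp add: represents_def add.assoc)

lemma annotation_add_const: "annotation T \<alpha> \<Longrightarrow> annotation T (\<lambda>q. \<alpha> q + c)"
  by (simp add: annotation_def)

section \<open>Products of annotated transducers\<close>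

lemma annotation_tr_product:
  assumes "is_transducer T" "annotation T \<alpha>" "annotation U \<beta>"
  shows "annotation (tr_product T U) (\<lambda>(p, q). \<alpha> p + \<beta> q)"
  using assms by (auto simp: annotation_def)

text \<open>\<open>T\<close> turns a long past of \<open>x\<close> into a long piece of
  \<open>f x\<close> ending right before position \<open>i + \<alpha> (state_at T x i)\<close>, and
  this piece forces the state of \<open>U\<close>.\<close>

lemma state_at_tr_product:
  assumes T: "sync_transducer T" and U: "sync_transducer U"
    and \<alpha>: "annotation T \<alpha>" and f: "represents T \<alpha> f"
  shows "state_at (tr_product T U) x i
    = (state_at T x i, state_at U (f x) (i + \<alpha> (state_at T x i)))"
proof -
  let ?P = "tr_product T U"
  have tr: "is_transducer T" "is_transducer U" "is_transducer ?P"
    using T U by (simp_all add: sync_transducer_def is_transducer_tr_product)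
  obtain k l where k: "sync_level U k" and l: "sync_level ?P l"
    using U sync_transducer_tr_product[OF T U] by (auto simp: sync_transducer_def strongly_synchronizing_def)
  obtain q0 where q0: "q0 \<in> states U"
    using tr(2) by (auto simp: is_transducer_def)
  \<comment> \<open>At least \<open>l\<close>, to synchronize the product, and long enough for
    \<open>T\<close> to write the \<open>k\<close> letters that synchronize
    \<open>U\<close>.\<close>
  define n where "n = l + k * card (states T)"
  define p0 where "p0 = state_at T x (i - int n)"
  have p0: "p0 \<in> states T"
    unfolding p0_def by (rule state_at_in_states[OF T])
  let ?w = "prefix n (tail x (i - int n))"
  let ?v = "out_word T ?w p0"
  have p: "step_word T ?w p0 = state_at T x i"
    using state_at_step[OF T, of x "i - int n" n] by (simp add: p0_def)
  have pos: "i - int n + \<alpha> p0 + int (length ?v) = i + \<alpha> (state_at T x i)"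
    using annotation_step[OF \<alpha> T, of x "i - int n" n] by (simp add: p0_def)
  have "sync_level ?P n"
    using sync_level_mono[OF l _ tr(3)] by (simp add: n_def)
  then have "state_at ?P x i = step_word ?P ?w (p0, q0)"
    using p0 q0 by (intro state_at_eq[OF tr(3)]) simp_all
  also have "\<dots> = (state_at T x i, step_word U ?v q0)"
    by (simp add: p)
  also have "step_word U ?v q0 = state_at U (f x) (i + \<alpha> (state_at T x i))"
  proof -
    have "k \<le> length ?v"
      using length_out_word_ge[OF tr(1) p0, of k ?w] by (simp add: n_def)
    then have "sync_level U (length ?v)"
      by (rule sync_level_mono[OF k _ tr(2)])
    moreover have "i + \<alpha> (state_at T x i) - int (length ?v) = i - int n + \<alpha> p0"
      using pos by linarith
    ultimately have "state_at U (f x) (i + \<alpha> (state_at T x i))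
        = step_word U (prefix (length ?v) (tail (f x) (i - int n + \<alpha> p0))) q0"
      using state_at_eq[OF tr(2) _ q0, of "length ?v" "f x" "i + \<alpha> (state_at T x i)"]
      by (simp only:)
    also have "prefix (length ?v) (tail (f x) (i - int n + \<alpha> p0)) = ?v"
      using representsD[OF f, of x "i - int n"] prefix_state_map[of T p0 "tail x (i - int n)" n]
      by (simp add: p0_def)
    finally show ?thesis ..
  qed
  finally show ?thesis .
qed

lemma represents_tr_product:
  assumes T: "sync_transducer T" and U: "sync_transducer U"
    and \<alpha>: "annotation T \<alpha>" and f: "represents T \<alpha> f" and g: "represents U \<beta> g"
  shows "represents (tr_product T U) (\<lambda>(p, q). \<alpha> p + \<beta> q) (g \<circ> f)"
  unfolding represents_def state_at_tr_product[OF T U \<alpha> f]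
proof (intro allI)
  fix x i
  let ?p = "state_at T x i"
  let ?q = "state_at U (f x) (i + \<alpha> ?p)"
  have "state_map (tr_product T U) (?p, ?q) (tail x i) = state_map U ?q (tail (f x) (i + \<alpha> ?p))"
    using T U state_at_in_states[OF T] state_at_in_states[OF U] representsD[OF f, of x i]
    by (simp add: state_map_tr_product sync_transducer_def)
  also have "\<dots> = tail (g (f x)) (i + \<alpha> ?p + \<beta> ?q)"
    by (rule representsD[OF g, symmetric])
  finally show "tail ((g \<circ> f) x) (i + (case (?p, ?q) of (p, q) \<Rightarrow> \<alpha> p + \<beta> q))
      = state_map (tr_product T U) (?p, ?q) (tail x i)"
    by (simp add: add.assoc)
qed

text \<open>The letters before position \<open>i + \<alpha> (state_at T x i)\<close> are written
  while letters before \<open>i\<close> are read.\<close>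

lemma represents_past:
  assumes T: "sync_transducer T" and \<alpha>: "annotation T \<alpha>" and f: "represents T \<alpha> f"
    and xy: "\<And>j. j < i \<Longrightarrow> x j = y j" and m: "m < i + \<alpha> (state_at T x i)"
  shows "f x m = f y m"
proof -
  obtain B where B: "\<And>q. q \<in> states T \<Longrightarrow> \<bar>\<alpha> q\<bar> \<le> int B"
    using annotation_bounded[OF T] by blast
  \<comment> \<open>Going back by \<open>n\<close> letters makes the starting position
    \<open>i' + \<alpha> ?q\<close> at most \<open>m\<close>, as \<open>\<alpha>\<close> is at most
    \<open>B\<close>.\<close>
  define n where "n = nat (i - m) + B"
  define i' where "i' = i - int n"
  have i'n: "i' + int n = i"
    by (simp add: i'_def)
  have eq: "state_at T x i' = state_at T y i'"
    using xy by (intro state_at_past[OF T]) (simp add: i'_def)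
  let ?q = "state_at T y i'"
  have pr: "prefix n (tail x i') = prefix n (tail y i')"
    using xy by (intro nth_equalityI) (simp_all add: i'_def)
  let ?o = "out_word T (prefix n (tail y i')) ?q"
  have "\<alpha> ?q \<le> int B"
    using B[OF state_at_in_states[OF T], of y i'] by linarith
  moreover have "i' + int B \<le> m"
    by (simp add: i'_def n_def)
  ultimately have i'm: "i' + \<alpha> ?q \<le> m"
    by linarith
  have "i' + \<alpha> ?q + int (length ?o) = i + \<alpha> (state_at T x i)"
    using annotation_step[OF \<alpha> T, of x i' n, unfolded i'n eq pr] i'n by linarith
  then have j: "nat (m - (i' + \<alpha> ?q)) < length ?o" "m = i' + \<alpha> ?q + int (nat (m - (i' + \<alpha> ?q)))"
    using m i'm by linarith+
  have "f z m = ?o ! nat (m - (i' + \<alpha> ?q))"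
    if "state_at T z i' = ?q" "prefix n (tail z i') = prefix n (tail y i')" for z
  proof -
    have "f z m = tail (f z) (i' + \<alpha> ?q) (nat (m - (i' + \<alpha> ?q)))"
      using j(2) by simp
    also have "\<dots> = state_map T ?q (tail z i') (nat (m - (i' + \<alpha> ?q)))"
      using representsD[OF f, of z i'] that(1) by simp
    also have "\<dots> = ?o ! nat (m - (i' + \<alpha> ?q))"
      using state_map_at_step[OF T, of z i' n] j(1) that by simp
    finally show ?thesis .
  qed
  from this[OF eq pr] this[of y] show ?thesis by simp
qed

text \<open>Keeping the past fixes the state, while the prescribed future lets its map range over
  all infinite words.\<close>

definition replace_from :: "(int \<Rightarrow> 'a) \<Rightarrow> int \<Rightarrow> (nat \<Rightarrow> 'a) \<Rightarrow> (int \<Rightarrow> 'a)" where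
  "replace_from x i u = (\<lambda>j. if j < i then x j else u (nat (j - i)))"

lemma replace_from_less [simp]: "j < i \<Longrightarrow> replace_from x i u j = x j"
  by (simp add: replace_from_def)

lemma tail_replace_from [simp]: "tail (replace_from x i u) i = u"
  by (simp add: replace_from_def fun_eq_iff)

lemma state_at_replace_from:
  assumes "sync_transducer T"
  shows "state_at T (replace_from x i u) i = state_at T x i"
  by (rule state_at_past[OF assms]) simp

text \<open>Both state maps read off the same image word, from two starting positions; the letters in
  between depend on the past only.\<close>
lemma represents_prefix:
  assumes T: "sync_transducer T" and f: "represents T \<alpha> f"
    and S: "sync_transducer S" "annotation S \<beta>" and f': "represents S \<beta> f"
    and le: "\<alpha> (state_at T x i) \<le> \<beta> (state_at S x i)"
  shows "\<exists>a. length a = nat (\<beta> (state_at S x i) - \<alpha> (state_at T x i)) \<and>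
    (\<forall>u. state_map T (state_at T x i) u = a \<frown> state_map S (state_at S x i) u)"
proof -
  let ?p = "state_at T x i" and ?q = "state_at S x i"
  let ?d = "nat (\<beta> ?q - \<alpha> ?p)"
  let ?a = "prefix ?d (tail (f x) (i + \<alpha> ?p))"
  have "state_map T ?p u = ?a \<frown> state_map S ?q u" for u
  proof -
    let ?x = "replace_from x i u"
    have st: "state_at T ?x i = ?p" "state_at S ?x i = ?q"
      using state_at_replace_from T S(1) by metis+
    have "f ?x m = f x m" if "m < i + \<beta> ?q" for m
      using that st(2) by (intro represents_past[OF S f', of i]) simp_all
    then have "prefix ?d (tail (f ?x) (i + \<alpha> ?p)) = ?a"
      by (intro nth_equalityI) simp_all
    moreover have "tail (f ?x) (i + \<alpha> ?p) = prefix ?d (tail (f ?x) (i + \<alpha> ?p)) \<frown> tail (f ?x) (i + \<beta> ?q)"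
      using tail_split[of "f ?x" "i + \<alpha> ?p" ?d] le by simp
    ultimately show ?thesis
      using representsD[OF f, of ?x i] representsD[OF f', of ?x i] st by simp
  qed
  then show ?thesis
    by (intro exI[of _ ?a]) simp
qed

section \<open>Represented maps and equivalence of transducers\<close>

lemma state_at_of_word:
  assumes T: "sync_transducer T" and k: "sync_level T k" "k \<le> length w" and p: "p \<in> states T"
  shows "state_at T (replace_from x (- int (length w)) (w \<frown> u)) 0 = step_word T w p"
proof -
  have tr: "is_transducer T"
    using T by (simp add: sync_transducer_def)
  have "state_at T (replace_from x (- int (length w)) (w \<frown> u)) 0
      = step_word T (prefix (length w) (tail (replace_from x (- int (length w)) (w \<frown> u)) (0 - int (length w)))) p"
    by (rule state_at_eq[OF tr sync_level_mono[OF k tr] p])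
  then show ?thesis by simp
qed

text \<open>Every word is the past of position 0 in some bi-infinite word, so
  \<open>represents_prefix\<close> compares the maps of all states reached by long words; bounds on
  the annotations bound the prefixes.\<close>

lemma tr_equiv_if_represents:
  assumes T: "sync_transducer T" "annotation T \<alpha>" and f: "represents T \<alpha> f"
    and S: "sync_transducer S" "annotation S \<beta>" and f': "represents S \<beta> f"
  shows "tr_equiv T S"
proof -
  obtain B where B: "\<And>q. q \<in> states T \<Longrightarrow> \<bar>\<alpha> q\<bar> \<le> int B"
    using annotation_bounded[OF T(1)] by blast
  obtain C where C: "\<And>q. q \<in> states S \<Longrightarrow> \<bar>\<beta> q\<bar> \<le> int C"
    using annotation_bounded[OF S(1)] by blast
  obtain k l where k: "sync_level T k" and l: "sync_level S l"
    using T S by (auto simp: sync_transducer_def strongly_synchronizing_def)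
  have "prefix_equiv (B + C) (state_map T (step_word T w p)) (state_map S (step_word S w q))"
    if w: "k + l \<le> length w" and p: "p \<in> states T" and q: "q \<in> states S" for w p q
  proof -
    let ?x = "replace_from undefined (- int (length w)) (w \<frown> undefined)"
    have st: "state_at T ?x 0 = step_word T w p" "state_at S ?x 0 = step_word S w q"
      using state_at_of_word[OF T(1) k _ p] state_at_of_word[OF S(1) l _ q] w by simp_all
    have bd: "\<bar>\<alpha> (state_at T ?x 0)\<bar> \<le> int B" "\<bar>\<beta> (state_at S ?x 0)\<bar> \<le> int C"
      using B C state_at_in_states T(1) S(1) by blast+
    show ?thesis
    proof (cases "\<alpha> (state_at T ?x 0) \<le> \<beta> (state_at S ?x 0)")
      case True
      obtain a where "length a = nat (\<beta> (state_at S ?x 0) - \<alpha> (state_at T ?x 0))"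
        "\<And>u. state_map T (state_at T ?x 0) u = a \<frown> state_map S (state_at S ?x 0) u"
        using represents_prefix[OF T(1) f S f' True] by blast
      then show ?thesis
        using bd st by (intro prefix_equivI[of a _ "[]" _ "state_map S (step_word S w q)"]) simp_all
    next
      case False
      then obtain a where "length a = nat (\<alpha> (state_at T ?x 0) - \<beta> (state_at S ?x 0))"
        "\<And>u. state_map S (state_at S ?x 0) u = a \<frown> state_map T (state_at T ?x 0) u"
        using represents_prefix[OF S(1) f' T f, of ?x 0] by auto
      then show ?thesis
        using bd st by (intro prefix_equivI[of "[]" _ a _ "state_map T (step_word T w p)"]) simp_all
    qed
  qed
  then show ?thesis
    unfolding tr_equiv_def by blast
qed

lemma tr_equiv_at:
  assumes T: "sync_transducer T" and S: "sync_transducer S" and eq: "tr_equiv T S"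
  obtains B where "\<And>x i. prefix_equiv B (state_map T (state_at T x i)) (state_map S (state_at S x i))"
proof -
  obtain K B where KB: "\<And>w p q. K \<le> length w \<Longrightarrow> p \<in> states T \<Longrightarrow> q \<in> states S \<Longrightarrow>
    prefix_equiv B (state_map T (step_word T w p)) (state_map S (step_word S w q))"
    using tr_equivE[OF eq] by blast
  have "prefix_equiv B (state_map T (state_at T x i)) (state_map S (state_at S x i))" for x i
    using KB[of "prefix K (tail x (i - int K))" "state_at T x (i - int K)" "state_at S x (i - int K)"]
      state_at_in_states[OF T] state_at_in_states[OF S] state_at_step[OF T, of x "i - int K" K]
      state_at_step[OF S, of x "i - int K" K] by simp
  then show ?thesis
    by (rule that)
qed

text \<open>With \<open>A\<close> and \<open>B'\<close> the prefixes of the two state maps over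
  their common remainder, \<open>c x i\<close> is the displacement between the annotations past
  these prefixes. It does not change when \<open>N\<close> letters are read and depends only on the
  forced states, which makes it the same for all words and positions. This value is the constant
  sought.\<close>

lemma represents_equiv:
  assumes T: "sync_transducer T" "nonconstant T" "annotation T \<alpha>" and f: "represents T \<alpha> f"
    and S: "sync_transducer S" "annotation S \<beta>" and eq: "tr_equiv T S"
  shows "\<exists>c. represents S (\<lambda>q. \<beta> q + c) f"
proof -
  have tr: "is_transducer T" "is_transducer S"
    using T S by (simp_all add: sync_transducer_def)
  obtain B where B: "\<And>x i. prefix_equiv B (state_map T (state_at T x i)) (state_map S (state_at S x i))"
    using tr_equiv_at[OF T(1) S(1) eq] by blast
  have "\<exists>a b h. length a \<le> B \<and> length b \<le> B \<and> (\<forall>u. state_map T p u = a \<frown> h u) \<and> (\<forall>u. state_map S q u = b \<frown> h u)"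
    if "prefix_equiv B (state_map T p) (state_map S q)" for p q
    using that by (simp add: prefix_equiv_def)
  \<comment> \<open>The prefixes are chosen as functions of the pair of states, so that
    \<open>c x i\<close> depends on \<open>x\<close> and \<open>i\<close> through the forced states
    only.\<close>
  then obtain a b h where abh: "\<And>p q. prefix_equiv B (state_map T p) (state_map S q) \<Longrightarrow>
      length (a p q) \<le> B \<and> length (b p q) \<le> B \<and>
      (\<forall>u. state_map T p u = a p q \<frown> h p q u) \<and> (\<forall>u. state_map S q u = b p q \<frown> h p q u)"
    by metis
  define A where "A x i = a (state_at T x i) (state_at S x i)" for x i
  define B' where "B' x i = b (state_at T x i) (state_at S x i)" for x i
  define H where "H x i = h (state_at T x i) (state_at S x i)" for x i
  have ab: "length (A x i) \<le> B" "length (B' x i) \<le> B"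
    "\<And>u. state_map T (state_at T x i) u = A x i \<frown> H x i u"
    "\<And>u. state_map S (state_at S x i) u = B' x i \<frown> H x i u" for x i
    using abh[OF B] by (simp_all add: A_def B'_def H_def)
  define c where "c x i = \<alpha> (state_at T x i) + int (length (A x i)) - \<beta> (state_at S x i) - int (length (B' x i))" for x i
  obtain k l where k: "sync_level T k" and l: "sync_level S l"
    using T S by (auto simp: sync_transducer_def strongly_synchronizing_def)
  \<comment> \<open>\<open>N\<close> is at least both synchronizing levels and makes both
    transducers write at least \<open>B\<close> letters, enough to cover the prefixes to be
    cancelled.\<close>
  define N where "N = k + l + B * card (states T) + B * card (states S)"
  have long: "B \<le> length (out_word T (prefix N (tail x i)) (state_at T x i))"
    "B \<le> length (out_word S (prefix N (tail x i)) (state_at S x i))" for x i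
    using state_at_in_states T(1) S(1) by (auto intro!: length_out_word_ge tr simp: N_def)
  have c_step: "c x (i + int N) = c x i" for x i
  proof -
    let ?w = "prefix N (tail x i)" and ?p = "state_at T x i" and ?q = "state_at S x i"
    have stp: "step_word T ?w ?p = state_at T x (i + int N)" "step_word S ?w ?q = state_at S x (i + int N)"
      by (rule state_at_step[OF T(1)] state_at_step[OF S(1)])+
    obtain e where "out_word T ?w ?p @ A x (i + int N) = A x i @ e"
      "out_word S ?w ?q @ B' x (i + int N) = B' x i @ e"
    proof (rule common_residual[OF tr(1) state_at_in_states[OF T(1)] tr(2) state_at_in_states[OF S(1)] ab(3,4)])
      show "\<And>u. state_map T (step_word T ?w ?p) u = A x (i + int N) \<frown> H x (i + int N) u"
        "\<And>u. state_map S (step_word S ?w ?q) u = B' x (i + int N) \<frown> H x (i + int N) u"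
        unfolding stp by (rule ab(3,4))+
      show "length (A x i) \<le> length (out_word T ?w ?p @ A x (i + int N))"
        "length (B' x i) \<le> length (out_word S ?w ?q @ B' x (i + int N))"
        using long[of x i] ab(1,2)[of x i] by simp_all
    qed (use T(2) that in blast)+
    then have "length (out_word T ?w ?p) + length (A x (i + int N)) = length (A x i) + length e"
      "length (out_word S ?w ?q) + length (B' x (i + int N)) = length (B' x i) + length e"
      by (metis length_append)+
    then show ?thesis
      using annotation_step[OF T(3,1), of x i N] annotation_step[OF S(2,1), of x i N]
      unfolding c_def by linarith
  qed
  have c_const: "c x i = c y j" for x i y j
  proof -
    \<comment> \<open>\<open>z\<close> has the past of \<open>x\<close> at position 0 and the window
      of \<open>y\<close> before \<open>j\<close> in front of position \<open>N\<close>, so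
      invariance under \<open>N\<close> steps connects the two values.\<close>
    define z where "z = replace_from (shift_by (- i) x) 0 (tail y (j - int N))"
    have "c z 0 = c (shift_by (- i) x) 0"
      unfolding c_def A_def B'_def z_def state_at_replace_from[OF T(1)] state_at_replace_from[OF S(1)] ..
    also have "\<dots> = c x i"
      by (simp add: c_def A_def B'_def state_at_shift_by[OF T(1)] state_at_shift_by[OF S(1)])
    finally have x: "c z 0 = c x i" .
    have pz: "prefix m (tail z (int N - int m)) = prefix m (tail y (j - int m))" if "m \<le> N" for m
      using that by (intro nth_equalityI) (simp_all add: z_def replace_from_def algebra_simps)
    have "k \<le> N" "l \<le> N"
      by (simp_all add: N_def)
    then have "state_at T z (int N) = state_at T y j" "state_at S z (int N) = state_at S y j"
      using state_at_cong[OF T(1) k pz] state_at_cong[OF S(1) l pz] by simp_all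
    then have "c z (int N) = c y j"
      by (simp add: c_def A_def B'_def)
    then show ?thesis
      using x c_step[of z 0] by simp
  qed
  define d where "d = c undefined 0"
  have "tail (f x) (i + (\<beta> (state_at S x i) + d)) = state_map S (state_at S x i) (tail x i)" for x i
  proof -
    \<comment> \<open>Starting \<open>N\<close> letters earlier makes the output of \<open>S\<close>
      long enough to contain \<open>B' x ?j\<close>; beyond it both sides are tails of the common
      remainder.\<close>
    let ?j = "i - int N"
    let ?p = "state_at T x ?j" and ?q = "state_at S x ?j"
    let ?o = "out_word S (prefix N (tail x ?j)) ?q"
    have "B' x ?j \<frown> H x ?j (tail x ?j) = ?o \<frown> state_map S (state_at S x i) (tail x i)"
      using state_map_at_step[OF S(1), of x ?j N] ab(4)[of x ?j "tail x ?j"] by simp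
    then have "H x ?j (tail x ?j) = drop (length (B' x ?j)) ?o \<frown> state_map S (state_at S x i) (tail x i)"
      using long(2)[of x ?j] ab(2)[of x ?j] by (intro conc_cancel(2)) simp_all
    then have "state_map S (state_at S x i) (tail x i)
        = suffix (length ?o - length (B' x ?j)) (H x ?j (tail x ?j))"
      by simp
    also have "H x ?j (tail x ?j) = suffix (length (A x ?j)) (tail (f x) (?j + \<alpha> ?p))"
      using representsD[OF f, of x ?j] ab(3)[of x ?j "tail x ?j"] by simp
    also have "suffix (length ?o - length (B' x ?j)) \<dots>
        = tail (f x) (?j + \<alpha> ?p + int (length (A x ?j)) + int (length ?o - length (B' x ?j)))"
      by simp
    also have "?j + \<alpha> ?p + int (length (A x ?j)) + int (length ?o - length (B' x ?j))
        = i + (\<beta> (state_at S x i) + d)"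
    proof -
      have "d = \<alpha> ?p + int (length (A x ?j)) - \<beta> ?q - int (length (B' x ?j))"
        using c_const[of undefined 0 x ?j] by (simp add: d_def c_def)
      moreover have "length (B' x ?j) \<le> length ?o"
        using long(2)[of x ?j] ab(2)[of x ?j] by linarith
      moreover have "\<beta> (state_at S x i) + int N = \<beta> ?q + int (length ?o)"
        using annotation_step[OF S(2,1), of x ?j N] by simp
      ultimately show ?thesis
        by linarith
    qed
    finally show ?thesis ..
  qed
  then show ?thesis
    unfolding represents_def by blast
qed

text \<open>The excess of output length over input length is additive along paths and zero on loops,
  so between two states it does not depend on the path. An annotation is a potential for it.\<close>

lemma annotation_ex:
  assumes T: "sync_transducer T" and L: "length_preserving T" and sc: "strongly_connected T"
  shows "\<exists>\<alpha>. annotation T \<alpha>"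
proof -
  obtain p where p: "p \<in> states T"
    using T by (auto simp: sync_transducer_def is_transducer_def)
  have st: "step_word T w q \<in> states T" if "q \<in> states T" for w q
    using T that step_word_in_states by (auto simp: sync_transducer_def)
  define \<delta> where "\<delta> w q = int (length (out_word T w q)) - int (length w)" for w q
  have \<delta>_append: "\<delta> (u @ v) q = \<delta> u q + \<delta> v (step_word T u q)" for u v q
    by (simp add: \<delta>_def)
  have \<delta>_loop: "\<delta> w q = 0" if "q \<in> states T" "step_word T w q = q" for w q
    using length_preservingD[OF L T that] by (simp add: \<delta>_def)
  define path where "path q = (SOME w. step_word T w p = q)" for q
  have path: "step_word T (path q) p = q" if "q \<in> states T" for q
    using sc p that unfolding strongly_connected_def path_def by (metis (mono_tags) someI_ex)
  have "\<delta> (path (step_word T w q)) p = \<delta> (path q) p + \<delta> w q" if q: "q \<in> states T" for w q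
  proof -
    \<comment> \<open>Returning along the same \<open>z\<close> closes both paths from
      \<open>p\<close> to loops.\<close>
    obtain z where z: "step_word T z (step_word T w q) = p"
      using sc p st[OF q] unfolding strongly_connected_def by blast
    have "\<delta> (path q @ w @ z) p = 0" "\<delta> (path (step_word T w q) @ z) p = 0"
      using p path[OF q] path[OF st[OF q]] z by (auto intro!: \<delta>_loop)
    then show ?thesis
      using path[OF q] path[OF st[OF q]] by (simp add: \<delta>_append)
  qed
  then have "annotation T (\<lambda>q. \<delta> (path q) p)"
    by (simp add: annotation_def \<delta>_def)
  then show ?thesis
    by (intro exI[of _ "\<lambda>q. \<delta> (path q) p"])
qed

text \<open>The past of a periodic word forces the loop state, so each period of the image is one
  loop output; the annotation law gives it the length of \<open>w\<close>.\<close>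

lemma represents_periodic_word:
  assumes T: "sync_transducer T" "annotation T \<alpha>" and f: "represents T \<alpha> f" and w: "w \<noteq> []"
  shows "\<exists>k. f (periodic_word w) = shift_by k (periodic_word (loop_out T w))"
proof -
  let ?x = "periodic_word w" and ?q = "loop_state T w" and ?L = "int (length w)"
  have q: "?q \<in> states T" "step_word T w ?q = ?q"
    using loop_state[OF T(1) w] by simp_all
  have tr: "is_transducer T"
    using T(1) by (simp add: sync_transducer_def)
  have per: "tail ?x (i + j * ?L) = tail ?x i" for i j
  proof -
    have "tail ?x (i + j * ?L) = tail (shift_by (- j * ?L) ?x) i"
      by simp
    then show ?thesis
      by (simp only: shift_by_periodic_word)
  qed
  have pw: "prefix (length w) (tail ?x 0) = w"
    by (intro nth_equalityI) (simp_all add: periodic_word_nth)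
  have at: "state_at T ?x 0 = ?q"
  proof -
    have "step_word T w (state_at T ?x 0) = state_at T ?x ?L"
      using state_at_step[OF T(1), of ?x 0 "length w"] pw by simp
    also have "\<dots> = state_at T (shift_by (1 * ?L) ?x) ?L"
      by (simp only: shift_by_periodic_word)
    also have "\<dots> = state_at T ?x 0"
      using state_at_shift_by[OF T(1), of ?L ?x ?L] by simp
    finally show ?thesis
      using loop_state_eqI[OF T(1) w state_at_in_states[OF T(1)]] by simp
  qed
  have len: "length (loop_out T w) = length w"
    using T(2)[unfolded annotation_def, rule_format, OF q(1), of w] q(2) by (simp add: loop_out_def)
  have "periodic_word (loop_out T w) = shift_by (- \<alpha> ?q) (f ?x)"
  proof (rule periodic_word_eqI)
    have "shift_by ?L (f ?x) = f (shift_by (1 * ?L) ?x)"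
      using represents_shift_by_commute[OF T(1) f, of ?L ?x] by simp
    then have "shift_by ?L (f ?x) = f ?x"
      by (simp only: shift_by_periodic_word)
    then show "shift_by (int (length (loop_out T w))) (shift_by (- \<alpha> ?q) (f ?x)) = shift_by (- \<alpha> ?q) (f ?x)"
      by (simp only: len shift_by_commute[of ?L])
    show "loop_out T w \<noteq> []"
      by (rule loop_out_nonempty[OF T(1) w])
    fix j assume j: "j < length (loop_out T w)"
    have "tail (f ?x) (\<alpha> ?q) j = state_map T ?q (tail ?x 0) j"
      using representsD[OF f, of ?x 0] at by simp
    also have "\<dots> = loop_out T w ! j"
      using state_map_at_step[OF T(1), of ?x 0 "length w"] at pw j by (simp add: loop_out_def)
    finally show "shift_by (- \<alpha> ?q) (f ?x) (int j) = loop_out T w ! j"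
      by (simp add: shift_by_def add.commute)
  qed
  then have "f ?x = shift_by (\<alpha> ?q) (periodic_word (loop_out T w))"
    by simp
  then show ?thesis ..
qed

section \<open>Automorphisms of the full shift\<close>

lemma continuous_map_shift_spaceI:
  fixes f :: "(int \<Rightarrow> 'a) \<Rightarrow> (int \<Rightarrow> 'a)"
  assumes "\<And>m. \<exists>F. finite F \<and> (\<forall>x y. (\<forall>i\<in>F. x i = y i) \<longrightarrow> f x m = f y m)"
  shows "continuous_map shift_space shift_space f"
  unfolding continuous_map_componentwise_UNIV
proof
  fix m
  obtain F where F: "finite F" "\<And>x y. \<forall>i\<in>F. x i = y i \<Longrightarrow> f x m = f y m"
    using assms[of m] by blast
  have "openin shift_space {x. f x m \<in> U}" for U
  proof (subst openin_subopen, rule ballI)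
    fix x assume "x \<in> {x. f x m \<in> U}"
    then have "{y. \<forall>i\<in>F. y i = x i} \<subseteq> {x. f x m \<in> U}"
      using F(2) by fastforce
    then show "\<exists>T. openin shift_space T \<and> x \<in> T \<and> T \<subseteq> {x. f x m \<in> U}"
      using openin_box[OF F(1), of x] by (intro exI[of _ "{y. \<forall>i\<in>F. y i = x i}"]) simp
  qed
  then show "continuous_map shift_space (discrete_topology UNIV) (\<lambda>x. f x m)"
    by (simp add: continuous_map_def)
qed

lemma dependence_if_continuous:
  fixes f :: "(int \<Rightarrow> 'a::finite) \<Rightarrow> (int \<Rightarrow> 'a)"
  assumes "continuous_map shift_space shift_space f"
  shows "\<exists>F. finite F \<and> (\<forall>x y. (\<forall>i\<in>F. x i = y i) \<longrightarrow> f x m = f y m)"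
proof (rule finite_dependence_if_locally_constant)
  fix x
  have "continuous_map shift_space (discrete_topology UNIV) (\<lambda>x. f x m)"
    using assms unfolding continuous_map_componentwise_UNIV by blast
  then have "openin shift_space {y \<in> topspace shift_space. f y m \<in> {f x m}}"
    by (rule openin_continuous_map_preimage) simp
  then show "openin shift_space {y. f y m = f x m}"
    by simp
qed

lemma continuous_map_shift_by: "continuous_map shift_space shift_space (shift_by k)"
proof (rule continuous_map_shift_spaceI)
  fix m
  show "\<exists>F. finite F \<and> (\<forall>x y. (\<forall>i\<in>F. x i = y i) \<longrightarrow> shift_by k x m = shift_by k y m)"
    by (intro exI[of _ "{m - k}"]) (simp add: shift_by_def)
qed

section \<open>The automorphism group\<close>

lemma shift_aut_simps [simp]:
  "\<one>\<^bsub>shift_aut\<^esub> = id" "f \<otimes>\<^bsub>shift_aut\<^esub> g = g \<circ> f"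
  by (simp_all add: shift_aut_def)

lemma shift_aut_commute:
  assumes "f \<in> carrier shift_aut"
  shows "f (shift_by k x) = shift_by k (f x)"
proof -
  have "f \<circ> shift_map = shift_map \<circ> f"
    using assms by (simp add: shift_aut_def)
  then have 1: "f (shift_by 1 x) = shift_by 1 (f x)" for x
    unfolding shift_map_eq by (metis comp_apply)
  have nat: "f (shift_by (int n) x) = shift_by (int n) (f x)" for n x
  proof (induction n arbitrary: x)
    case (Suc n)
    have "f (shift_by (int (Suc n)) x) = f (shift_by (int n) (shift_by 1 x))"
      by (simp add: add.commute)
    also have "\<dots> = shift_by (int n) (shift_by 1 (f x))"
      by (simp only: Suc 1)
    finally show ?case
      by (simp add: add.commute)
  qed simp
  show ?thesis
  proof (cases "k \<ge> 0")
    case True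
    then show ?thesis
      using nat[of "nat k" x] by simp
  next
    case False
    have "shift_by (- k) (f (shift_by k x)) = f (shift_by (- k) (shift_by k x))"
      using False nat[of "nat (- k)" "shift_by k x"] by simp
    then have "shift_by k (shift_by (- k) (f (shift_by k x))) = shift_by k (f x)"
      by simp
    then show ?thesis by simp
  qed
qed

lemma shift_autI:
  assumes "continuous_map shift_space shift_space f" "continuous_map shift_space shift_space g"
    "\<And>x. g (f x) = x" "\<And>x. f (g x) = x" "\<And>x. f (shift_by 1 x) = shift_by 1 (f x)"
  shows "f \<in> carrier shift_aut"
proof -
  have "homeomorphic_maps shift_space shift_space f g"
    using assms by (simp add: homeomorphic_maps_def)
  then show ?thesis
    using assms(5) homeomorphic_maps_imp_map by (auto simp: shift_aut_def shift_map_eq)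
qed

lemma shift_aut_inverse:
  assumes "f \<in> carrier shift_aut"
  obtains g where "g \<in> carrier shift_aut" "\<And>x. g (f x) = x" "\<And>x. f (g x) = x"
proof -
  obtain g where "homeomorphic_maps shift_space shift_space f g"
    using assms unfolding shift_aut_def by (auto simp: homeomorphic_map_maps)
  then have g: "continuous_map shift_space shift_space f" "continuous_map shift_space shift_space g"
    "\<And>x. g (f x) = x" "\<And>x. f (g x) = x"
    by (simp_all add: homeomorphic_maps_def)
  have "g (shift_by 1 x) = shift_by 1 (g x)" for x
    using g(3,4) shift_aut_commute[OF assms] by metis
  then have "g \<in> carrier shift_aut"
    using g by (intro shift_autI[of g f])
  then show ?thesis
    using that g by blast
qed

lemma shift_aut_continuous:
  "f \<in> carrier shift_aut \<Longrightarrow> continuous_map shift_space shift_space f"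
  by (simp add: shift_aut_def homeomorphic_imp_continuous_map)

lemma shift_by_in_shift_aut: "shift_by k \<in> carrier shift_aut"
  by (rule shift_autI[of _ "shift_by (- k)"]) (simp_all add: continuous_map_shift_by add.commute)

lemma group_shift_aut: "group shift_aut"
proof (rule groupI)
  fix f g :: "(int \<Rightarrow> 'a) \<Rightarrow> (int \<Rightarrow> 'a)"
  assume f: "f \<in> carrier shift_aut" and g: "g \<in> carrier shift_aut"
  show "f \<otimes>\<^bsub>shift_aut\<^esub> g \<in> carrier shift_aut"
  proof -
    have "f \<circ> shift_map = shift_map \<circ> f" "g \<circ> shift_map = shift_map \<circ> g"
      using f g by (simp_all add: shift_aut_def)
    then have "(g \<circ> f) \<circ> shift_map = shift_map \<circ> (g \<circ> f)"
      by (metis comp_assoc)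
    then show ?thesis
      using f g homeomorphic_map_compose[of shift_space shift_space f shift_space g]
      by (simp add: shift_aut_def)
  qed
next
  fix f :: "(int \<Rightarrow> 'a) \<Rightarrow> (int \<Rightarrow> 'a)" assume f: "f \<in> carrier shift_aut"
  obtain g where "g \<in> carrier shift_aut" "\<And>x. g (f x) = x" "\<And>x. f (g x) = x"
    by (rule shift_aut_inverse[OF f]) (rule that)
  then show "\<exists>g\<in>carrier shift_aut. g \<otimes>\<^bsub>shift_aut\<^esub> f = \<one>\<^bsub>shift_aut\<^esub>"
    by (intro bexI[of _ g]) (simp_all add: fun_eq_iff)
next
  have "(id :: (int \<Rightarrow> 'a) \<Rightarrow> (int \<Rightarrow> 'a)) \<in> carrier shift_aut"
    by (simp add: shift_aut_def)
  then show "\<one>\<^bsub>shift_aut\<^esub> \<in> carrier (shift_aut :: ((int \<Rightarrow> 'a) \<Rightarrow> (int \<Rightarrow> 'a)) monoid)"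
    by simp
qed (simp_all add: comp_assoc)

section \<open>Powers of the shift and their cosets\<close>

lemma subgroup_range_shift_by: "subgroup (range shift_by) shift_aut"
proof -
  interpret group "shift_aut :: ((int \<Rightarrow> 'a) \<Rightarrow> (int \<Rightarrow> 'a)) monoid"
    by (rule group_shift_aut)
  have comp: "shift_by j \<circ> shift_by k = (shift_by (j + k) :: (int \<Rightarrow> 'a) \<Rightarrow> (int \<Rightarrow> 'a))" for j k
    by (simp add: fun_eq_iff)
  show ?thesis
  proof
    show "range shift_by \<subseteq> carrier (shift_aut :: ((int \<Rightarrow> 'a) \<Rightarrow> (int \<Rightarrow> 'a)) monoid)"
      using shift_by_in_shift_aut by blast
    show "\<one>\<^bsub>shift_aut\<^esub> \<in> range (shift_by :: int \<Rightarrow> (int \<Rightarrow> 'a) \<Rightarrow> (int \<Rightarrow> 'a))"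
      by (rule range_eqI[of _ _ 0]) (simp add: fun_eq_iff)
    fix f :: "(int \<Rightarrow> 'a) \<Rightarrow> (int \<Rightarrow> 'a)" assume "f \<in> range shift_by"
    then obtain k where k: "f = shift_by k" by blast
    have "inv\<^bsub>shift_aut\<^esub> f = shift_by (- k)"
      unfolding k by (rule inv_equality) (simp_all add: fun_eq_iff shift_by_in_shift_aut)
    then show "inv\<^bsub>shift_aut\<^esub> f \<in> range shift_by" by simp
    fix g :: "(int \<Rightarrow> 'a) \<Rightarrow> (int \<Rightarrow> 'a)" assume "g \<in> range shift_by"
    then show "f \<otimes>\<^bsub>shift_aut\<^esub> g \<in> range shift_by"
      using k comp by auto
  qed
qed

lemma shift_subgroup_eq: "shift_subgroup = range (shift_by :: int \<Rightarrow> (int \<Rightarrow> 'a) \<Rightarrow> (int \<Rightarrow> 'a))"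
proof
  interpret group "shift_aut :: ((int \<Rightarrow> 'a) \<Rightarrow> (int \<Rightarrow> 'a)) monoid"
    by (rule group_shift_aut)
  show "shift_subgroup \<subseteq> range (shift_by :: int \<Rightarrow> (int \<Rightarrow> 'a) \<Rightarrow> (int \<Rightarrow> 'a))"
    unfolding shift_subgroup_def
    by (rule generate_subgroup_incl[OF _ subgroup_range_shift_by]) (simp add: shift_map_eq)
  have gen: "(shift_by 1 :: (int \<Rightarrow> 'a) \<Rightarrow> (int \<Rightarrow> 'a)) \<in> shift_subgroup"
    "(shift_by (- 1) :: (int \<Rightarrow> 'a) \<Rightarrow> (int \<Rightarrow> 'a)) \<in> shift_subgroup"
  proof -
    show "(shift_by 1 :: (int \<Rightarrow> 'a) \<Rightarrow> (int \<Rightarrow> 'a)) \<in> shift_subgroup"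
      unfolding shift_subgroup_def by (rule generate.incl) (simp add: shift_map_eq)
    have "inv\<^bsub>shift_aut\<^esub> shift_map = (shift_by (- 1) :: (int \<Rightarrow> 'a) \<Rightarrow> (int \<Rightarrow> 'a))"
      by (rule inv_equality) (simp_all add: shift_map_eq fun_eq_iff shift_by_in_shift_aut)
    moreover have "inv\<^bsub>shift_aut\<^esub> (shift_map :: (int \<Rightarrow> 'a) \<Rightarrow> (int \<Rightarrow> 'a)) \<in> shift_subgroup"
      unfolding shift_subgroup_def by (rule generate.inv) simp
    ultimately show "(shift_by (- 1) :: (int \<Rightarrow> 'a) \<Rightarrow> (int \<Rightarrow> 'a)) \<in> shift_subgroup"
      by simp
  qed
  have mult: "(shift_by (j + k) :: (int \<Rightarrow> 'a) \<Rightarrow> (int \<Rightarrow> 'a)) \<in> shift_subgroup"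
    if "(shift_by j :: (int \<Rightarrow> 'a) \<Rightarrow> (int \<Rightarrow> 'a)) \<in> shift_subgroup"
      "(shift_by k :: (int \<Rightarrow> 'a) \<Rightarrow> (int \<Rightarrow> 'a)) \<in> shift_subgroup" for j k
  proof -
    have "shift_by k \<circ> shift_by j \<in> (shift_subgroup :: ((int \<Rightarrow> 'a) \<Rightarrow> (int \<Rightarrow> 'a)) set)"
      using that generate.eng[of "shift_by j" shift_aut "{shift_map}" "shift_by k"]
      by (simp add: shift_subgroup_def)
    moreover have "shift_by k \<circ> shift_by j = (shift_by (j + k) :: (int \<Rightarrow> 'a) \<Rightarrow> (int \<Rightarrow> 'a))"
      by (simp add: fun_eq_iff add.commute)
    ultimately show ?thesis by simp
  qed
  have zero: "shift_by 0 \<in> (shift_subgroup :: ((int \<Rightarrow> 'a) \<Rightarrow> (int \<Rightarrow> 'a)) set)"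
    using mult[OF gen] by simp
  have "shift_by k \<in> (shift_subgroup :: ((int \<Rightarrow> 'a) \<Rightarrow> (int \<Rightarrow> 'a)) set)" for k
  proof (induction k rule: int_induct[of _ 0])
    case base
    show ?case by (rule zero)
  next
    case (step1 i)
    then show ?case using mult[OF _ gen(1)] by blast
  next
    case (step2 i)
    then show ?case using mult[OF _ gen(2), of i] by simp
  qed
  then show "range shift_by \<subseteq> (shift_subgroup :: ((int \<Rightarrow> 'a) \<Rightarrow> (int \<Rightarrow> 'a)) set)"
    by blast
qed

lemma shift_coset_eq:
  assumes "\<And>k x. f (shift_by k x) = shift_by k (f x)"
  shows "shift_subgroup #>\<^bsub>shift_aut\<^esub> f = range (\<lambda>k. shift_by k \<circ> f)"
proof -
  have "f \<circ> shift_by k = shift_by k \<circ> f" for k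
    using assms by (simp add: fun_eq_iff)
  then show ?thesis
    by (auto simp: r_coset_def shift_subgroup_eq)
qed

lemma shift_coset_shift_by:
  assumes "\<And>k x. f (shift_by k x) = shift_by k (f x)"
  shows "shift_subgroup #>\<^bsub>shift_aut\<^esub> (shift_by c \<circ> f) = shift_subgroup #>\<^bsub>shift_aut\<^esub> f"
proof -
  have "range (\<lambda>k. shift_by k \<circ> (shift_by c \<circ> f)) = range (\<lambda>k. shift_by k \<circ> f)"
  proof
    have "shift_by k \<circ> (shift_by c \<circ> f) = shift_by (k + c) \<circ> f" for k
      by (simp add: fun_eq_iff)
    then show "range (\<lambda>k. shift_by k \<circ> (shift_by c \<circ> f)) \<subseteq> range (\<lambda>k. shift_by k \<circ> f)"
      by auto
    have "shift_by k \<circ> f = shift_by (k - c) \<circ> (shift_by c \<circ> f)" for k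
      by (simp add: fun_eq_iff)
    then show "range (\<lambda>k. shift_by k \<circ> f) \<subseteq> range (\<lambda>k. shift_by k \<circ> (shift_by c \<circ> f))"
      by (metis image_subsetI rangeI)
  qed
  moreover have "(shift_by c \<circ> f) (shift_by k x) = shift_by k ((shift_by c \<circ> f) x)" for k x
    by (simp add: assms add.commute)
  ultimately show ?thesis
    using shift_coset_eq[of f] shift_coset_eq[of "shift_by c \<circ> f"] assms by simp
qed

lemma normal_shift_subgroup:
  "(shift_subgroup :: ((int \<Rightarrow> 'a) \<Rightarrow> (int \<Rightarrow> 'a)) set) \<lhd> shift_aut"
proof (rule group.normalI[OF group_shift_aut])
  show "subgroup (shift_subgroup :: ((int \<Rightarrow> 'a) \<Rightarrow> (int \<Rightarrow> 'a)) set) shift_aut"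
    unfolding shift_subgroup_eq by (rule subgroup_range_shift_by)
  show "\<forall>f\<in>carrier shift_aut. (shift_subgroup :: ((int \<Rightarrow> 'a) \<Rightarrow> (int \<Rightarrow> 'a)) set) #>\<^bsub>shift_aut\<^esub> f = f <#\<^bsub>shift_aut\<^esub> shift_subgroup"
  proof
    fix f :: "(int \<Rightarrow> 'a) \<Rightarrow> (int \<Rightarrow> 'a)" assume f: "f \<in> carrier shift_aut"
    show "shift_subgroup #>\<^bsub>shift_aut\<^esub> f = f <#\<^bsub>shift_aut\<^esub> shift_subgroup"
      unfolding shift_coset_eq[OF shift_aut_commute[OF f]] l_coset_def
      by (auto simp: shift_subgroup_eq)
  qed
qed

subsection \<open>Transducers of block maps\<close>

text \<open>The de Bruijn automaton with memory \<open>M\<close>. Each step writes exactly one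
  letter, so the constant 0 is an annotation.\<close>

definition block_transducer :: "nat \<Rightarrow> ('a list \<Rightarrow> 'a) \<Rightarrow> ('a, 'a list) transducer" where
  "block_transducer M g =
     \<lparr>states = {w. length w = M}, step = \<lambda>a w. drop 1 (w @ [a]), out = \<lambda>a w. [g (w @ [a])]\<rparr>"

lemma step_word_block_transducer: "step_word (block_transducer M g) v w = drop (length v) (w @ v)"
proof (induction v arbitrary: w)
  case (Cons a v)
  have "step_word (block_transducer M g) (a # v) w = drop (length v) (drop 1 (w @ [a]) @ v)"
    using Cons by (simp add: block_transducer_def)
  also have "drop 1 (w @ [a]) @ v = drop 1 (w @ a # v)"
    by (cases w) simp_all
  finally show ?case
    by (simp only: drop_drop length_Cons Suc_eq_plus1)
qed simp

lemma length_out_word_block_transducer [simp]: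
  "length (out_word (block_transducer M g) v w) = length v"
  by (induction v arbitrary: w) (simp_all add: block_transducer_def)

lemma sync_transducer_block_transducer:
  fixes g :: "'a::finite list \<Rightarrow> 'a"
  shows "sync_transducer (block_transducer M g)" "sync_level (block_transducer M g) M"
proof -
  let ?D = "block_transducer M g"
  have st: "states ?D = {w. length w = M}"
    by (simp add: block_transducer_def)
  have "finite {w :: 'a list. set w \<subseteq> UNIV \<and> length w = M}"
    by (rule finite_lists_length_eq) simp
  then have fin: "finite (states ?D)"
    by (simp add: st)
  have ne: "states ?D \<noteq> {}"
    using Ex_list_of_length[of M] by (auto simp: st)
  have "is_transducer ?D"
    unfolding is_transducer_def
  proof (intro conjI ballI allI impI fin ne)
    show "step ?D a w \<in> states ?D" if "w \<in> states ?D" for a w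
      using that by (simp add: block_transducer_def)
    show "out_word ?D v w \<noteq> []" if "v \<noteq> []" for v w
      using that length_out_word_block_transducer[of M g v w] by fastforce
  qed
  moreover show sync: "sync_level ?D M"
    by (simp add: sync_level_def step_word_block_transducer st)
  ultimately show "sync_transducer ?D"
    by (auto simp: sync_transducer_def strongly_synchronizing_def)
qed

lemma annotation_block_transducer: "annotation (block_transducer M g) (\<lambda>_. 0)"
  by (simp add: annotation_def)

lemma length_preserving_block_transducer: "length_preserving (block_transducer M g)"
  by (simp add: length_preserving_def loop_out_def)

lemma state_at_block_transducer:
  fixes g :: "'a::finite list \<Rightarrow> 'a"
  shows "state_at (block_transducer M g) x i = prefix M (tail x (i - int M))"
proof -
  obtain w :: "'a list" where w: "length w = M"
    using Ex_list_of_length by blast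
  have "state_at (block_transducer M g) x i = step_word (block_transducer M g) (prefix M (tail x (i - int M))) w"
    using sync_transducer_block_transducer[of M g] w
    by (intro state_at_eq) (simp_all add: sync_transducer_def block_transducer_def)
  then show ?thesis
    by (simp add: step_word_block_transducer w)
qed

lemma represents_block_transducer:
  fixes g :: "'a::finite list \<Rightarrow> 'a"
  assumes f: "\<And>x i. f x i = g (prefix (Suc M) (tail x (i - int M)))"
  shows "represents (block_transducer M g) (\<lambda>_. 0) f"
  unfolding represents_def
proof (intro allI)
  fix x i
  let ?D = "block_transducer M g"
  let ?q = "state_at ?D x i"
  note D = sync_transducer_block_transducer(1)[of M g]
  have o: "out_word ?D (prefix n (tail x i)) ?q = prefix n (tail (f x) i)" for n
  proof (induction n)
    case (Suc n)
    let ?j = "i + int n"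
    have "out ?D (x ?j) (state_at ?D x ?j) = [f x ?j]"
      by (simp add: state_at_block_transducer f) (simp add: block_transducer_def)
    moreover have "prefix (Suc n) (tail y i) = prefix n (tail y i) @ [y ?j]" for y :: "int \<Rightarrow> 'a"
      by simp
    ultimately show ?case
      by (simp only: Suc out_word_append state_at_step[OF D] out_word.simps append_Nil2)
  qed simp
  have "tail (f x) i = state_map ?D ?q (tail x i)"
  proof (rule state_map_unique)
    show "is_transducer ?D" "?q \<in> states ?D"
      using D state_at_in_states by (simp_all add: sync_transducer_def)
    show "\<exists>z. tail (f x) i = out_word ?D (prefix n (tail x i)) ?q \<frown> z" for n
      unfolding o by (metis prefix_suffix)
  qed
  then show "tail (f x) (i + 0) = state_map ?D ?q (tail x i)"
    by simp
qed

text \<open>Fix a past ending in \<open>w\<close>. Injectivity of \<open>f\<close> passes to the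
  state map, since image letters before 0 depend on the past only. For the clopen image, changing an
  image word from position \<open>m\<close> on does not affect the negative letters of its preimage,
  which therefore still forces the state \<open>w\<close>.\<close>

lemma clopen_embedding_block_transducer:
  fixes g :: "'a::finite list \<Rightarrow> 'a"
  assumes n: "2 \<le> CARD('a)"
    and f: "\<And>x i. f x i = g (prefix (Suc M) (tail x (i - int M)))"
    and g: "\<And>x. h (f x) = x" "\<And>y. f (h y) = y"
    and h: "\<And>y y' i. (\<And>j. j < i + int m \<Longrightarrow> y j = y' j) \<Longrightarrow> h y i = h y' i"
  shows "clopen_embedding (block_transducer M g)"
proof -
  let ?D = "block_transducer M g"
  note D = sync_transducer_block_transducer[of M g]
  note rep = represents_block_transducer[of f g M, OF f]
  have past: "f x j = f y j" if "j < 0" "\<And>j. j < 0 \<Longrightarrow> x j = y j" for x y j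
    using represents_past[OF D(1) annotation_block_transducer rep, of 0 x y j] that by simp
  have tail_f: "tail (f x) 0 = state_map ?D (state_at ?D x 0) (tail x 0)" for x
    using representsD[OF rep, of x 0] by simp
  have "inj (state_map ?D w) \<and> finitary (image_of_state ?D w)" if w: "w \<in> states ?D" for w
  proof
    have lw: "length w = M"
      using w by (simp add: block_transducer_def)
    define X where "X u = replace_from undefined (- int (length w)) (w \<frown> u)" for u
    have at: "state_at ?D (X u) 0 = w" for u
      using state_at_of_word[OF D(1,2) _ w, of w undefined u] lw
      by (simp add: X_def step_word_block_transducer)
    have tX: "tail (X u) 0 = u" for u
    proof
      fix n
      show "tail (X u) 0 n = u n"
        by (simp add: X_def replace_from_def nat_add_distrib)
    qed
    have X_past: "X u j = X v j" if "j < 0" for u v j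
      using that by (simp add: X_def replace_from_def)
    have sm: "state_map ?D w u = tail (f (X u)) 0" for u
      using tail_f[of "X u"] by (simp add: at tX)
    show "inj (state_map ?D w)"
    proof (rule injI)
      fix u v assume eq: "state_map ?D w u = state_map ?D w v"
      have "f (X u) = f (X v)"
      proof
        fix j
        show "f (X u) j = f (X v) j"
        proof (cases "j < 0")
          case True
          then show ?thesis
            using X_past by (rule past)
        next
          case False
          then show ?thesis
            using fun_cong[OF eq, of "nat j"] by (simp add: sm)
        qed
      qed
      then have "X u = X v"
        using g(1) by metis
      then show "u = v"
        using tX by metis
    qed
    have "determined m (image_of_state ?D w)"
      unfolding determined_def
    proof (intro allI impI)
      fix v v' assume pr: "prefix m v = prefix m v'" and "v \<in> image_of_state ?D w"
      then obtain u where u: "v = tail (f (X u)) 0"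
        by (auto simp: image_of_state_def sm)
      \<comment> \<open>\<open>y\<close> keeps the letters of \<open>f (X u)\<close> before 0 and
        continues with \<open>v'\<close>; its preimage \<open>h y\<close> will exhibit
        \<open>v'\<close> as a value of the state map.\<close>
      define y where "y = replace_from (f (X u)) 0 v'"
      have "y j = f (X u) j" if "j < int m" for j
      proof (cases "j < 0")
        case False
        then have "v (nat j) = v' (nat j)"
          using arg_cong[OF pr, of "\<lambda>w. w ! nat j"] False \<open>j < int m\<close> by simp
        then show ?thesis
          using False by (simp add: y_def replace_from_def u)
      qed (simp add: y_def)
      then have "h y i = h (f (X u)) i" if "i < 0" for i
        using that by (intro h) simp
      then have "h y i = X u i" if "i < 0" for i
        using that g(1) by simp
      then have "state_at ?D (h y) 0 = w"
        using state_at_past[OF D(1), of 0 "h y" "X u"] at by simp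
      then have "tail (f (h y)) 0 = state_map ?D w (tail (h y) 0)"
        using tail_f[of "h y"] by simp
      then have "v' = state_map ?D w (tail (h y) 0)"
        by (simp add: g(2) y_def)
      then show "v' \<in> image_of_state ?D w"
        by (auto simp: image_of_state_def)
    qed
    then show "finitary (image_of_state ?D w)"
      by (auto simp: finitary_def)
  qed
  moreover have "nonconstant ?D"
  proof -
    obtain a b :: 'a where "a \<noteq> b"
      using two_letters[OF n] by blast
    then have "(\<lambda>_ :: nat. a) \<noteq> (\<lambda>_. b)"
      by (simp add: fun_eq_iff)
    then show ?thesis
      using calculation unfolding nonconstant_def inj_def by blast
  qed
  ultimately show ?thesis
    using D(1) by (simp add: clopen_embedding_def)
qed

text \<open>Curtis--Hedlund--Lyndon: after composition with a power of the shift, an automorphism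
  reads only letters that are not in the future.\<close>
lemma shift_aut_block_map:
  fixes f :: "(int \<Rightarrow> 'a::finite) \<Rightarrow> (int \<Rightarrow> 'a)"
  assumes f: "f \<in> carrier shift_aut"
  obtains m g where "\<And>x i. shift_by (int m) (f x) i = g (prefix (Suc (2 * m)) (tail x (i - int (2 * m))))"
    "\<And>y y' i. \<forall>j \<le> i + int m. y j = y' j \<Longrightarrow> f y i = f y' i"
proof -
  obtain F where F: "finite F" "\<And>x y. \<forall>i\<in>F. x i = y i \<Longrightarrow> f x 0 = f y 0"
    using dependence_if_continuous[OF shift_aut_continuous[OF f], of 0] by blast
  define m where "m = Max (insert 0 ((\<lambda>i. nat \<bar>i\<bar>) ` F))"
  have m: "\<bar>i\<bar> \<le> int m" if "i \<in> F" for i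
  proof -
    have "nat \<bar>i\<bar> \<le> m"
      unfolding m_def using F(1) that by (intro Max_ge) auto
    then show ?thesis by linarith
  qed
  have shift: "f x i = f (shift_by (- i) x) 0" for x i
    by (simp add: shift_aut_commute[OF f]) (simp add: shift_by_def)
  \<comment> \<open>Positions outside the window from \<open>- m\<close> to \<open>m\<close> receive
    arbitrary letters; \<open>F\<close> lies inside the window, so they do not affect the
    value.\<close>
  define g where "g w = f (\<lambda>j. w ! nat (j + int m)) 0" for w
  have block: "f x i = g (prefix (Suc (2 * m)) (tail x (i - int m)))" for x i
    unfolding shift[of x i] g_def
  proof (rule F(2), rule ballI)
    fix j assume "j \<in> F"
    then have "nat (j + int m) < Suc (2 * m)" "0 \<le> j + int m"
      using m[of j] by linarith+
    then show "shift_by (- i) x j = prefix (Suc (2 * m)) (tail x (i - int m)) ! nat (j + int m)"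
      by (simp add: shift_by_def algebra_simps del: subseq_to_Suc)
  qed
  show ?thesis
  proof
    show "shift_by (int m) (f x) i = g (prefix (Suc (2 * m)) (tail x (i - int (2 * m))))" for x i
      using block[of x "i - int m"] by (simp add: shift_by_def algebra_simps del: subseq_to_Suc)
    show "f y i = f y' i" if "\<forall>j \<le> i + int m. y j = y' j" for y y' i
      unfolding shift[of y i] shift[of y' i]
    proof (rule F(2), rule ballI)
      fix j assume "j \<in> F"
      then have "j + i \<le> i + int m"
        using m[of j] by linarith
      then show "shift_by (- i) y j = shift_by (- i) y' j"
        using that by (simp add: shift_by_def)
    qed
  qed
qed

section \<open>The group \<open>\<L>\<^sub>n\<close> and the automorphisms of the shift\<close>

lemma represents_id: "represents id_transducer (\<lambda>_. c) (shift_by c)"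
  by (simp add: represents_def fun_eq_iff)

lemma annotation_id: "annotation id_transducer (\<lambda>_. c)"
  by (simp add: annotation_def)

text \<open>The product represents the composition and is equivalent to the identity transducer, all
  of whose annotations represent shifts.\<close>

lemma represents_tr_product_id:
  fixes T :: "('a::finite, 'p) transducer" and U :: "('a, 'q) transducer"
  assumes n: "2 \<le> CARD('a)"
    and T: "clopen_embedding T" "annotation T \<alpha>" and f: "represents T \<alpha> f"
    and U: "clopen_embedding U" "annotation U \<beta>" and g: "represents U \<beta> g"
    and eq: "tr_equiv (tr_product T U) id_transducer"
  shows "\<exists>c. g \<circ> f = shift_by c"
proof -
  note Td = clopen_embeddingD[OF T(1)] and Ud = clopen_embeddingD[OF U(1)]
    and Pd = clopen_embeddingD[OF clopen_embedding_tr_product[OF T(1) U(1)]]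
    and Id = clopen_embeddingD[OF clopen_embedding_id[OF n]]
  have "represents (tr_product T U) (\<lambda>(p, q). \<alpha> p + \<beta> q) (g \<circ> f)"
    by (rule represents_tr_product[OF Td(3) Ud(3) T(2) f g])
  then obtain c where "represents id_transducer (\<lambda>q. 0 + c) (g \<circ> f)"
    using represents_equiv[OF Pd(3,4) annotation_tr_product[OF Td(1) T(2) U(2)] _ Id(3) annotation_id[of 0] eq]
    by blast
  then have "g \<circ> f = shift_by c"
    using represents_unique[OF Id(3)] represents_id[of c] by simp
  then show ?thesis ..
qed

lemma represents_shift_aut:
  assumes T: "sync_transducer T" and f: "represents T \<alpha> f" and U: "sync_transducer U" and g: "represents U \<beta> g"
    and gf: "g \<circ> f = shift_by c" and fg: "f \<circ> g = shift_by d"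
  shows "f \<in> carrier shift_aut"
proof (rule shift_autI)
  note fc = represents_shift_by_commute[OF T f] and gc = represents_shift_by_commute[OF U g]
  have gf': "g (f x) = shift_by c x" for x
    using fun_cong[OF gf, of x] by simp
  have fg': "f (g x) = shift_by d x" for x
    using fun_cong[OF fg, of x] by simp
  show "continuous_map shift_space shift_space f"
    using represents_dependence[OF T f] by (rule continuous_map_shift_spaceI)
  have "continuous_map shift_space shift_space g"
    using represents_dependence[OF U g] by (rule continuous_map_shift_spaceI)
  then show "continuous_map shift_space shift_space (shift_by (- c) \<circ> g)"
    using continuous_map_shift_by by (rule continuous_map_compose)
  show left: "(shift_by (- c) \<circ> g) (f x) = x" for x
    by (simp add: gf')
  \<comment> \<open>Surjectivity of \<open>f\<close>, which comes from \<open>fg\<close>, makes the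
    left inverse two-sided.\<close>
  show "f ((shift_by (- c) \<circ> g) x) = x" for x
  proof -
    have "x = f (g (shift_by (- d) x))"
      by (simp add: fg')
    then have "(shift_by (- c) \<circ> g) x = g (shift_by (- d) x)"
      using left[of "g (shift_by (- d) x)"] by simp
    then show ?thesis
      by (simp add: fg')
  qed
  show "f (shift_by 1 x) = shift_by 1 (f x)" for x
    by (rule fc)
qed

text \<open>By \<open>represents_equiv\<close>, any member of the class with any annotation gives
  \<open>f\<close> up to a shift. This makes the identification with cosets well defined.\<close>

lemma annotated_map_coset:
  fixes C :: "('a::{finite,linorder}, 'q) transducer"
  assumes C: "clopen_embedding C" "annotation C \<gamma>" and f: "represents C \<gamma> f"
    and T: "T \<in> reduced_class C" "annotation T \<alpha>"
  shows "shift_subgroup #>\<^bsub>shift_aut\<^esub> annotated_map T \<alpha> = shift_subgroup #>\<^bsub>shift_aut\<^esub> f"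
proof -
  note Cd = clopen_embeddingD[OF C(1)]
    and Td = clopen_embeddingD[OF clopen_embedding_reduced_class[OF C(1) T(1)]]
  obtain g where g: "represents T \<alpha> g"
    using represents_ex[OF Td(3) T(2)] by blast
  have "tr_equiv C T"
    using T(1) by (simp add: reduced_class_def tr_equiv_sym)
  then obtain c where "represents T (\<lambda>q. \<alpha> q + c) f"
    using represents_equiv[OF Cd(3,4) C(2) f Td(3) T(2)] by blast
  then have "f = shift_by c \<circ> g"
    using represents_unique[OF Td(3) _ represents_add_const[OF g]] by (auto simp: fun_eq_iff)
  then show ?thesis
    using annotated_map_eq[OF Td(3) T(2) g] shift_coset_shift_by represents_shift_by_commute[OF Td(3) g]
    by metis
qed

lemma L_group_member:
  fixes A :: "'a::{finite,linorder} tclass"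
  assumes n: "2 \<le> CARD('a)" and A: "A \<in> carrier L_group" and T: "T \<in> A"
  shows "clopen_embedding T" "A = reduced_class T" "\<exists>\<alpha>. annotation T \<alpha>"
proof -
  have AO: "A \<in> carrier O_tilde" and AL: "A \<in> carrier L_tilde"
    using A Units_O_tildeD[of A] by (simp_all add: L_group_def)
  note Tm = O_tilde_member[OF n AO T]
  show "clopen_embedding T" "A = reduced_class T"
    using Tm by simp_all
  have "length_preserving T"
    using AL reduced_class_in_L_tilde[OF n Tm(2)] Tm(3) by simp
  then show "\<exists>\<alpha>. annotation T \<alpha>"
    using annotation_ex[OF clopen_embeddingD(3)[OF Tm(2)]] strongly_connected_if_core Tm(1)
    by (auto simp: reduced_def)
qed

text \<open>On elements of \<open>L_group\<close> the choice is immaterial: all members and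
  annotations give one coset.\<close>

definition automorphism_coset ::
    "'a::{finite,linorder} tclass \<Rightarrow> ((int \<Rightarrow> 'a) \<Rightarrow> (int \<Rightarrow> 'a)) set" where
  "automorphism_coset A = (SOME K. \<exists>T\<in>A. \<exists>\<alpha>. annotation T \<alpha> \<and>
     K = shift_subgroup #>\<^bsub>shift_aut\<^esub> annotated_map T \<alpha>)"

lemma automorphism_coset_eq:
  fixes C :: "('a::{finite,linorder}, 'q) transducer"
  assumes n: "2 \<le> CARD('a)" and A: "reduced_class C \<in> carrier L_group"
    and C: "clopen_embedding C" "annotation C \<gamma>" and f: "represents C \<gamma> f"
  shows "automorphism_coset (reduced_class C) = shift_subgroup #>\<^bsub>shift_aut\<^esub> f"
proof -
  obtain T where T: "T \<in> reduced_class C"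
    by (rule reduced_class_nonempty[OF C(1)])
  obtain \<alpha> where \<alpha>: "annotation T \<alpha>"
    using L_group_member(3)[OF n A T] by blast
  show ?thesis
    unfolding automorphism_coset_def
  proof (rule some_equality)
    show "\<exists>T\<in>reduced_class C. \<exists>\<alpha>. annotation T \<alpha> \<and>
        shift_subgroup #>\<^bsub>shift_aut\<^esub> f = shift_subgroup #>\<^bsub>shift_aut\<^esub> annotated_map T \<alpha>"
      using annotated_map_coset[OF C f T \<alpha>] T \<alpha> by blast
  qed (use annotated_map_coset[OF C f] in blast)
qed

text \<open>That the represented map is an automorphism comes from the inverse in the group, whose
  represented map inverts \<open>f\<close> on both sides up to shifts.\<close>

lemma L_groupE:
  fixes A :: "'a::{finite,linorder} tclass"
  assumes n: "2 \<le> CARD('a)" and A: "A \<in> carrier L_group"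
  obtains T \<alpha> f where "T \<in> A" "clopen_embedding T" "A = reduced_class T" "annotation T \<alpha>"
    "represents T \<alpha> f" "f \<in> carrier shift_aut"
    "automorphism_coset A = shift_subgroup #>\<^bsub>shift_aut\<^esub> f"
proof -
  interpret O: group "O_group :: 'a tclass monoid"
    by (rule group_O_group[OF n])
  have rep: "\<exists>T \<alpha> f. T \<in> A \<and> clopen_embedding T \<and> A = reduced_class T \<and> annotation T \<alpha> \<and> represents T \<alpha> f"
    if A: "A \<in> carrier L_group" for A :: "'a tclass"
  proof -
    have "A \<in> carrier O_tilde"
      using A Units_O_tildeD[of A] by (simp add: L_group_def)
    then obtain S :: "('a, nat) transducer" where S: "clopen_embedding S" "A = reduced_class S"
      by (rule carrier_O_tildeE[OF n]) (rule that)
    obtain T where T: "T \<in> A"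
      unfolding S(2) by (rule reduced_class_nonempty[OF S(1)])
    obtain \<alpha> where "annotation T \<alpha>"
      using L_group_member(3)[OF n A T] by blast
    then show ?thesis
      using represents_ex[OF clopen_embeddingD(3)[OF L_group_member(1)[OF n A T]]]
        L_group_member(1,2)[OF n A T] T by blast
  qed
  have AO: "A \<in> carrier O_group"
    using A by (simp add: L_group_def)
  let ?B = "inv\<^bsub>O_group\<^esub> A"
  have B: "?B \<in> carrier L_group"
    by (rule subgroup.m_inv_closed[OF subgroup_L_group[OF n] A])
  obtain T \<alpha> f where T: "T \<in> A" "clopen_embedding T" "A = reduced_class T" "annotation T \<alpha>"
    and f: "represents T \<alpha> f"
    using rep[OF A] by blast
  obtain U :: "('a, nat) transducer" and \<beta> g where U: "clopen_embedding U" "?B = reduced_class U"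
    "annotation U \<beta>" and g: "represents U \<beta> g"
    using rep[OF B] by blast
  note Td = clopen_embeddingD[OF T(2)] and Ud = clopen_embeddingD[OF U(1)]
  have "reduced_class (tr_product T U) = reduced_class (id_transducer :: ('a, unit) transducer)"
    "reduced_class (tr_product U T) = reduced_class (id_transducer :: ('a, unit) transducer)"
    using O.r_inv[OF AO] O.l_inv[OF AO] mult_O_tilde[OF T(2) U(1)] mult_O_tilde[OF U(1) T(2)]
    by (simp_all flip: T(3) U(2) add: one_O_tilde[OF n])
  then have "tr_equiv (tr_product T U) (id_transducer :: ('a, unit) transducer)"
    "tr_equiv (tr_product U T) (id_transducer :: ('a, unit) transducer)"
    by (simp_all add: reduced_class_eq_iff[OF clopen_embedding_tr_product[OF T(2) U(1)] clopen_embedding_id[OF n]]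
        reduced_class_eq_iff[OF clopen_embedding_tr_product[OF U(1) T(2)] clopen_embedding_id[OF n]])
  then obtain c d where "g \<circ> f = shift_by c" "f \<circ> g = shift_by d"
    using represents_tr_product_id[OF n T(2,4) f U(1,3) g] represents_tr_product_id[OF n U(1,3) g T(2,4) f]
    by blast
  then have "f \<in> carrier shift_aut"
    by (rule represents_shift_aut[OF Td(3) f Ud(3) g])
  then show ?thesis
    using that[OF T f] automorphism_coset_eq[OF n _ T(2,4) f] A T(3) by metis
qed

lemma shift_aut_transducer:
  fixes f :: "(int \<Rightarrow> 'a::{finite,linorder}) \<Rightarrow> (int \<Rightarrow> 'a)"
  assumes n: "2 \<le> CARD('a)" and f: "f \<in> carrier shift_aut"
  obtains C :: "('a, 'a list) transducer" and c where "clopen_embedding C" "length_preserving C"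
    "annotation C (\<lambda>_. 0)" "represents C (\<lambda>_. 0) (shift_by c \<circ> f)"
proof -
  obtain m g where fm: "\<And>x i. shift_by (int m) (f x) i = g (prefix (Suc (2 * m)) (tail x (i - int (2 * m))))"
    "\<And>y y' i. \<forall>j \<le> i + int m. y j = y' j \<Longrightarrow> f y i = f y' i"
    by (rule shift_aut_block_map[OF f]) (rule that)
  obtain h where h: "h \<in> carrier shift_aut" "\<And>x. h (f x) = x" "\<And>x. f (h x) = x"
    by (rule shift_aut_inverse[OF f]) (rule that)
  obtain l g' where hl: "\<And>x i. shift_by (int l) (h x) i = g' (prefix (Suc (2 * l)) (tail x (i - int (2 * l))))"
    "\<And>y y' i. \<forall>j \<le> i + int l. y j = y' j \<Longrightarrow> h y i = h y' i"
    by (rule shift_aut_block_map[OF h(1)]) (rule that)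
  let ?C = "block_transducer (2 * m) g" and ?f = "shift_by (int m) \<circ> f" and ?h = "h \<circ> shift_by (- int m)"
  have fC: "\<And>x i. ?f x i = g (prefix (Suc (2 * m)) (tail x (i - int (2 * m))))"
    by (simp only: comp_apply fm(1))
  have "clopen_embedding ?C"
  \<comment> \<open>At position \<open>i\<close> the inverse of \<open>?f\<close> reads up to
    position \<open>i + l + m\<close>; \<open>Suc\<close> accounts for the strict inequality in the
    hypothesis on the inverse.\<close>
  proof (rule clopen_embedding_block_transducer[where f = ?f and h = ?h and m = "l + Suc m", OF n fC])
    show "?h (?f x) = x" "?f (?h x) = x" for x
      by (simp_all add: h(2,3))
    fix y y' :: "int \<Rightarrow> 'a" and i
    assume "\<And>j. j < i + int (l + Suc m) \<Longrightarrow> y j = y' j"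
    then have "h (shift_by (- int m) y) i = h (shift_by (- int m) y') i"
      by (intro hl(2)) (simp add: shift_by_def)
    then show "?h y i = ?h y' i" by simp
  qed
  then show ?thesis
    by (rule that[OF _ length_preserving_block_transducer annotation_block_transducer
        represents_block_transducer[of ?f g "2 * m", OF fC]])
qed

lemma transducer_of_shift_aut_in_L_group:
  fixes f :: "(int \<Rightarrow> 'a::{finite,linorder}) \<Rightarrow> (int \<Rightarrow> 'a)"
  assumes n: "2 \<le> CARD('a)" and f: "f \<in> carrier shift_aut"
  obtains A where "A \<in> carrier L_group" "automorphism_coset A = shift_subgroup #>\<^bsub>shift_aut\<^esub> f"
proof -
  obtain h where h: "h \<in> carrier shift_aut" "\<And>x. h (f x) = x" "\<And>x. f (h x) = x"
    by (rule shift_aut_inverse[OF f]) (rule that)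
  obtain C :: "('a, 'a list) transducer" and c where C: "clopen_embedding C" "length_preserving C"
    "annotation C (\<lambda>_. 0)" "represents C (\<lambda>_. 0) (shift_by c \<circ> f)"
    by (rule shift_aut_transducer[OF n f]) (rule that)
  obtain D :: "('a, 'a list) transducer" and d where D: "clopen_embedding D" "length_preserving D"
    "annotation D (\<lambda>_. 0)" "represents D (\<lambda>_. 0) (shift_by d \<circ> h)"
    by (rule shift_aut_transducer[OF n h(1)]) (rule that)
  let ?I = "id_transducer :: ('a, unit) transducer"
  \<comment> \<open>Stated for arbitrary data because it is applied in both orders, to show that the
    transducers of \<open>f\<close> and of its inverse are inverse to each other.\<close>
  have prod: "reduced_class P \<otimes>\<^bsub>O_tilde\<^esub> reduced_class Q = \<one>\<^bsub>O_tilde\<^esub>"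
    if P: "clopen_embedding P" "annotation P (\<lambda>_. 0)" "represents P (\<lambda>_. 0) (shift_by c \<circ> f)"
    and Q: "clopen_embedding Q" "annotation Q (\<lambda>_. 0)" "represents Q (\<lambda>_. 0) (shift_by d \<circ> h)"
    and f: "f \<in> carrier shift_aut" and h: "h \<in> carrier shift_aut" "\<And>x. h (f x) = x"
    for P Q :: "('a, 'a list) transducer" and c d f h
  proof -
    note PQ = clopen_embedding_tr_product[OF P(1) Q(1)]
    note Pd = clopen_embeddingD[OF P(1)] and Qd = clopen_embeddingD[OF Q(1)] and PQd = clopen_embeddingD[OF PQ]
      and Id = clopen_embeddingD[OF clopen_embedding_id[OF n]]
    have "(shift_by d \<circ> h) \<circ> (shift_by c \<circ> f) = shift_by (d + c)"
      by (simp add: fun_eq_iff shift_aut_commute[OF h(1)] h(2))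
    then have "represents (tr_product P Q) (\<lambda>(p, q). 0 + 0) (shift_by (d + c))"
      using represents_tr_product[OF Pd(3) Qd(3) P(2,3) Q(3)] by simp
    then have "tr_equiv (tr_product P Q) ?I"
      by (rule tr_equiv_if_represents[OF PQd(3) annotation_tr_product[OF Pd(1) P(2) Q(2)] _ Id(3) annotation_id represents_id])
    then show ?thesis
      using reduced_class_eq_iff[OF PQ clopen_embedding_id[OF n]] mult_O_tilde[OF P(1) Q(1)]
      by (simp add: one_O_tilde[OF n])
  qed
  let ?A = "reduced_class C"
  have "?A \<in> Units O_tilde"
    using prod[OF C(1,3,4) D(1,3,4) f h(1,2)] prod[OF D(1,3,4) C(1,3,4) h(1) f h(3)]
      reduced_class_in_O_tilde[OF n C(1)] reduced_class_in_O_tilde[OF n D(1)]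
    unfolding Units_def by blast
  then have A: "?A \<in> carrier L_group"
    using reduced_class_in_L_tilde[OF n C(1)] C(2) by (simp add: L_group_def)
  have "automorphism_coset ?A = shift_subgroup #>\<^bsub>shift_aut\<^esub> (shift_by c \<circ> f)"
    by (rule automorphism_coset_eq[OF n A C(1,3,4)])
  then show ?thesis
    using that[OF A] shift_coset_shift_by[of f c] shift_aut_commute[OF f] by metis
qed

lemma automorphism_coset_iso:
  assumes n: "2 \<le> CARD('a::{finite,linorder})"
  shows "automorphism_coset \<in> iso (L_group :: 'a tclass monoid) (shift_aut Mod shift_subgroup)"
proof -
  let ?N = "shift_subgroup :: ((int \<Rightarrow> 'a) \<Rightarrow> (int \<Rightarrow> 'a)) set"
  note E = L_groupE[OF n]
  have closed: "automorphism_coset A \<in> rcosets\<^bsub>shift_aut\<^esub> ?N" if A: "A \<in> carrier L_group" for A :: "'a tclass"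
    by (rule E[OF A]) (auto simp: RCOSETS_def)
  have mult: "automorphism_coset (A \<otimes>\<^bsub>O_tilde\<^esub> B) = automorphism_coset A <#>\<^bsub>shift_aut\<^esub> automorphism_coset B"
    if A: "A \<in> carrier L_group" and B: "B \<in> carrier L_group" for A B :: "'a tclass"
  proof -
    obtain T \<alpha> f where T: "T \<in> A" "clopen_embedding T" "A = reduced_class T" "annotation T \<alpha>"
      and f: "represents T \<alpha> f" "f \<in> carrier shift_aut"
      and fA: "automorphism_coset A = ?N #>\<^bsub>shift_aut\<^esub> f"
      by (rule E[OF A]) (rule that)
    obtain U \<beta> g where U: "U \<in> B" "clopen_embedding U" "B = reduced_class U" "annotation U \<beta>"
      and g: "represents U \<beta> g" "g \<in> carrier shift_aut"
      and gB: "automorphism_coset B = ?N #>\<^bsub>shift_aut\<^esub> g"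
      by (rule E[OF B]) (rule that)
    note Td = clopen_embeddingD[OF T(2)] and Ud = clopen_embeddingD[OF U(2)]
    have AB: "A \<otimes>\<^bsub>O_tilde\<^esub> B = reduced_class (tr_product T U)"
      using mult_O_tilde[OF T(2) U(2)] T(3) U(3) by simp
    have "A \<otimes>\<^bsub>O_group\<^esub> B \<in> carrier L_group"
      by (rule subgroup.m_closed[OF subgroup_L_group[OF n] A B])
    then have "reduced_class (tr_product T U) \<in> carrier L_group"
      using AB by simp
    then have "automorphism_coset (A \<otimes>\<^bsub>O_tilde\<^esub> B) = ?N #>\<^bsub>shift_aut\<^esub> (g \<circ> f)"
      unfolding AB by (rule automorphism_coset_eq[OF n _ clopen_embedding_tr_product[OF T(2) U(2)]
          annotation_tr_product[OF Td(1) T(4) U(4)] represents_tr_product[OF Td(3) Ud(3) T(4) f(1) g(1)]])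
    \<comment> \<open>The orders match: both \<open>tr_product T U\<close> and the product of
      \<open>shift_aut\<close> apply the left factor first.\<close>
    also have "\<dots> = automorphism_coset A <#>\<^bsub>shift_aut\<^esub> automorphism_coset B"
      unfolding fA gB using normal.rcos_sum[OF normal_shift_subgroup f(2) g(2)] by simp
    finally show ?thesis .
  qed
  \<comment> \<open>Equal cosets mean that \<open>f\<close> is also represented by the second
    transducer with a shifted annotation, and a map determines its transducer up to
    equivalence.\<close>
  have "inj_on automorphism_coset (carrier (L_group :: 'a tclass monoid))"
  proof (rule inj_onI)
    fix A B :: "'a tclass" assume A: "A \<in> carrier L_group" and B: "B \<in> carrier L_group"
      and eq: "automorphism_coset A = automorphism_coset B"
    obtain T \<alpha> f where T: "T \<in> A" "clopen_embedding T" "A = reduced_class T" "annotation T \<alpha>"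
      and f: "represents T \<alpha> f" "f \<in> carrier shift_aut"
      and fA: "automorphism_coset A = ?N #>\<^bsub>shift_aut\<^esub> f"
      by (rule E[OF A]) (rule that)
    obtain U \<beta> g where U: "U \<in> B" "clopen_embedding U" "B = reduced_class U" "annotation U \<beta>"
      and g: "represents U \<beta> g" "g \<in> carrier shift_aut"
      and gB: "automorphism_coset B = ?N #>\<^bsub>shift_aut\<^esub> g"
      by (rule E[OF B]) (rule that)
    note Td = clopen_embeddingD[OF T(2)] and Ud = clopen_embeddingD[OF U(2)]
    have "shift_by 0 \<circ> f = f"
      by (simp add: fun_eq_iff)
    then have "f \<in> range (\<lambda>k. shift_by k \<circ> f)"
      by (metis rangeI)
    then have "f \<in> ?N #>\<^bsub>shift_aut\<^esub> g"
      using eq fA gB shift_coset_eq[OF shift_aut_commute[OF f(2)]] by simp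
    then obtain k where "f = shift_by k \<circ> g"
      using shift_coset_eq[OF shift_aut_commute[OF g(2)]] by auto
    then have "represents U (\<lambda>q. \<beta> q + k) f"
      using represents_add_const[OF g(1), of k] by (simp add: comp_def)
    then have "tr_equiv T U"
      by (rule tr_equiv_if_represents[OF Td(3) T(4) f(1) Ud(3) annotation_add_const[OF U(4)]])
    then show "A = B"
      using T(3) U(3) reduced_class_cong[OF _ Td(1) Ud(1)] by simp
  qed
  moreover have "automorphism_coset ` carrier (L_group :: 'a tclass monoid) = rcosets\<^bsub>shift_aut\<^esub> ?N"
  proof
    show "automorphism_coset ` carrier (L_group :: 'a tclass monoid) \<subseteq> rcosets\<^bsub>shift_aut\<^esub> ?N"
      using closed by blast
    show "rcosets\<^bsub>shift_aut\<^esub> ?N \<subseteq> automorphism_coset ` carrier (L_group :: 'a tclass monoid)"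
    proof
      fix K assume "K \<in> rcosets\<^bsub>shift_aut\<^esub> ?N"
      then obtain f where f: "f \<in> carrier shift_aut" "K = ?N #>\<^bsub>shift_aut\<^esub> f"
        by (auto simp: RCOSETS_def)
      obtain A where "A \<in> carrier L_group" "automorphism_coset A = ?N #>\<^bsub>shift_aut\<^esub> f"
        by (rule transducer_of_shift_aut_in_L_group[OF n f(1)]) (rule that)
      then show "K \<in> automorphism_coset ` carrier (L_group :: 'a tclass monoid)"
        using f(2) by blast
    qed
  qed
  ultimately show ?thesis
    using closed mult by (auto simp: iso_def hom_def bij_betw_def FactGroup_def L_group_def)
qed

section \<open>The periodic orbit representation\<close>

lemma shift_orbit_eq: "shift_orbit x = range (\<lambda>k. shift_by k x)"
  unfolding shift_orbit_def shift_subgroup_eq by blast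

lemma shift_orbit_eq_if_same:
  assumes "same_orbit u v"
  shows "shift_orbit (periodic_word u) = shift_orbit (periodic_word v)"
proof -
  have "shift_orbit (periodic_word u) \<subseteq> shift_orbit (periodic_word v)" if "same_orbit u v" for u v :: "'a list"
    using that unfolding same_orbit_def shift_orbit_eq by auto
  then show ?thesis
    using assms same_orbit_sym by blast
qed

lemma periodic_orbits_eq: "periodic_orbits = (\<lambda>w. shift_orbit (periodic_word w)) ` {w. prime_word w}"
proof
  show "(periodic_orbits :: (int \<Rightarrow> 'a) set set) \<subseteq> (\<lambda>w. shift_orbit (periodic_word w)) ` {w. prime_word w}"
  proof
    fix Q :: "(int \<Rightarrow> 'a) set" assume "Q \<in> periodic_orbits"
    then obtain x where x: "Q = shift_orbit x" "periodic_point x"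
      by (auto simp: periodic_orbits_def)
    then obtain p where p: "0 < p" "shift_by (int p) x = x"
      by (auto simp: periodic_point_def shift_map_funpow)
    note l = least_period[OF p]
    define w where "w = prefix (least_period x) (tail x 0)"
    have w: "periodic_word w = x"
      using l by (intro periodic_word_eqI) (auto simp: w_def)
    have "w \<noteq> []" "length w = least_period x"
      using l(1) by (simp_all add: w_def)
    then have "prime_word w"
      using prime_word_iff_least_period[of w] w by simp
    then show "Q \<in> (\<lambda>w. shift_orbit (periodic_word w)) ` {w. prime_word w}"
      using x(1) w by auto
  qed
  show "(\<lambda>w. shift_orbit (periodic_word w)) ` {w. prime_word w} \<subseteq> (periodic_orbits :: (int \<Rightarrow> 'a) set set)"
  proof (rule image_subsetI)
    fix w :: "'a list" assume "w \<in> {w. prime_word w}"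
    then have "0 < length w"
      by (simp add: prime_word_def)
    then have "periodic_point (periodic_word w)"
      unfolding periodic_point_def shift_map_funpow using shift_by_periodic_word[of 1 w]
      by (intro exI[of _ "length w"]) simp
    then show "shift_orbit (periodic_word w) \<in> periodic_orbits"
      by (auto simp: periodic_orbits_def)
  qed
qed

lemma orbit_cyclic_word_eq:
  assumes w: "prime_word w"
  shows "orbit_cyclic_word (shift_orbit (periodic_word w)) = cyclic_word w"
proof -
  have wne: "w \<noteq> []"
    using w by (simp add: prime_word_def)
  have *: "cyclic_word (map x [0..int (least_period x) - 1]) = cyclic_word w"
    if x: "x \<in> shift_orbit (periodic_word w)" for x
  proof -
    obtain k where k: "x = shift_by k (periodic_word w)"
      using x by (auto simp: shift_orbit_eq)
    have lp: "least_period x = length w"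
      using w prime_word_iff_least_period[OF wne] by (simp add: k least_period_shift_by)
    define u where "u = map x [0..int (least_period x) - 1]"
    have len: "length u = length w"
      by (simp add: u_def lp)
    have "periodic_word u = x"
    proof (rule periodic_word_eqI)
      have "shift_by (int (length w)) x = x"
        unfolding k shift_by_commute[of "int (length w)"] using shift_by_periodic_word[of 1 w] by simp
      then show "shift_by (int (length u)) x = x"
        by (simp add: len)
      show "x (int j) = u ! j" if "j < length u" for j
        using that by (simp add: u_def)
      show "u \<noteq> []"
        using len wne by auto
    qed
    moreover have "u \<noteq> []"
      using len wne by auto
    moreover from calculation have "prime_word u"
      using prime_word_iff_least_period[of u] len lp by simp
    moreover have "same_orbit u w"
      using calculation(1) k by (auto simp: same_orbit_def)
    ultimately show ?thesis
      using cyclic_word_eq_if_same_orbit w by (simp add: u_def)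
  qed
  have "shift_by 0 (periodic_word w) \<in> shift_orbit (periodic_word w)"
    unfolding shift_orbit_eq by (rule rangeI)
  then show ?thesis
    unfolding orbit_cyclic_word_def using * by (intro the_equality) auto
qed

lemma inj_orbit_cyclic_word: "inj_on orbit_cyclic_word periodic_orbits"
proof (rule inj_onI)
  fix P Q :: "(int \<Rightarrow> 'a) set"
  assume "P \<in> periodic_orbits" "Q \<in> periodic_orbits" and eq: "orbit_cyclic_word P = orbit_cyclic_word Q"
  then obtain u v where uv: "P = shift_orbit (periodic_word u)" "prime_word u"
    "Q = shift_orbit (periodic_word v)" "prime_word v"
    by (auto simp: periodic_orbits_eq)
  then have "cyclic_word u = cyclic_word v"
    using eq by (simp add: orbit_cyclic_word_eq)
  then have "same_orbit u v"
    using cyclic_word_member(2)[OF uv(4), of u] self_in_cyclic_word[of u] by simp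
  then show "P = Q"
    using shift_orbit_eq_if_same uv by blast
qed

text \<open>As \<open>f\<close> commutes with shifts, its value at one point of an orbit determines
  the image orbit.\<close>

lemma orbit_permutation_eq:
  assumes f: "f \<in> carrier shift_aut" and w: "prime_word w" and v: "prime_word v"
    and fw: "f (periodic_word w) = shift_by k (periodic_word v)"
  shows "orbit_permutation f (cyclic_word w) = cyclic_word v"
proof -
  let ?P = "shift_orbit (periodic_word w)"
  have "?P \<in> periodic_orbits"
    using w by (auto simp: periodic_orbits_eq)
  then have "inv_into periodic_orbits orbit_cyclic_word (cyclic_word w) = ?P"
    using inv_into_f_f[OF inj_orbit_cyclic_word] orbit_cyclic_word_eq[OF w] by metis
  moreover have "f ` ?P = shift_orbit (periodic_word v)"
  proof -
    have "f ` ?P = range (\<lambda>j. shift_by (j + k) (periodic_word v))"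
      by (auto simp: shift_orbit_eq image_image shift_aut_commute[OF f] fw)
    also have "\<dots> = shift_orbit (periodic_word v)"
    proof -
      have "shift_by j (periodic_word v) \<in> range (\<lambda>j. shift_by (j + k) (periodic_word v))" for j
        by (rule range_eqI[of _ _ "j - k"]) simp
      then show ?thesis
        unfolding shift_orbit_eq by auto
    qed
    finally show ?thesis .
  qed
  moreover have "cyclic_word w \<in> prime_cyclic_words"
    using w by (simp add: prime_cyclic_words_def)
  ultimately show ?thesis
    by (simp add: orbit_permutation_def orbit_cyclic_word_eq[OF v])
qed

text \<open>Each member of the coset maps the periodic word of \<open>w\<close> to a shift of that
  of the loop output, which lies in the orbit of the prime word given by
  \<open>cyclic_action\<close>.\<close>

lemma cyclic_action_eq_periodic_orbit_rep:
  fixes A :: "'a::{finite,linorder} tclass"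
  assumes n: "2 \<le> CARD('a)" and A: "A \<in> carrier L_group"
  shows "cyclic_action A = periodic_orbit_rep (automorphism_coset A)"
proof -
  obtain T \<alpha> f where T: "T \<in> A" "clopen_embedding T" "A = reduced_class T" "annotation T \<alpha>"
    and f: "represents T \<alpha> f" "f \<in> carrier shift_aut"
    and fA: "automorphism_coset A = shift_subgroup #>\<^bsub>shift_aut\<^esub> f"
    by (rule L_groupE[OF n A]) (rule that)
  note Td = clopen_embeddingD[OF T(2)]
  have coset: "automorphism_coset A = range (\<lambda>k. shift_by k \<circ> f)"
    unfolding fA by (rule shift_coset_eq[OF shift_aut_commute[OF f(2)]])
  have *: "orbit_permutation g = cyclic_action A" if g: "g \<in> automorphism_coset A" for g
  proof -
    obtain k where k: "g = shift_by k \<circ> f"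
      using g coset by auto
    have gaut: "g \<in> carrier shift_aut"
      using monoid.m_closed[OF group.is_monoid[OF group_shift_aut] f(2) shift_by_in_shift_aut[of k]]
      by (simp add: k)
    show ?thesis
    proof (rule extensionalityI[OF _ cyclic_action_extensional])
      show "orbit_permutation g \<in> extensional prime_cyclic_words"
        by (simp add: orbit_permutation_def)
      fix c :: "'a list set" assume "c \<in> prime_cyclic_words"
      then obtain w where w: "prime_word w" "c = cyclic_word w"
        by (auto simp: prime_cyclic_words_def)
      then have wne: "w \<noteq> []"
        by (simp add: prime_word_def)
      obtain v where v: "prime_word v" "same_orbit v (loop_out T w)"
        "cyclic_action (reduced_class T) (cyclic_word w) = cyclic_word v"
        by (rule cyclic_action_ex[OF T(2) w(1)]) (rule that)
      obtain i where "f (periodic_word w) = shift_by i (periodic_word (loop_out T w))"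
        using represents_periodic_word[OF Td(3) T(4) f(1) wne] by blast
      moreover obtain j where "periodic_word (loop_out T w) = shift_by j (periodic_word v)"
        using same_orbit_sym[OF v(2)] by (auto simp: same_orbit_def)
      ultimately have "g (periodic_word w) = shift_by (k + (i + j)) (periodic_word v)"
        by (simp add: k)
      then show "orbit_permutation g c = cyclic_action A c"
        using orbit_permutation_eq[OF gaut w(1) v(1)] v(3) w(2) T(3) by simp
    qed
  qed
  moreover have "shift_by 0 \<circ> f \<in> automorphism_coset A"
    unfolding coset by (rule rangeI)
  ultimately show ?thesis
    unfolding periodic_orbit_rep_def by (intro the_equality[symmetric]) auto
qed

theorem theorem1p4:
  fixes r :: nat
  assumes "1 \<le> r" and "r < CARD('a::{finite,linorder})"
  shows "group_hom (Or_group r :: 'a tclass monoid) (right_sym_group prime_cyclic_words)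
           cyclic_action \<and>
         (Or_group (CARD('a) - 1) :: 'a tclass monoid) = O_group \<and>
         subgroup (carrier (L_group :: 'a tclass monoid)) (Or_group (CARD('a) - 1)) \<and>
         (\<exists>\<Phi> \<in> iso (L_group :: 'a tclass monoid) (shift_aut Mod shift_subgroup).
            (\<forall>A \<in> carrier L_group. \<forall>T \<in> A.
               (\<exists>\<alpha>. annotation T \<alpha>) \<and>
               (\<forall>\<alpha>. annotation T \<alpha> \<longrightarrow>
                  \<Phi> A = shift_subgroup #>\<^bsub>shift_aut\<^esub> annotated_map T \<alpha>)) \<and>
            (\<forall>A \<in> carrier L_group. cyclic_action A = periodic_orbit_rep (\<Phi> A)))"
proof -
  have n: "2 \<le> CARD('a)"
    using assms by linarith
  have "automorphism_coset A = shift_subgroup #>\<^bsub>shift_aut\<^esub> annotated_map T \<alpha>"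
    if A: "A \<in> carrier L_group" and T: "T \<in> A" and \<alpha>: "annotation T \<alpha>" for A :: "'a tclass" and T \<alpha>
  proof -
    note Tm = L_group_member[OF n A T]
    obtain f where f: "represents T \<alpha> f"
      using represents_ex[OF clopen_embeddingD(3)[OF Tm(1)] \<alpha>] by blast
    then show ?thesis
      using automorphism_coset_eq[OF n _ Tm(1) \<alpha> f] A Tm(2)
        annotated_map_eq[OF clopen_embeddingD(3)[OF Tm(1)] \<alpha> f] by simp
  qed
  then show ?thesis
    using cyclic_action_group_hom[OF n, of r] Or_group_full subgroup_L_group[OF n]
      automorphism_coset_iso[OF n] L_group_member(3)[OF n] cyclic_action_eq_periodic_orbit_rep[OF n]
    by (intro conjI bexI[of _ automorphism_coset]) auto
qed

end
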